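(* I) A discrete sequence $\Lambda=\{\lambda_n\}\subset\mathbb{R}$ is a zero set of a Hamburger entire function if and only if $\Lambda$ is a balanced zero density sequence whose characteristic sequence $P=\{p_n\}$ satisfies $$\lim_{|n|\to\infty}\frac{\log|\lambda_n|}{p_n}=0.$$ If $\Lambda$ is such a sequence then there exists a unique, up to a constant multiple, Hamburger entire function $F$ with the zero set $\Lambda$. The function $F$ is given by the formula $F=\dfrac{\mathrm{const}}{K\mu}$, where $\mu$ is a finite discrete measure concentrated on $\Lambda$, $$\mu=\sum_n(-1)^n\exp(p_n)\,\delta_{\lambda_n}.$$ II) A discrete sequence $\Lambda=\{\lambda_n\}\subset\mathbb{R}$ is a zero set of a Krein entire function of exponential type zero if and only if $\Lambda$ is a balanced zero density sequence whose characteristic sequence $P=\{p_n\}$ satisfies $$\sum_n\exp(p_n)<\infty.$$ If $\Lambda$ is such a sequence then there exists a unique, up to a constant multiple, zero type Krein entire function $F$ with the zero set $\Lambda$. The function $F$ is given by the formula $F=\dfrac{\mathrm{const}}{K\mu}$, where $\mu$ is a finite discrete measure concentrated on $\Lambda$, $$\mu=\sum_n(-1)^n\exp(p_n)\,\delta_{\lambda_n}.$$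
   Context: **Classes of entire functions.** The Hamburger class consists of all transcendental (non-polynomial) entire functions $F$ of exponential type zero that are real on $\mathbb{R}$, have only real simple zeros $\{\lambda_n\}\subset\mathbb{R}$ and satisfy $\lim_{|n|\to\infty}\frac{|\lambda_n|^a}{|F'(\lambda_n)|}=0$ for all $a>0$. The Krein class of zero-type entire functions is defined in the same way with the last condition replaced by $\sum_n\frac1{|F'(\lambda_n)|}<\infty$. $\Lambda$ is a zero set of $F$ if $\{F=0\}=\Lambda$. **Cauchy integral.** For a finite measure $\mu$ on $\mathbb{R}$, $K\mu(z)=\frac1\pi\int\frac{1}{t-z}\,d\mu(t)$, $z\notin\operatorname{supp}\mu$. $\delta_\lambda$ is the unit point mass at $\lambda$. A measure is discrete if it is supported on a discrete sequence. **Sequences.** A discrete sequence is an infinite sequence of distinct real numbers without finite accumulation points. It is always enumerated in the natural order: $\lambda_n<\lambda_{n+1}$, non-negative elements have non-negative integer indices and negative elements have negative indices. So a sequence unbounded in both directions is indexed by $\mathbb{Z}$ with $\lambda_{-1}<0\le\lambda_0$; a sequence bounded from below is indexed by $n\ge -N$, where $N$ is the number of its negative elements; a sequence bounded from above is indexed by $n<N$, where $N$ is the number of its non-negative elements. Sums and limits over $n$ or $k$ run only over indices that occur. $\Lambda$ has upper density $d$ if $\limsup_{A\to\infty}\#[\Lambda\cap(-A,A)]/(2A)=d$; it has zero density if $d=0$. A discrete sequence $\Lambda=\{\lambda_n\}$ is balanced if the limit $\lim_{N\to\infty}\sum_{|n|<N}\frac{\lambda_n}{1+\lambda_n^2}$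 exists. If $\Lambda$ is balanced and of finite upper density, its characteristic sequence $P=\{p_n\}$ is $$p_n=\frac12\left[\log(1+\lambda_n^2)+\lim_{N\to\infty}\sum_{0<|n-k|<N}\log\frac{1+\lambda_k^2}{(\lambda_k-\lambda_n)^2}\right].$$ (For a sequence of finite upper density, the limit exists for every $n$ if and only if it exists for some $n$, if and only if the sequence is balanced.)
   Formalization: In part I the condition lim log|λ_n|/p_n = 0 is supplemented by the requirement that p_n < 0 for all large |n|; without it the "if" direction fails, e.g. for Λ = {2^n, 2^n + exp(-e^n)}, where p_n tends to +∞. *)

theory Defs
  imports
    "HOL-Complex_Analysis.Complex_Analysis"
    "HOL-Computational_Algebra.Polynomial"
begin

section \<open>Discrete sequences\<close>

text \<open>
  A discrete sequence is a family \<open>lam\<close> over an index set \<open>I\<close> of integers; values of \<open>lam\<close> outside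
  \<open>I\<close> are irrelevant. The three shapes of \<open>I\<close> are: unbounded in both directions, bounded from below,
  bounded from above. Because the sign of an element agrees with the sign of its index, the \<open>N\<close> in
  the last two shapes is the number of negative, respectively non-negative, elements.
\<close>

definition discrete_sequence :: "int set \<Rightarrow> (int \<Rightarrow> real) \<Rightarrow> bool" where
  "discrete_sequence I lam \<longleftrightarrow>
     (I = UNIV \<or> (\<exists>N::nat. I = {- int N..}) \<or> (\<exists>N::nat. I = {..<int N})) \<and>
     strict_mono_on I lam \<and>
     (\<forall>n\<in>I. 0 \<le> lam n \<longleftrightarrow> 0 \<le> n) \<and>
     (\<forall>x. \<not> x islimpt (lam ` I))"

text \<open>The filter for limits as \<open>\<bar>n\<bar>\<close> tends to infinity over the indices \<open>n \<in> I\<close>.\<close>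

definition index_at_infinity :: "int set \<Rightarrow> int filter" where
  "index_at_infinity I = inf (filtercomap (\<lambda>n. \<bar>n\<bar>) at_top) (principal I)"

definition upper_density :: "real set \<Rightarrow> ereal" where
  "upper_density L = Limsup at_top (\<lambda>A::real. ereal (real (card (L \<inter> {-A<..<A})) / (2 * A)))"

definition zero_density :: "real set \<Rightarrow> bool" where
  "zero_density L \<longleftrightarrow> upper_density L = 0"

definition balanced :: "int set \<Rightarrow> (int \<Rightarrow> real) \<Rightarrow> bool" where
  "balanced I lam \<longleftrightarrow>
     convergent (\<lambda>N::nat. \<Sum>n\<in>{n\<in>I. \<bar>n\<bar> < int N}. lam n / (1 + (lam n)\<^sup>2))"

text \<open>Only meaningful when the limit exists, in particular for balanced sequences of finite upper
  density.\<close>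

definition characteristic_sequence :: "int set \<Rightarrow> (int \<Rightarrow> real) \<Rightarrow> int \<Rightarrow> real" where
  "characteristic_sequence I lam n =
     1/2 * (ln (1 + (lam n)\<^sup>2) +
       lim (\<lambda>N::nat. \<Sum>k\<in>{k\<in>I. 0 < \<bar>n - k\<bar> \<and> \<bar>n - k\<bar> < int N}.
                        ln ((1 + (lam k)\<^sup>2) / (lam k - lam n)\<^sup>2)))"

section \<open>Classes of entire functions\<close>

text \<open>The infimum is \<open>\<infinity>\<close> if \<open>F\<close> is not of exponential type.\<close>

definition exponential_type :: "(complex \<Rightarrow> complex) \<Rightarrow> ereal" where
  "exponential_type F =
     Inf {ereal a | a. 0 \<le> a \<and> (\<exists>C. \<forall>z. norm (F z) \<le> C * exp (a * norm z))}"

definition transcendental_entire :: "(complex \<Rightarrow> complex) \<Rightarrow> bool" where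
  "transcendental_entire F \<longleftrightarrow> F holomorphic_on UNIV \<and> (\<nexists>p. \<forall>z. F z = poly p z)"

definition has_zero_set :: "(complex \<Rightarrow> complex) \<Rightarrow> real set \<Rightarrow> bool" where
  "has_zero_set F L \<longleftrightarrow> {z. F z = 0} = complex_of_real ` L"

text \<open>
  The conditions shared by the two classes, with the zeros of \<open>F\<close> enumerated by \<open>lam\<close> over \<open>I\<close>. A
  transcendental entire function of exponential type zero has infinitely many zeros, so requiring a
  discrete sequence here excludes nothing; the enumeration is determined by \<open>F\<close>.
\<close>

definition zero_type_real_simple_zeros ::
    "(complex \<Rightarrow> complex) \<Rightarrow> int set \<Rightarrow> (int \<Rightarrow> real) \<Rightarrow> bool" where
  "zero_type_real_simple_zeros F I lam \<longleftrightarrow>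
     transcendental_entire F \<and> exponential_type F = 0 \<and>
     (\<forall>x. F (complex_of_real x) \<in> \<real>) \<and>
     discrete_sequence I lam \<and> has_zero_set F (lam ` I) \<and>
     (\<forall>n\<in>I. deriv F (complex_of_real (lam n)) \<noteq> 0)"

definition hamburger_class :: "(complex \<Rightarrow> complex) set" where
  "hamburger_class = {F. \<exists>I lam. zero_type_real_simple_zeros F I lam \<and>
     (\<forall>a>0. ((\<lambda>n. \<bar>lam n\<bar> powr a / norm (deriv F (complex_of_real (lam n)))) \<longlongrightarrow> 0)
              (index_at_infinity I))}"

definition krein_zero_type_class :: "(complex \<Rightarrow> complex) set" where
  "krein_zero_type_class = {F. \<exists>I lam. zero_type_real_simple_zeros F I lam \<and>
     (\<lambda>n. 1 / norm (deriv F (complex_of_real (lam n)))) summable_on I}"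

section \<open>Finite signed measures and the Cauchy integral\<close>

text \<open>
  A finite signed measure on the Borel sets of the line is a countably additive real-valued set
  function. Integration is with respect to its Jordan decomposition; note that \<open>ennreal\<close> sends
  negative reals to 0, and the empty set contributes 0 to the suprema anyway.
\<close>

definition finite_signed_measure :: "(real set \<Rightarrow> real) \<Rightarrow> bool" where
  "finite_signed_measure m \<longleftrightarrow> m {} = 0 \<and>
     (\<forall>B :: nat \<Rightarrow> real set. range B \<subseteq> sets borel \<longrightarrow> disjoint_family B \<longrightarrow>
        (\<lambda>i. m (B i)) sums m (\<Union>i. B i))"

definition positive_variation :: "(real set \<Rightarrow> real) \<Rightarrow> real measure" where
  "positive_variation m = measure_of UNIV (sets borel)
     (\<lambda>B. SUP A\<in>{A\<in>sets borel. A \<subseteq> B}. ennreal (m A))"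

definition negative_variation :: "(real set \<Rightarrow> real) \<Rightarrow> real measure" where
  "negative_variation m = positive_variation (\<lambda>B. - m B)"

definition signed_integral :: "(real set \<Rightarrow> real) \<Rightarrow> (real \<Rightarrow> complex) \<Rightarrow> complex" where
  "signed_integral m f =
     (LINT t|positive_variation m. f t) - (LINT t|negative_variation m. f t)"

definition cauchy_integral :: "(real set \<Rightarrow> real) \<Rightarrow> complex \<Rightarrow> complex" where
  "cauchy_integral m z =
     1 / complex_of_real pi * signed_integral m (\<lambda>t. 1 / (complex_of_real t - z))"

definition concentrated_on :: "(real set \<Rightarrow> real) \<Rightarrow> real set \<Rightarrow> bool" where
  "concentrated_on m L \<longleftrightarrow> (\<forall>B\<in>sets borel. B \<inter> L = {} \<longrightarrow> m B = 0)"

definition unit_point_mass :: "real \<Rightarrow> real set \<Rightarrow> real" where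
  "unit_point_mass x B = indicator B x"

definition characteristic_measure :: "int set \<Rightarrow> (int \<Rightarrow> real) \<Rightarrow> real set \<Rightarrow> real" where
  "characteristic_measure I lam B =
     (\<Sum>\<^sub>\<infinity>n\<in>I. (-1) powi n * exp (characteristic_sequence I lam n) * unit_point_mass (lam n) B)"

section \<open>The conditions and the conclusion\<close>

text \<open>
  The limit alone does not determine the sign of \<open>p\<^sub>n\<close>: for very close pairs of points (such as
  \<open>2\<^sup>n\<close> and \<open>2\<^sup>n + exp (- exp n)\<close>, for positive \<open>n\<close>) the \<open>p\<^sub>n\<close> tend to \<open>+\<infinity>\<close> fast enough for the limit
  to be 0, although the exponentials of the \<open>p\<^sub>n\<close>, which are \<open>const / \<bar>F' (lam n)\<bar>\<close>, are unbounded.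
  The limit is meant with \<open>p\<^sub>n\<close> tending to \<open>-\<infinity>\<close>, whence the first conjunct.
\<close>

definition hamburger_condition :: "int set \<Rightarrow> (int \<Rightarrow> real) \<Rightarrow> bool" where
  "hamburger_condition I lam \<longleftrightarrow>
     (\<forall>\<^sub>F n in index_at_infinity I. characteristic_sequence I lam n < 0) \<and>
     ((\<lambda>n. ln \<bar>lam n\<bar> / characteristic_sequence I lam n) \<longlongrightarrow> 0) (index_at_infinity I)"

definition krein_condition :: "int set \<Rightarrow> (int \<Rightarrow> real) \<Rightarrow> bool" where
  "krein_condition I lam \<longleftrightarrow> (\<lambda>n. exp (characteristic_sequence I lam n)) summable_on I"

definition unique_up_to_constant ::
    "(complex \<Rightarrow> complex) set \<Rightarrow> real set \<Rightarrow> bool" where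
  "unique_up_to_constant S L \<longleftrightarrow>
     (\<exists>F\<in>S. has_zero_set F L) \<and>
     (\<forall>F\<in>S. \<forall>G\<in>S. has_zero_set F L \<longrightarrow> has_zero_set G L \<longrightarrow> (\<exists>c. \<forall>z. G z = c * F z))"

text \<open>
  The identity \<open>F = const / K\<mu>\<close> is asserted off \<open>L\<close>, where \<open>K\<mu>\<close> is defined. As \<open>F\<close> has no zero there
  and \<open>x / 0 = 0\<close>, it includes \<open>K\<mu> z \<noteq> 0\<close>.
\<close>

definition constant_over_cauchy_integral ::
    "(complex \<Rightarrow> complex) \<Rightarrow> (real set \<Rightarrow> real) \<Rightarrow> real set \<Rightarrow> bool" where
  "constant_over_cauchy_integral F m L \<longleftrightarrow>
     (\<exists>c. \<forall>z. z \<notin> complex_of_real ` L \<longrightarrow> F z = c / cauchy_integral m z)"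

end

theory Submission
  imports Defs
begin

text \<open>
  An entire function \<open>F\<close> of zero type is determined by its zeros up to a constant. Dividing \<open>F\<close> by the
  product over its zeros in the disc of radius \<open>R\<close> leaves a function without zeros there and of size
  \<open>exp (o(R))\<close>, so by the Borel--Caratheodory inequality its logarithm is \<open>o(1)\<close> on compact sets
  (\<open>zero_type_factorization\<close>). The same division bounds the number of zeros, which gives zero
  density. As then \<open>n = o(lam n)\<close>, the zeros in a disc may be replaced by the zeros with indices in
  \<open>\<bar>m - n\<bar> < N\<close> (\<open>zero_type_window_factorization\<close>).

  All products are normalized at \<open>\<i>\<close>, which is never a zero; the factors \<open>(lam k - z) / (lam k - \<i>)\<close>
  have absolute value \<open>\<bar>lam k - z\<bar> / sqrt (1 + (lam k)\<^sup>2)\<close>, as in the characteristic sequence. Hence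
  \<open>\<bar>F' (lam n)\<bar> = \<bar>F \<i>\<bar> exp (- p\<^sub>n)\<close> (\<open>exp_characteristic_sequence\<close>), which turns the conditions on \<open>F'\<close>
  into conditions on the \<open>p\<^sub>n\<close>. The logarithmic derivative at \<open>\<i>\<close> shows that the sequence is balanced.

  Conversely, if the sequence is balanced and of zero density, then the products converge, and
  their limit is of zero type: for the far factors the logarithms are summed, where balance
  controls the terms of first order, and for the near factors a crude bound suffices because there
  are few of them (\<open>window_limit_enumerated_zeros\<close>).

  Finally, let \<open>1 / \<bar>F' (lam n)\<bar>\<close> be summable, which in the Hamburger case follows from the decay
  condition with exponent 2. The difference of \<open>1 / F\<close> and its partial fraction series is entire. It is a
  quotient of two functions of zero type, hence of zero type, and it tends to 0 along the imaginary
  axis; so it vanishes by a Phragmen--Lindelof principle and the theorem of Liouville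
  (\<open>partial_fractions\<close>). Since the \<open>F' (lam n)\<close> alternate in sign, the series is a constant multiple of the
  Cauchy integral of the characteristic measure.
\<close>

section \<open>Entire functions of zero exponential type\<close>

text \<open>Exponential type zero, in the form of explicit bounds.\<close>

definition zero_type :: "(complex \<Rightarrow> complex) \<Rightarrow> bool" where
  "zero_type f \<longleftrightarrow> f holomorphic_on UNIV \<and> (\<forall>e>0. \<exists>C. \<forall>z. norm (f z) \<le> C * exp (e * norm z))"

lemma exp_mult_at_top: "c > 0 \<Longrightarrow> filterlim (\<lambda>R::real. exp (c * R)) at_top at_top"
  by (intro filterlim_compose[OF exp_at_top] filterlim_tendsto_pos_mult_at_top[OF tendsto_const])
    (auto simp: filterlim_ident)

lemma zero_type_eventually_bound:
  assumes "zero_type f" "e > 0" "c > 0"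
  shows "\<forall>\<^sub>F R in at_top. \<forall>z. norm z \<le> c * R \<longrightarrow> norm (f z) \<le> exp (e * R)"
proof -
  obtain C where C: "\<And>z. norm (f z) \<le> C * exp (e / (2 * c) * norm z)"
    using assms unfolding zero_type_def by (metis divide_pos_pos mult_pos_pos zero_less_numeral)
  have "filterlim (\<lambda>R. exp (e / 2 * R)) at_top at_top"
    using assms by (intro exp_mult_at_top) simp
  then have "\<forall>\<^sub>F R in at_top. \<bar>C\<bar> \<le> exp (e / 2 * R)"
    by (simp add: filterlim_at_top)
  then show ?thesis
  proof eventually_elim
    case (elim R)
    show ?case
    proof (intro allI impI)
      fix z :: complex assume z: "norm z \<le> c * R"
      have "norm (f z) \<le> \<bar>C\<bar> * exp (e / (2 * c) * norm z)"
        by (rule order_trans[OF C]) (auto intro: mult_right_mono)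
      also have "\<dots> \<le> exp (e / 2 * R) * exp (e / (2 * c) * (c * R))"
        using elim z assms by (intro mult_mono) (auto simp: field_simps)
      also have "\<dots> = exp (e * R)"
        using assms by (simp add: exp_add[symmetric] field_simps)
      finally show "norm (f z) \<le> exp (e * R)" .
    qed
  qed
qed

lemma factor_out_zeros:
  assumes "finite A" "0 \<notin> A" "f holomorphic_on UNIV" "\<And>a. a \<in> A \<Longrightarrow> f a = 0"
  shows "\<exists>g. g holomorphic_on UNIV \<and> (\<forall>w::complex. f w = (\<Prod>a\<in>A. 1 - w / a) * g w)"
  using assms
proof (induction A rule: finite_induct)
  case empty
  then show ?case by auto
next
  case (insert a A)
  then obtain g where g: "g holomorphic_on UNIV" "\<And>w. f w = (\<Prod>b\<in>A. 1 - w / b) * g w"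
    by auto
  have a0: "a \<noteq> 0" using insert by auto
  have "(\<Prod>b\<in>A. 1 - a / b) \<noteq> 0"
    using insert by (auto simp: prod_zero_iff)
  with g(2)[of a] insert have ga: "g a = 0" by auto
  define h where "h = (\<lambda>z. if z = a then deriv g a else (g z - g a) / (z - a))"
  have h: "h holomorphic_on UNIV" unfolding h_def
    by (rule pole_lemma[OF g(1)]) auto
  have "g w = (1 - w / a) * (- a * h w)" for w
    using a0 ga by (auto simp: h_def field_simps)
  moreover have "(\<lambda>w. - a * h w) holomorphic_on UNIV"
    by (intro holomorphic_intros h)
  ultimately show ?case
    using insert g(2) by (intro exI[of _ "\<lambda>w. - a * h w"]) (auto simp: mult_ac)
qed

text \<open>
  Dividing out zeros in the disc of radius \<open>R\<close> gains a factor 2 for each of them on the circle of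
  radius \<open>3 R\<close>, hence everywhere inside it.
\<close>

lemma bound_after_division:
  assumes "finite A" "A \<subseteq> ball 0 R - {0}" "R > 0" "g holomorphic_on UNIV"
    and f: "\<And>w::complex. f w = (\<Prod>a\<in>A. 1 - w / a) * g w"
    and M: "\<And>w. norm w \<le> 3 * R \<Longrightarrow> norm (f w) \<le> M" and w: "norm w \<le> 3 * R"
  shows "norm (g w) \<le> M / 2 ^ card A"
proof (rule maximum_modulus_frontier[where f = g and S = "cball 0 (3 * R)"])
  show "g holomorphic_on interior (cball 0 (3 * R))"
    using assms holomorphic_on_subset by blast
  show "continuous_on (closure (cball 0 (3 * R))) g"
    using assms holomorphic_on_imp_continuous_on continuous_on_subset by blast
  fix z :: complex assume "z \<in> frontier (cball 0 (3 * R))"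
  then have z: "norm z = 3 * R" using \<open>R > 0\<close> by (simp add: frontier_cball)
  have "2 ^ card A \<le> (\<Prod>a\<in>A. norm (1 - z / a))"
  proof -
    have "2 \<le> norm (1 - z / a)" if "a \<in> A" for a
    proof -
      have a: "0 < norm a" "norm a < R" using that assms by auto
      have "3 \<le> norm (z / a)" using a z by (simp add: norm_divide field_simps)
      also have "\<dots> \<le> norm (1 - z / a) + norm (1::complex)"
        by (metis norm_triangle_ineq4 norm_minus_commute diff_add_cancel add_diff_cancel_left' diff_diff_eq2)
      finally show ?thesis by simp
    qed
    then have "(\<Prod>a\<in>A. (2::real)) \<le> (\<Prod>a\<in>A. norm (1 - z / a))"
      by (intro prod_mono) auto
    then show ?thesis by simp
  qed
  then have "2 ^ card A * norm (g z) \<le> norm (f z)"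
    by (simp add: f norm_mult prod_norm mult_right_mono)
  also have "\<dots> \<le> M" using M z by simp
  finally show "norm (g z) \<le> M / 2 ^ card A"
    by (simp add: field_simps)
qed (use w in auto)

text \<open>The Borel--Caratheodory inequality, for the logarithm of a function without zeros.\<close>

lemma Borel_Caratheodory_log:
  assumes "R > 0" "A > 0" and hol: "g holomorphic_on ball 0 R"
    and nz: "\<And>w. w \<in> ball 0 R \<Longrightarrow> g w \<noteq> 0" and g0: "g 0 = 1"
    and bd: "\<And>w. w \<in> ball 0 R \<Longrightarrow> norm (g w) \<le> exp A"
  shows "\<exists>h. h holomorphic_on ball 0 R \<and>
           (\<forall>w\<in>ball 0 R. g w = exp (h w) \<and> norm (h w) \<le> 4 * A * norm w / (R - norm w))"
proof -
  obtain h0 where h0: "h0 holomorphic_on ball 0 R" "\<And>w. w \<in> ball 0 R \<Longrightarrow> g w = exp (h0 w)"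
    using contractible_imp_holomorphic_log[OF hol convex_imp_contractible nz] by auto
  define h where "h w = h0 w - h0 0" for w
  have "exp (h0 0) = 1" using h0(2)[of 0] g0 \<open>R > 0\<close> by simp
  then have gh: "g w = exp (h w)" if "w \<in> ball 0 R" for w
    using h0(2)[OF that] by (simp add: h_def exp_diff)
  have h: "h holomorphic_on ball 0 R" unfolding h_def
    by (intro holomorphic_intros h0)
  have Re: "Re (h w) \<le> A" if "w \<in> ball 0 R" for w
    using bd[OF that] by (simp add: gh[OF that])
  have lt: "norm (h w) < norm (4 * of_real A - h w)" if "w \<in> ball 0 R" for w
  proof (rule power2_less_imp_less)
    have "(norm (4 * of_real A - h w))\<^sup>2 - (norm (h w))\<^sup>2 = 8 * A * (2 * A - Re (h w))"
      unfolding cmod_power2 by (simp add: power2_eq_square algebra_simps)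
    also have "\<dots> > 0" using Re[OF that] \<open>A > 0\<close> by simp
    finally show "(norm (h w))\<^sup>2 < (norm (4 * of_real A - h w))\<^sup>2" by simp
  qed auto
  have "norm (h w) \<le> 4 * A * norm w / (R - norm w)" if w: "w \<in> ball 0 R" for w
  proof -
    define p where "p z = h (of_real R * z) / (4 * of_real A - h (of_real R * z))" for z
    have inb: "complex_of_real R * z \<in> ball 0 R" if "norm z < 1" for z
      using that \<open>R > 0\<close> by (simp add: norm_mult)
    have hR: "(\<lambda>z. h (of_real R * z)) holomorphic_on ball 0 1"
      by (rule holomorphic_on_compose_gen[of "\<lambda>z. of_real R * z" "ball 0 1" h "ball 0 R", unfolded o_def])
        (use h inb in \<open>auto intro!: holomorphic_intros\<close>)
    have nz4: "4 * of_real A - h w \<noteq> 0" if "w \<in> ball 0 R" for w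
      using lt[OF that] by force
    have "p holomorphic_on ball 0 1" unfolding p_def
      using nz4[OF inb] by (intro holomorphic_intros hR) auto
    moreover have "p 0 = 0" by (simp add: p_def h_def)
    moreover have "norm (p z) < 1" if "norm z < 1" for z
      using lt[OF inb[OF that]] nz4[OF inb[OF that]] by (simp add: p_def norm_divide divide_less_eq)
    moreover have "norm (w / of_real R) < 1" using w \<open>R > 0\<close> by (simp add: norm_divide)
    ultimately have "norm (p (w / of_real R)) \<le> norm (w / of_real R)"
      using Schwarz_Lemma(1) by blast
    then have "norm (h w) / norm (4 * of_real A - h w) \<le> norm w / R"
      using \<open>R > 0\<close> by (simp add: p_def norm_divide)
    then have "norm (h w) * R \<le> norm w * norm (4 * of_real A - h w)"
      using \<open>R > 0\<close> nz4[OF w] by (simp add: field_simps)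
    also have "\<dots> \<le> norm w * (4 * A + norm (h w))"
      using \<open>A > 0\<close> norm_triangle_ineq4[of "4 * of_real A" "h w"]
      by (intro mult_left_mono) (auto simp: norm_mult)
    finally have "norm (h w) * (R - norm w) \<le> 4 * A * norm w"
      by (simp add: algebra_simps)
    then show ?thesis using w by (simp add: pos_le_divide_eq)
  qed
  then show ?thesis using h gh by blast
qed

text \<open>The zeros in an open disc around the origin; multiplicities are not recorded.\<close>

definition zeros_within :: "(complex \<Rightarrow> complex) \<Rightarrow> real \<Rightarrow> complex set" where
  "zeros_within f R = {a. f a = 0 \<and> norm a < R}"

lemma finite_zeros_within:
  assumes "f holomorphic_on UNIV" "f c \<noteq> 0"
  shows "finite (zeros_within f R)"
proof (cases "f constant_on UNIV")
  case True
  with assms(2) have "f z \<noteq> 0" for z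
    by (metis UNIV_I constant_on_def)
  then show ?thesis by (simp add: zeros_within_def)
next
  case False
  then have "finite {z \<in> cball 0 R. f z = 0}"
    by (intro holomorphic_compact_finite_zeros[OF assms(1)]) auto
  then show ?thesis
    by (rule rev_finite_subset) (auto simp: zeros_within_def)
qed

text \<open>
  After division by the zeros in the disc of radius \<open>R\<close>, a function of zero type is the exponential of a
  function that is at most \<open>e\<close> times the distance to the origin.
\<close>

lemma zero_type_factorization:
  assumes zt: "zero_type f" and f0: "f 0 = 1" and simple: "\<forall>a. f a = 0 \<longrightarrow> deriv f a \<noteq> 0"
    and "e > 0"
  shows "\<forall>\<^sub>F R in at_top. real (card (zeros_within f R)) \<le> e * R \<and>
           (\<exists>g h. g holomorphic_on UNIV \<and> (\<forall>w. f w = (\<Prod>a\<in>zeros_within f R. 1 - w / a) * g w) \<and>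
              h holomorphic_on ball 0 (R/2) \<and>
              (\<forall>w\<in>ball 0 (R/2). g w = exp (h w) \<and> norm (h w) \<le> e * norm w))"
proof -
  define d where "d = e / 8"
  have d: "d > 0" using \<open>e > 0\<close> by (simp add: d_def)
  have "\<forall>\<^sub>F R in at_top. \<forall>z. norm z \<le> 3 * R \<longrightarrow> norm (f z) \<le> exp (d * R)"
    by (rule zero_type_eventually_bound[OF zt d]) simp
  then show ?thesis
    using eventually_gt_at_top[of 0]
  proof eventually_elim
    case (elim R)
    have hol: "f holomorphic_on UNIV" using zt by (simp add: zero_type_def)
    define A where "A = zeros_within f R"
    have fin: "finite A" using finite_zeros_within[OF hol, of 0] f0 by (simp add: A_def)
    have A: "A \<subseteq> ball 0 R - {0}" using f0 by (auto simp: A_def zeros_within_def)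
    have A0: "0 \<notin> A" and Af: "\<And>a. a \<in> A \<Longrightarrow> f a = 0"
      using A by (auto simp: A_def zeros_within_def)
    obtain g where g: "g holomorphic_on UNIV" "\<And>w. f w = (\<Prod>a\<in>A. 1 - w / a) * g w"
      using factor_out_zeros[OF fin A0 hol Af] by blast
    have g0: "g 0 = 1" using g(2)[of 0] f0 by simp
    have bd: "norm (g w) \<le> exp (d * R) / 2 ^ card A" if "norm w \<le> 3 * R" for w
      using bound_after_division[OF fin A _ g(1) g(2)] elim that by simp
    have "2 ^ card A \<le> exp (d * R)"
      using bd[of 0] g0 elim by simp
    then have "ln (2 ^ card A) \<le> ln (exp (d * R))"
      by (intro ln_mono) auto
    then have "ln (2 ^ card A) \<le> d * R" by simp
    moreover have "ln (2::real) \<ge> 1/2"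
      using ln_ge_iff[of 2 "1/2"] exp_half_le2 by simp
    ultimately have "real (card A) * (1/2) \<le> d * R"
      by (smt (verit) ln_realpow mult_left_mono of_nat_0_le_iff)
    then have card: "real (card A) \<le> e * R" using elim \<open>e > 0\<close> by (simp add: d_def)
    have nz: "g w \<noteq> 0" if "w \<in> ball 0 R" for w
    proof
      assume gw: "g w = 0"
      then have w: "w \<in> A" using g(2)[of w] that by (simp add: A_def zeros_within_def)
      have "(f has_field_derivative
              ((\<Prod>a\<in>A. 1 - w / a) * deriv g w + deriv (\<lambda>w. \<Prod>a\<in>A. 1 - w / a) w * g w)) (at w)"
        unfolding ext[of f, OF g(2)]
        by (intro DERIV_mult' holomorphic_derivI[OF g(1)] holomorphic_derivI[of _ UNIV] holomorphic_intros)
          (use A in auto)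
      moreover have "(\<Prod>a\<in>A. 1 - w / a) = 0"
        using w fin A by (subst prod_zero_iff) (auto intro!: bexI[of _ w])
      ultimately have "deriv f w = 0" using gw by (simp add: DERIV_imp_deriv)
      then show False using simple w by (simp add: A_def zeros_within_def)
    qed
    have bd': "norm (g w) \<le> exp (d * R)" if "w \<in> ball 0 R" for w
    proof -
      have "norm (g w) \<le> exp (d * R) / 2 ^ card A" using bd[of w] that elim by simp
      also have "\<dots> \<le> exp (d * R) / 1" by (intro divide_left_mono) auto
      finally show ?thesis by simp
    qed
    have "\<exists>h. h holomorphic_on ball 0 R \<and>
        (\<forall>w\<in>ball 0 R. g w = exp (h w) \<and> norm (h w) \<le> 4 * (d * R) * norm w / (R - norm w))"
      by (rule Borel_Caratheodory_log)
        (use elim d nz bd' g0 holomorphic_on_subset[OF g(1) subset_UNIV] in auto)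
    then obtain h where h: "h holomorphic_on ball 0 R" "\<And>w. w \<in> ball 0 R \<Longrightarrow>
        g w = exp (h w) \<and> norm (h w) \<le> 4 * (d * R) * norm w / (R - norm w)"
      by blast
    have "norm (h w) \<le> e * norm w" if w: "w \<in> ball 0 (R/2)" for w
    proof -
      have "norm (h w) \<le> 4 * (d * R) * norm w / (R - norm w)" using h(2)[of w] w elim by simp
      also have "\<dots> \<le> 4 * (d * R) * norm w / (R / 2)"
        using w elim d by (intro divide_left_mono mult_pos_pos) auto
      also have "\<dots> = e * norm w" using elim by (simp add: d_def field_simps)
      finally show ?thesis .
    qed
    moreover have "h holomorphic_on ball 0 (R/2)"
      by (rule holomorphic_on_subset[OF h(1)]) (use elim in auto)
    ultimately show ?case using card g h(2) elim unfolding A_def[symmetric]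
      by (intro conjI exI[of _ g] exI[of _ h] ballI allI) auto
  qed
qed

section \<open>Quotients and a Phragmen--Lindelof principle\<close>

lemma zero_typeI:
  assumes hol: "f holomorphic_on UNIV" and "c > 0"
    and ev: "\<And>e. e > 0 \<Longrightarrow> \<forall>\<^sub>F R in at_top. \<forall>z. norm z \<le> c * R \<longrightarrow> norm (f z) \<le> exp (e * R)"
  shows "zero_type f"
  unfolding zero_type_def
proof (intro conjI allI impI hol)
  fix e :: real assume "e > 0"
  then obtain R0 where R0: "\<And>R z. R \<ge> R0 \<Longrightarrow> norm z \<le> c * R \<Longrightarrow> norm (f z) \<le> exp (e * c * R)"
    using ev[of "e * c"] \<open>c > 0\<close> by (auto simp: eventually_at_top_linorder)
  have "norm (f z) \<le> exp (e * c * \<bar>R0\<bar>) * exp (e * norm z)" for z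
  proof -
    have "norm z \<le> c * max R0 (norm z / c)"
      using \<open>c > 0\<close> by (simp add: max_def field_simps)
    then have "norm (f z) \<le> exp (e * c * max R0 (norm z / c))"
      by (intro R0) auto
    also have "e * c * max R0 (norm z / c) \<le> e * c * (\<bar>R0\<bar> + norm z / c)"
      using \<open>c > 0\<close> \<open>e > 0\<close> by (intro mult_left_mono) (auto simp: max_def intro: add_increasing2 add_increasing)
    also have "\<dots> = e * c * \<bar>R0\<bar> + e * norm z"
      using \<open>c > 0\<close> by (simp add: field_simps)
    finally show ?thesis by (simp add: exp_add)
  qed
  then show "\<exists>C. \<forall>z. norm (f z) \<le> C * exp (e * norm z)" by blast
qed

text \<open>
  If \<open>G = f * H\<close> and \<open>P\<close> is the product over the zeros of \<open>f\<close> in a disc, then \<open>f = P * exp h\<close> with \<open>h\<close>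
  small, and the function \<open>G / P = exp h * H\<close> is not larger than \<open>G\<close> on a bigger disc.
\<close>

lemma zero_type_quotient:
  assumes zt: "zero_type f" and f0: "f 0 = 1" and simple: "\<forall>a. f a = 0 \<longrightarrow> deriv f a \<noteq> 0"
    and ztG: "zero_type G" and hol: "H holomorphic_on UNIV" and G: "\<And>w. G w = f w * H w"
  shows "zero_type H"
proof (rule zero_typeI[OF hol, of "1/4"])
  fix e :: real assume "e > 0"
  define d where "d = e / 2"
  have d: "d > 0" using \<open>e > 0\<close> by (simp add: d_def)
  note fac = zero_type_factorization[OF zt f0 simple d]
  have "\<forall>\<^sub>F R in at_top. \<forall>z. norm z \<le> 3 * R \<longrightarrow> norm (G z) \<le> exp (d * R)"
    by (rule zero_type_eventually_bound[OF ztG d]) simp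
  then show "\<forall>\<^sub>F R in at_top. \<forall>z. norm z \<le> 1 / 4 * R \<longrightarrow> norm (H z) \<le> exp (e * R)"
    using fac eventually_gt_at_top[of 0]
  proof eventually_elim
    case (elim R)
    define A where "A = zeros_within f R"
    from elim obtain g h where g: "g holomorphic_on UNIV"
      and fg: "\<And>w. f w = (\<Prod>a\<in>A. 1 - w / a) * g w"
      and h: "\<And>w. w \<in> ball 0 (R/2) \<Longrightarrow> g w = exp (h w) \<and> norm (h w) \<le> d * norm w"
      unfolding A_def by blast
    have fin: "finite A" unfolding A_def
      by (rule finite_zeros_within[of f 0]) (use zt f0 in \<open>auto simp: zero_type_def\<close>)
    have A: "A \<subseteq> ball 0 R - {0}" using f0 by (auto simp: A_def zeros_within_def)
    have gH: "(\<lambda>w. g w * H w) holomorphic_on UNIV" by (intro holomorphic_intros g hol)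
    show ?case
    proof (intro allI impI)
      fix z :: complex assume z: "norm z \<le> 1 / 4 * R"
      have "norm (g z * H z) \<le> exp (d * R) / 2 ^ card A"
        by (rule bound_after_division[OF fin A _ gH, of G]) (use elim z fg G in auto)
      also have "\<dots> \<le> exp (d * R) / 1" by (intro divide_left_mono) auto
      finally have "exp (Re (h z)) * norm (H z) \<le> exp (d * R)"
        using h[of z] z elim by (simp add: norm_mult)
      moreover have "- (d * R) \<le> Re (h z)"
      proof -
        have "norm (h z) \<le> d * norm z" using h[of z] z elim by simp
        also have "\<dots> \<le> d * R" using d z elim by (intro mult_left_mono) auto
        finally show ?thesis using abs_Re_le_cmod[of "h z"] by linarith
      qed
      then have "exp (- (d * R)) * norm (H z) \<le> exp (Re (h z)) * norm (H z)"
        by (intro mult_right_mono) auto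
      ultimately have "exp (- (d * R)) * norm (H z) \<le> exp (d * R)" by linarith
      then have "norm (H z) \<le> exp (d * R) * exp (d * R)"
        by (simp add: exp_minus field_simps)
      then show "norm (H z) \<le> exp (e * R)"
        by (simp add: exp_add[symmetric] d_def mult.commute)
    qed
  qed
qed simp

text \<open>
  A Phragmen--Lindelof principle. On the half disc of radius \<open>R\<close> the harmonic function
  \<open>Re (2 w - w\<^sup>2 / R)\<close> is nonnegative on the diameter and at least \<open>R\<close> on the arc, whereas at
  a fixed point it stays bounded as \<open>R\<close> grows.
\<close>

lemma zero_type_half_plane_bound:
  assumes zt: "zero_type f" and M: "M > 0" "\<And>y. norm (f (\<i> * of_real y)) \<le> M" and z: "Re z \<ge> 0"
  shows "norm (f z) \<le> M"
proof -
  have bd: "norm (f z) \<le> M * exp (e * (2 * Re z + norm z))" if "e > 0" for e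
  proof -
    have "\<forall>\<^sub>F R in at_top. \<forall>w. norm w \<le> 1 * R \<longrightarrow> norm (f w) \<le> exp (e / 2 * R)"
      by (rule zero_type_eventually_bound[OF zt]) (use that in auto)
    moreover have "filterlim (\<lambda>R. exp (e / 2 * R)) at_top at_top"
      using that by (intro exp_mult_at_top) simp
    then have "\<forall>\<^sub>F R in at_top. 1 / M \<le> exp (e / 2 * R)"
      by (simp add: filterlim_at_top)
    ultimately have "\<forall>\<^sub>F R in at_top. (\<forall>w. norm w \<le> 1 * R \<longrightarrow> norm (f w) \<le> exp (e / 2 * R)) \<and>
        1 / M \<le> exp (e / 2 * R) \<and> R > norm z"
      using eventually_gt_at_top[of "norm z"] by eventually_elim auto
    then obtain R where R: "\<And>w. norm w \<le> R \<Longrightarrow> norm (f w) \<le> exp (e / 2 * R)"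
      "1 / M \<le> exp (e / 2 * R)" "R > norm z"
      by (auto simp: eventually_at_top_linorder)
    have Rpos: "R > 0" using R(3) norm_ge_zero[of z] by linarith
    have fR: "norm (f w) \<le> M * exp (e * R)" if "norm w \<le> R" for w
    proof -
      have "norm (f w) \<le> exp (e / 2 * R)" by (rule R(1)[OF that])
      also have "\<dots> \<le> (M * exp (e / 2 * R)) * exp (e / 2 * R)"
        using R(2) M(1) mult_right_mono[of 1 "M * exp (e / 2 * R)" "exp (e / 2 * R)"]
        by (simp add: field_simps)
      also have "\<dots> = M * exp (e * R)" by (simp add: exp_add[symmetric])
      finally show ?thesis .
    qed
    define g where "g w = f w * exp (- (of_real e * (2 * w - w\<^sup>2 / of_real R)))" for w
    define S where "S = cball 0 R \<inter> {w. Re w \<ge> 0}"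
    have fhol: "f holomorphic_on T" for T
      using zt holomorphic_on_subset by (auto simp: zero_type_def)
    have ghol: "g holomorphic_on T" for T
      unfolding g_def using Rpos by (intro holomorphic_intros fhol) auto
    have clS: "closed S" unfolding S_def by (intro closed_Int closed_cball closed_halfspace_Re_ge)
    have nexp: "norm (g w) = norm (f w) * exp (- (e * (2 * Re w - Re (w\<^sup>2) / R)))" for w
      by (simp add: g_def norm_mult)
    have "norm (g z) \<le> M"
    proof (rule maximum_modulus_frontier[where f = g and S = S])
      fix w assume w: "w \<in> frontier S"
      have wS: "w \<in> S" using w clS frontier_subset_closed by blast
      have "ball 0 R \<inter> {w. Re w > 0} \<subseteq> interior S"
        by (rule interior_maximal) (auto simp: S_def open_halfspace_Re_gt intro!: open_Int)
      then have "w \<notin> ball 0 R \<inter> {w. Re w > 0}" using w by (auto simp: frontier_def)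
      with wS consider "norm w = R" "Re w \<ge> 0" | "Re w = 0" by (fastforce simp: S_def)
      then show "norm (g w) \<le> M"
      proof cases
        case 1
        have w2: "(Re w)\<^sup>2 + (Im w)\<^sup>2 = R\<^sup>2" using 1 by (metis cmod_power2)
        have "Re w \<le> R" using 1 complex_Re_le_cmod[of w] by simp
        have "R \<le> 2 * Re w - Re (w\<^sup>2) / R"
        proof -
          have "2 * Re w - Re (w\<^sup>2) / R - R = 2 * Re w * (R - Re w) / R"
            using w2 Rpos by (simp add: field_simps power2_eq_square)
          also have "\<dots> \<ge> 0" using 1 \<open>Re w \<le> R\<close> Rpos by simp
          finally show ?thesis by simp
        qed
        then have "exp (- (e * (2 * Re w - Re (w\<^sup>2) / R))) \<le> exp (- (e * R))"
          using \<open>e > 0\<close> by simp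
        then have "norm (g w) \<le> (M * exp (e * R)) * exp (- (e * R))"
          unfolding nexp using fR[of w] 1 M by (intro mult_mono) auto
        then show ?thesis by (simp add: exp_minus field_simps)
      next
        case 2
        then have "w = \<i> * of_real (Im w)" by (simp add: complex_eq_iff)
        then have "norm (f w) \<le> M" using M(2) by metis
        moreover have "exp (- (e * (2 * Re w - Re (w\<^sup>2) / R))) \<le> 1"
          using 2 \<open>e > 0\<close> Rpos by (simp add: power2_eq_square)
        ultimately show ?thesis unfolding nexp
          using mult_mono[of "norm (f w)" M _ 1] M by auto
      qed
    qed (use z R(3) clS in \<open>auto simp: S_def intro!: ghol holomorphic_on_imp_continuous_on bounded_Int\<close>)
    then have "norm (f z) \<le> M * exp (e * (2 * Re z - Re (z\<^sup>2) / R))"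
      unfolding nexp exp_minus by (simp add: field_simps)
    also have "e * (2 * Re z - Re (z\<^sup>2) / R) \<le> e * (2 * Re z + norm z)"
    proof -
      have "- Re (z\<^sup>2) \<le> norm z * norm z"
        using abs_Re_le_cmod[of "z * z"] unfolding norm_mult power2_eq_square by linarith
      also have "\<dots> \<le> norm z * R" using R(3) by (intro mult_left_mono) auto
      finally have "- Re (z\<^sup>2) / R \<le> norm z" using Rpos by (simp add: field_simps)
      then show ?thesis using that by (intro mult_left_mono) auto
    qed
    finally show ?thesis using M by simp
  qed
  have "((\<lambda>e. M * exp (e * (2 * Re z + norm z))) \<longlongrightarrow> M * exp (0 * (2 * Re z + norm z))) (at_right 0)"
    by (intro tendsto_intros)
  then have "norm (f z) \<le> M * exp (0 * (2 * Re z + norm z))"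
    by (rule tendsto_lowerbound) (auto intro: eventually_mono[OF eventually_at_right_less bd])
  then show ?thesis by simp
qed

lemma zero_type_vanishing_at_imaginary_infinity:
  assumes zt: "zero_type f" and M: "\<And>y. norm (f (\<i> * of_real y)) \<le> M"
    and lim: "((\<lambda>y. f (\<i> * of_real y)) \<longlongrightarrow> 0) at_top"
  shows "f z = 0"
proof -
  define B where "B = \<bar>M\<bar> + 1"
  have B: "B > 0" "norm (f (\<i> * of_real y)) \<le> B" for y
    using M[of y] by (auto simp: B_def)
  have zt': "zero_type (\<lambda>w. f (- w))"
  proof -
    have "(\<lambda>w. f (- w)) holomorphic_on UNIV"
      by (rule holomorphic_on_compose_gen[of uminus UNIV f UNIV, unfolded o_def])
        (use zt in \<open>auto simp: zero_type_def intro!: holomorphic_intros\<close>)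
    then show ?thesis using zt by (auto simp: zero_type_def) (metis norm_minus_cancel)
  qed
  have bd: "norm (f w) \<le> B" for w
  proof (cases "Re w \<ge> 0")
    case True
    then show ?thesis using zero_type_half_plane_bound[OF zt] B by blast
  next
    case False
    have "norm (f (- (\<i> * of_real y))) \<le> B" for y
      using B(2)[of "- y"] by simp
    then show ?thesis
      using zero_type_half_plane_bound[OF zt' B(1), of "- w"] False by simp
  qed
  have const: "f w = f 0" for w
    using Liouville_polynomial[of f 0 B 0 w] zt bd by (simp add: zero_type_def)
  have "((\<lambda>y. f 0) \<longlongrightarrow> 0) (at_top :: real filter)"
    using lim by (subst (asm) const) simp
  then have "f 0 = 0" by (simp add: tendsto_const_iff)
  then show ?thesis using const by simp
qed

section \<open>Partial fractions of the reciprocal\<close>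

lemma zero_type_shift:
  assumes "zero_type F"
  shows "zero_type (\<lambda>w. c * F (w + a))"
  unfolding zero_type_def
proof (intro conjI allI impI)
  have "(\<lambda>w. F (w + a)) holomorphic_on UNIV"
    by (rule holomorphic_on_compose_gen[of "\<lambda>w. w + a" UNIV F UNIV, unfolded o_def])
      (use assms in \<open>auto simp: zero_type_def intro!: holomorphic_intros\<close>)
  then show "(\<lambda>w. c * F (w + a)) holomorphic_on UNIV" by (intro holomorphic_intros)
  fix e :: real assume "e > 0"
  then obtain C where C: "\<And>z. norm (F z) \<le> C * exp (e * norm z)"
    using assms by (auto simp: zero_type_def)
  have "norm (c * F (w + a)) \<le> norm c * \<bar>C\<bar> * exp (e * norm a) * exp (e * norm w)" for w
  proof -
    have "norm (F (w + a)) \<le> \<bar>C\<bar> * exp (e * norm (w + a))"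
      by (rule order_trans[OF C]) (auto intro: mult_right_mono)
    also have "\<dots> \<le> \<bar>C\<bar> * exp (e * norm a + e * norm w)"
      using \<open>e > 0\<close> norm_triangle_ineq[of w a]
      by (intro mult_left_mono) (auto simp: distrib_left[symmetric])
    finally show ?thesis
      by (simp add: norm_mult exp_add mult_left_mono mult.assoc)
  qed
  then show "\<exists>C. \<forall>w. norm (c * F (w + a)) \<le> C * exp (e * norm w)" by blast
qed

text \<open>Where no factor of the product is less than 1, each factor alone is a lower bound.\<close>

lemma zero_type_lower_bound:
  assumes zt: "zero_type f" and f0: "f 0 = 1" and simple: "\<forall>a. f a = 0 \<longrightarrow> deriv f a \<noteq> 0"
    and a: "f a = 0" and ge: "\<And>b. f b = 0 \<Longrightarrow> 1 \<le> norm (1 - w / b)"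
  shows "norm (1 - w / a) \<le> norm (f w)"
proof -
  have bd: "norm (1 - w / a) * exp (- (e * norm w)) \<le> norm (f w)" if "e > 0" for e
  proof -
    have "\<exists>R. (real (card (zeros_within f R)) \<le> e * R \<and>
           (\<exists>g h. g holomorphic_on UNIV \<and> (\<forall>w. f w = (\<Prod>a\<in>zeros_within f R. 1 - w / a) * g w) \<and>
              h holomorphic_on ball 0 (R/2) \<and>
              (\<forall>w\<in>ball 0 (R/2). g w = exp (h w) \<and> norm (h w) \<le> e * norm w))) \<and>
        R > norm a \<and> R > 2 * norm w"
      by (rule eventually_happens'[OF trivial_limit_at_top_linorder], intro eventually_conj
          zero_type_factorization[OF zt f0 simple that] eventually_gt_at_top)
    then obtain R g h where R: "R > norm a" "R > 2 * norm w"
      and fg: "\<forall>w. f w = (\<Prod>a\<in>zeros_within f R. 1 - w / a) * g w"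
      and gh: "\<And>w. w \<in> ball 0 (R/2) \<Longrightarrow> g w = exp (h w) \<and> norm (h w) \<le> e * norm w"
      by blast
    have "finite (zeros_within f R)"
      by (rule finite_zeros_within[of f 0]) (use zt f0 in \<open>auto simp: zero_type_def\<close>)
    moreover have "a \<in> zeros_within f R" using a R by (simp add: zeros_within_def)
    ultimately have "(\<Prod>b\<in>zeros_within f R. norm (1 - w / b)) =
        norm (1 - w / a) * (\<Prod>b\<in>zeros_within f R - {a}. norm (1 - w / b))"
      by (rule prod.remove)
    moreover have "1 \<le> (\<Prod>b\<in>zeros_within f R - {a}. norm (1 - w / b))"
      by (intro prod_ge_1 ge) (auto simp: zeros_within_def)
    ultimately have "norm (1 - w / a) \<le> (\<Prod>b\<in>zeros_within f R. norm (1 - w / b))"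
      using mult_left_mono[of 1 _ "norm (1 - w / a)"] by fastforce
    moreover have "exp (- (e * norm w)) \<le> norm (g w)"
    proof -
      have "w \<in> ball 0 (R/2)" using R by simp
      from gh[OF this] have "g w = exp (h w)" "norm (h w) \<le> e * norm w" by auto
      moreover have "- norm (h w) \<le> Re (h w)" using abs_Re_le_cmod[of "h w"] by linarith
      ultimately show ?thesis by simp
    qed
    ultimately show ?thesis
      unfolding fg[rule_format, of w] norm_mult prod_norm[symmetric] by (intro mult_mono) (auto intro: prod_nonneg)
  qed
  have "((\<lambda>e. norm (1 - w / a) * exp (- (e * norm w))) \<longlongrightarrow>
      norm (1 - w / a) * exp (- (0 * norm w))) (at_right 0)"
    by (intro tendsto_intros)
  then have "norm (1 - w / a) * exp (- (0 * norm w)) \<le> norm (f w)"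
    by (rule tendsto_upperbound) (auto intro: eventually_mono[OF eventually_at_right_less bd])
  then show ?thesis by simp
qed

text \<open>At a zero of \<open>f\<close> the quotient takes the value given by the rule of de l'Hospital.\<close>

lemma entire_division:
  assumes f: "f holomorphic_on UNIV" and g: "g holomorphic_on UNIV"
    and simple: "\<forall>a::complex. f a = 0 \<longrightarrow> deriv f a \<noteq> 0" and zero: "\<And>a. f a = 0 \<Longrightarrow> g a = 0"
  shows "\<exists>H. H holomorphic_on UNIV \<and> (\<forall>w. g w = f w * H w)"
proof -
  define H where "H w = (if f w = 0 then deriv g w / deriv f w else g w / f w)" for w
  have "H field_differentiable at x" for x
  proof -
    have "\<exists>q r. q holomorphic_on UNIV \<and> r holomorphic_on UNIV \<and> q x \<noteq> 0 \<and>
        (\<forall>w. q w \<noteq> 0 \<longrightarrow> H w = r w / q w)"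
    proof (cases "f x = 0")
      case True
      define q where "q w = (if w = x then deriv f x else (f w - f x) / (w - x))" for w
      define r where "r w = (if w = x then deriv g x else (g w - g x) / (w - x))" for w
      have "q holomorphic_on UNIV" unfolding q_def[abs_def] by (rule pole_lemma[OF f]) auto
      moreover have "r holomorphic_on UNIV" unfolding r_def[abs_def] by (rule pole_lemma[OF g]) auto
      moreover have "q x \<noteq> 0" using True simple by (simp add: q_def)
      moreover have "H w = r w / q w" if "q w \<noteq> 0" for w
      proof (cases "w = x")
        case True
        then show ?thesis using \<open>f x = 0\<close> by (simp add: H_def q_def r_def)
      next
        case False
        then show ?thesis using that True zero[OF True] by (simp add: H_def q_def r_def)
      qed
      ultimately show ?thesis by (intro exI[of _ q] exI[of _ r]) simp
    next
      case False
      then show ?thesis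
        by (intro exI[of _ f] exI[of _ g]) (simp add: H_def f g)
    qed
    then obtain q r where q: "q holomorphic_on UNIV" "q x \<noteq> 0"
      and r: "r holomorphic_on UNIV" "\<And>w. q w \<noteq> 0 \<Longrightarrow> H w = r w / q w" by blast
    let ?S = "{w. q w \<noteq> 0}"
    have "continuous_on UNIV q" using q holomorphic_on_imp_continuous_on by blast
    then have "open ?S"
      using open_Collect_neq[of q "\<lambda>_. 0"] by (simp add: continuous_on_const)
    moreover have "(\<lambda>w. r w / q w) holomorphic_on ?S"
      using holomorphic_on_subset[OF q(1)] holomorphic_on_subset[OF r(1)]
      by (intro holomorphic_intros) auto
    then have "H holomorphic_on ?S"
      by (rule holomorphic_transform) (auto simp: r)
    ultimately show ?thesis using q(2) by (simp add: holomorphic_on_open field_differentiable_def)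
  qed
  then have "H holomorphic_on UNIV"
    by (simp add: holomorphic_on_def field_differentiable_at_within)
  moreover have "g w = f w * H w" for w using zero by (auto simp: H_def)
  ultimately show ?thesis by blast
qed

text \<open>
  The difference of \<open>1 / f\<close> and its partial fraction series is an entire function of zero type,
  because it is the quotient of two functions of zero type, and it tends to 0 along the imaginary
  axis. The zeros lie on the line \<open>Im = -1\<close> since real zeros are translated by \<open>-\<i>\<close>.
\<close>

lemma partial_fractions:
  assumes zt: "zero_type f" and f0: "f 0 = 1" and simple: "\<forall>a. f a = 0 \<longrightarrow> deriv f a \<noteq> 0"
    and Im: "\<And>a. f a = 0 \<Longrightarrow> Im a = -1" and ex: "f a0 = 0"
    and sm: "(\<lambda>a. 1 / norm (deriv f a)) summable_on {a. f a = 0}"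
    and z: "f z \<noteq> 0"
  shows "1 / f z = (\<Sum>\<^sub>\<infinity>a\<in>{a. f a = 0}. 1 / (deriv f a * (z - a)))"
proof -
  define Z where "Z = {a. f a = 0}"
  have hol: "f holomorphic_on UNIV" using zt by (simp add: zero_type_def)
  define q where "q a w = (if w = a then deriv f a else (f w - f a) / (w - a))" for a w
  have q: "q a holomorphic_on UNIV" for a
    unfolding q_def[abs_def] by (rule pole_lemma[OF hol]) auto
  have qeq: "q a w = f w / (w - a)" if "f a = 0" "w \<noteq> a" for a w
    using that by (simp add: q_def)
  define S where "S = (\<Sum>\<^sub>\<infinity>a\<in>Z. 1 / norm (deriv f a))"
  have sm': "(\<lambda>a. 1 / norm (deriv f a)) summable_on Z" using sm by (simp add: Z_def)
  have S0: "S \<ge> 0" unfolding S_def by (intro infsum_nonneg) auto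
  have qbd: "norm (q a w) \<le> B" if a: "f a = 0" and B: "\<And>v. norm (v - w) \<le> 2 \<Longrightarrow> norm (f v) \<le> B" for a w B
  proof -
    \<comment> \<open>near \<open>a\<close>, the bound comes from the circle of radius 1 around \<open>a\<close>\<close>
    have far: "norm (q a v) \<le> B" if "norm (v - a) \<ge> 1" "norm (v - w) \<le> 2" for v
    proof -
      have "norm (q a v) = norm (f v) / norm (v - a)"
        using that by (subst qeq[OF a]) (auto simp: norm_divide)
      also have "\<dots> \<le> norm (f v) / 1" using that by (intro divide_left_mono) auto
      finally show ?thesis using B[OF that(2)] by simp
    qed
    show ?thesis
    proof (cases "norm (w - a) \<ge> 1")
      case True
      then show ?thesis by (intro far) auto
    next
      case False
      show ?thesis
      proof (rule maximum_modulus_frontier[where f = "q a" and S = "cball a 1"])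
        fix v assume "v \<in> frontier (cball a 1)"
        then have v: "norm (v - a) = 1" by (simp add: frontier_cball dist_norm norm_minus_commute)
        then have "norm (v - w) \<le> 2"
          using norm_triangle_ineq4[of "v - a" "w - a"] False by simp
        then show "norm (q a v) \<le> B" using v by (intro far) auto
      qed (use False q in \<open>auto simp: dist_norm norm_minus_commute
            intro!: holomorphic_on_imp_continuous_on intro: holomorphic_on_subset\<close>)
    qed
  qed
  \<comment> \<open>the series multiplied by \<open>f\<close>, which removes its poles\<close>
  define E where "E w = (\<Sum>\<^sub>\<infinity>a\<in>Z. q a w / deriv f a)" for w
  have bnd: "\<exists>B\<ge>0. \<forall>v. norm v \<le> r \<longrightarrow> norm (f v) \<le> B" for r
  proof -
    obtain C where C: "\<And>v. norm (f v) \<le> C * exp (1 * norm v)"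
      using zt unfolding zero_type_def by (metis zero_less_one)
    have "norm (f v) \<le> \<bar>C\<bar> * exp r" if "norm v \<le> r" for v
      using that by (intro order_trans[OF C] mult_mono) auto
    then show ?thesis by (intro exI[of _ "\<bar>C\<bar> * exp r"]) auto
  qed
  have term_bd: "norm (q a w / deriv f a) \<le> B * (1 / norm (deriv f a))"
    if "a \<in> Z" "\<And>v. norm (v - w) \<le> 2 \<Longrightarrow> norm (f v) \<le> B" for a w B
  proof -
    have "norm (q a w) \<le> B" by (rule qbd) (use that in \<open>auto simp: Z_def\<close>)
    then have "norm (q a w) / norm (deriv f a) \<le> B / norm (deriv f a)"
      by (rule divide_right_mono) auto
    then show ?thesis by (simp add: norm_divide)
  qed
  have abs: "(\<lambda>a. norm (q a w / deriv f a)) summable_on Z"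
    and Ebd: "(\<And>v. norm (v - w) \<le> 2 \<Longrightarrow> norm (f v) \<le> B) \<Longrightarrow> norm (E w) \<le> B * S" for w B
  proof -
    have *: "(\<lambda>a. norm (q a w / deriv f a)) summable_on Z" "norm (E w) \<le> B * S"
      if B: "\<And>v. norm (v - w) \<le> 2 \<Longrightarrow> norm (f v) \<le> B" for B
    proof -
      have sB: "(\<lambda>a. B * (1 / norm (deriv f a))) summable_on Z"
        by (intro summable_on_cmult_right sm')
      have t: "norm (q a w / deriv f a) \<le> B * (1 / norm (deriv f a))" if "a \<in> Z" for a
        using term_bd[OF that] B by blast
      show abs: "(\<lambda>a. norm (q a w / deriv f a)) summable_on Z"
        by (rule Infinite_Sum.abs_summable_on_comparison_test'[OF sB t])
      have "norm (E w) \<le> (\<Sum>\<^sub>\<infinity>a\<in>Z. norm (q a w / deriv f a))"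
        unfolding E_def by (rule norm_infsum_bound[OF abs])
      also have "\<dots> \<le> (\<Sum>\<^sub>\<infinity>a\<in>Z. B * (1 / norm (deriv f a)))"
        by (rule infsum_mono[OF abs sB t])
      also have "\<dots> = B * S" unfolding S_def by (rule infsum_cmult_right')
      finally show "norm (E w) \<le> B * S" .
    qed
    show "norm (E w) \<le> B * S" if "\<And>v. norm (v - w) \<le> 2 \<Longrightarrow> norm (f v) \<le> B"
      using *(2) that .
    obtain B where B: "\<And>v. norm v \<le> norm w + 2 \<Longrightarrow> norm (f v) \<le> B"
      using bnd by blast
    show "(\<lambda>a. norm (q a w / deriv f a)) summable_on Z"
    proof (rule *(1))
      fix v assume "norm (v - w) \<le> 2"
      then show "norm (f v) \<le> B"
        using norm_triangle_ineq[of w "v - w"] by (intro B) auto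
    qed
  qed
  have Ehol: "E holomorphic_on UNIV"
  proof -
    have "E holomorphic_on ball 0 r" for r
    proof -
      obtain B where B: "B \<ge> 0" "\<And>v. norm v \<le> r + 2 \<Longrightarrow> norm (f v) \<le> B"
        using bnd by blast
      have ul: "uniform_limit (cball 0 r) (\<lambda>X w. \<Sum>a\<in>X. q a w / deriv f a) E (finite_subsets_at_top Z)"
        unfolding E_def
      proof (rule Weierstrass_m_test_general)
        show "(\<lambda>a. B * (1 / norm (deriv f a))) summable_on Z"
          by (intro summable_on_cmult_right sm')
        fix a w assume a: "a \<in> Z" and w: "w \<in> cball (0::complex) r"
        show "norm (q a w / deriv f a) \<le> B * (1 / norm (deriv f a))"
        proof (rule term_bd[OF a])
          fix v assume "norm (v - w) \<le> 2"
          then show "norm (f v) \<le> B"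
            using norm_triangle_ineq[of w "v - w"] w by (intro B) auto
        qed
      qed
      have "(\<lambda>w. \<Sum>a\<in>X. q a w / deriv f a) holomorphic_on T" if "X \<subseteq> Z" for X T
        using that simple holomorphic_on_subset[OF q]
        by (intro holomorphic_intros) (auto simp: Z_def)
      then have ev: "\<forall>\<^sub>F X in finite_subsets_at_top Z.
          continuous_on (cball 0 r) (\<lambda>w. \<Sum>a\<in>X. q a w / deriv f a) \<and>
          (\<lambda>w. \<Sum>a\<in>X. q a w / deriv f a) holomorphic_on ball 0 r"
        by (intro eventually_finite_subsets_at_top_weakI conjI holomorphic_on_imp_continuous_on) auto
      show ?thesis
        by (rule holomorphic_uniform_limit[OF ev ul finite_subsets_at_top_neq_bot])
    qed
    then have "E field_differentiable at w" for w
      by (rule holomorphic_on_imp_differentiable_at[where s = "ball 0 (norm w + 1)"]) auto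
    then show ?thesis
      by (simp add: holomorphic_on_def field_differentiable_at_within)
  qed
  define G where "G w = 1 - E w" for w
  have Ghol: "G holomorphic_on UNIV" unfolding G_def[abs_def] by (intro holomorphic_intros Ehol)
  have ztG: "zero_type G"
  proof (rule zero_typeI[OF Ghol, of 1])
    fix e :: real assume "e > 0"
    define d where "d = e / 3"
    have d: "d > 0" using \<open>e > 0\<close> by (simp add: d_def)
    have ev: "\<forall>\<^sub>F R in at_top. \<forall>w. norm w \<le> 2 * R \<longrightarrow> norm (f w) \<le> exp (d * R)"
      by (rule zero_type_eventually_bound[OF zt d]) simp
    have lim: "filterlim (\<lambda>R. exp (d * R)) at_top at_top"
      by (rule exp_mult_at_top[OF d])
    then have "\<forall>\<^sub>F R in at_top. S + 1 \<le> exp (d * R)"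
      by (simp add: filterlim_at_top)
    then show "\<forall>\<^sub>F R in at_top. \<forall>w. norm w \<le> 1 * R \<longrightarrow> norm (G w) \<le> exp (e * R)"
      using ev eventually_gt_at_top[of 2]
    proof eventually_elim
      case (elim R)
      show ?case
      proof (intro allI impI)
        fix w :: complex assume w: "norm w \<le> 1 * R"
        have "norm (E w) \<le> exp (d * R) * S"
        proof (rule Ebd)
          fix v assume "norm (v - w) \<le> 2"
          then have "norm v \<le> 2 * R"
            using norm_triangle_ineq[of w "v - w"] w elim(3) by simp
          then show "norm (f v) \<le> exp (d * R)" using elim by blast
        qed
        then have "norm (G w) \<le> 1 + exp (d * R) * S"
          using norm_triangle_ineq4[of 1 "E w"] by (simp add: G_def)
        also have "1 \<le> exp (d * R)" using d elim by simp
        then have "1 + exp (d * R) * S \<le> exp (d * R) * (S + 1)"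
          by (simp add: distrib_left)
        also have "\<dots> \<le> exp (d * R) * exp (d * R)" using elim by (intro mult_left_mono) auto
        also have "\<dots> \<le> exp (e * R)"
          using elim \<open>e > 0\<close> by (simp add: exp_add[symmetric] d_def)
        finally show "norm (G w) \<le> exp (e * R)" .
      qed
    qed
  qed simp
  have Gzero: "G a = 0" if "f a = 0" for a
  proof -
    have "E a = (\<Sum>\<^sub>\<infinity>b\<in>{a}. q b a / deriv f b)"
      unfolding E_def by (rule infsum_cong_neutral) (use that in \<open>auto simp: Z_def qeq\<close>)
    also have "\<dots> = 1" using that simple by (simp add: q_def)
    finally show ?thesis by (simp add: G_def)
  qed
  obtain H where H: "H holomorphic_on UNIV" "\<And>w. G w = f w * H w"
    using entire_division[OF hol Ghol simple Gzero] by blast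
  have ztH: "zero_type H" by (rule zero_type_quotient[OF zt f0 simple ztG H])
  define K where "K w = (\<Sum>\<^sub>\<infinity>a\<in>Z. 1 / (deriv f a * (w - a)))" for w
  have EK: "E w = f w * K w" if "f w \<noteq> 0" for w
  proof -
    have "E w = (\<Sum>\<^sub>\<infinity>a\<in>Z. f w * (1 / (deriv f a * (w - a))))"
      unfolding E_def
    proof (rule infsum_cong)
      fix a assume "a \<in> Z"
      then have "f a = 0" "w \<noteq> a" using that by (auto simp: Z_def)
      then show "q a w / deriv f a = f w * (1 / (deriv f a * (w - a)))"
        by (simp add: qeq)
    qed
    then show ?thesis unfolding K_def infsum_cmult_right' .
  qed
  have HK: "H w = 1 / f w - K w" if "f w \<noteq> 0" for w
    using H(2)[of w] EK[OF that] that by (simp add: G_def field_simps)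
  have Kbd: "norm (K w) \<le> S / \<bar>Im w + 1\<bar>" if "Im w \<noteq> -1" for w
  proof -
    have t: "norm (1 / (deriv f a * (w - a))) \<le> 1 / norm (deriv f a) * (1 / \<bar>Im w + 1\<bar>)" if "a \<in> Z" for a
    proof -
      have "\<bar>Im w + 1\<bar> \<le> norm (w - a)"
        using abs_Im_le_cmod[of "w - a"] Im[of a] that by (simp add: Z_def)
      then have "1 / norm (w - a) \<le> 1 / \<bar>Im w + 1\<bar>"
        using \<open>Im w \<noteq> -1\<close> by (intro divide_left_mono mult_pos_pos) (auto simp: add_eq_0_iff2)
      then have "1 / norm (deriv f a) * (1 / norm (w - a)) \<le> 1 / norm (deriv f a) * (1 / \<bar>Im w + 1\<bar>)"
        by (intro mult_left_mono) auto
      then show ?thesis by (simp add: norm_divide norm_mult)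
    qed
    have s: "(\<lambda>a. 1 / norm (deriv f a) * (1 / \<bar>Im w + 1\<bar>)) summable_on Z"
      by (intro summable_on_cmult_left sm')
    have abs: "(\<lambda>a. norm (1 / (deriv f a * (w - a)))) summable_on Z"
      by (rule Infinite_Sum.abs_summable_on_comparison_test'[OF s t])
    have "norm (K w) \<le> (\<Sum>\<^sub>\<infinity>a\<in>Z. norm (1 / (deriv f a * (w - a))))"
      unfolding K_def by (rule norm_infsum_bound[OF abs])
    also have "\<dots> \<le> (\<Sum>\<^sub>\<infinity>a\<in>Z. 1 / norm (deriv f a) * (1 / \<bar>Im w + 1\<bar>))"
      by (rule infsum_mono[OF abs s t])
    also have "\<dots> = S * (1 / \<bar>Im w + 1\<bar>)" unfolding S_def by (rule infsum_cmult_left')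
    finally show ?thesis by simp
  qed
  \<comment> \<open>\<open>\<bar>f\<bar>\<close> is at least 1 on the imaginary axis except between the origin and its reflection in the line of zeros\<close>
  have flow: "norm (1 - \<i> * of_real v / a0) \<le> norm (f (\<i> * of_real v))" "norm (1 - \<i> * of_real v / a0) \<ge> 1"
    if v: "v \<ge> 0 \<or> v \<le> -2" for v
  proof -
    have ge: "1 \<le> norm (1 - \<i> * of_real v / b)" if "f b = 0" for b
    proof -
      have b: "b \<noteq> 0" using that f0 by auto
      have "0 \<le> v * (v + 2)" using v by (auto simp: zero_le_mult_iff)
      then have "(norm b)\<^sup>2 \<le> (norm (b - \<i> * of_real v))\<^sup>2"
        using Im[OF that] unfolding cmod_power2 by (simp add: power2_eq_square algebra_simps)
      then have "norm b \<le> norm (b - \<i> * of_real v)" by (rule power2_le_imp_le) auto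
      moreover have "1 - \<i> * of_real v / b = (b - \<i> * of_real v) / b" using b by (simp add: field_simps)
      ultimately show ?thesis using b by (simp add: norm_divide)
    qed
    show "norm (1 - \<i> * of_real v / a0) \<le> norm (f (\<i> * of_real v))"
      by (rule zero_type_lower_bound[OF zt f0 simple ex ge])
    show "norm (1 - \<i> * of_real v / a0) \<ge> 1" by (rule ge[OF ex])
  qed
  have Hbd: "norm (H (\<i> * of_real v)) \<le> 1 / norm (1 - \<i> * of_real v / a0) + S / \<bar>v + 1\<bar>"
    if v: "v \<ge> 0 \<or> v \<le> -2" for v
  proof -
    have nz: "f (\<i> * of_real v) \<noteq> 0" using flow[OF v] by auto
    have "norm (1 / f (\<i> * of_real v)) \<le> 1 / norm (1 - \<i> * of_real v / a0)"
      unfolding norm_divide norm_one using flow[OF v] by (intro divide_left_mono mult_pos_pos) linarith+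
    moreover have "norm (K (\<i> * of_real v)) \<le> S / \<bar>v + 1\<bar>"
      using Kbd[of "\<i> * of_real v"] v by auto
    ultimately show ?thesis
      unfolding HK[OF nz] by (rule order_trans[OF norm_triangle_ineq4 add_mono])
  qed
  have "continuous_on {-2..0} (\<lambda>v. H (\<i> * of_real v))"
    by (rule continuous_on_compose2[OF holomorphic_on_imp_continuous_on[OF H(1)]])
      (auto intro!: continuous_intros)
  then have "bounded ((\<lambda>v. H (\<i> * of_real v)) ` {-2..0})"
    by (intro compact_imp_bounded compact_continuous_image compact_Icc)
  then obtain B where B: "\<And>v. v \<in> {-2..0} \<Longrightarrow> norm (H (\<i> * of_real v)) \<le> B"
    unfolding bounded_iff by blast
  have "H z = 0"
  proof (rule zero_type_vanishing_at_imaginary_infinity[OF ztH])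
    show "norm (H (\<i> * of_real v)) \<le> max B (1 + S)" for v
    proof (cases "v \<in> {-2..0}")
      case True
      then show ?thesis using B by (simp add: le_max_iff_disj)
    next
      case False
      then have v: "v \<ge> 0 \<or> v \<le> -2" by auto
      have "1 / norm (1 - \<i> * of_real v / a0) \<le> 1"
        by (rule divide_le_eq_1[THEN iffD2]) (use flow(2)[OF v] in linarith)
      moreover have "S / \<bar>v + 1\<bar> \<le> S / 1" using S0 v by (intro divide_left_mono) auto
      ultimately show ?thesis using Hbd[OF v] by simp
    qed
    have inv_lim: "((\<lambda>v. c / (v + 1)) \<longlongrightarrow> 0) at_top" for c :: real
      by (intro tendsto_divide_0[OF tendsto_const] filterlim_at_top_imp_at_infinity
          filterlim_at_top_add_at_top[OF filterlim_ident] filterlim_tendsto_add_at_top[OF tendsto_const]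
          filterlim_at_top_mono[OF filterlim_ident]) auto
    have a0: "a0 \<noteq> 0" using ex f0 by auto
    have "((\<lambda>v. 1 / norm (1 - \<i> * of_real v / a0)) \<longlongrightarrow> 0) at_top"
    proof (rule tendsto_sandwich[of "\<lambda>_. 0" _ _ "\<lambda>v. norm a0 / (v + 1)"])
      show "\<forall>\<^sub>F v in at_top. 1 / norm (1 - \<i> * of_real v / a0) \<le> norm a0 / (v + 1)"
        using eventually_gt_at_top[of 0]
      proof eventually_elim
        case (elim v)
        have "1 - \<i> * of_real v / a0 = (a0 - \<i> * of_real v) / a0" using a0 by (simp add: field_simps)
        moreover have "v + 1 \<le> norm (a0 - \<i> * of_real v)"
          using abs_Im_le_cmod[of "a0 - \<i> * of_real v"] Im[OF ex] elim by simp
        ultimately show ?case using elim a0 by (auto simp: norm_divide intro!: divide_left_mono mult_pos_pos)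
      qed
      show "((\<lambda>v. norm a0 / (v + 1)) \<longlongrightarrow> 0) at_top" by (rule inv_lim)
    qed (auto)
    moreover have "((\<lambda>v. S / \<bar>v + 1\<bar>) \<longlongrightarrow> 0) at_top"
      by (rule Lim_transform_eventually[OF inv_lim[of S]])
        (auto intro: eventually_mono[OF eventually_gt_at_top[of 0]])
    ultimately have "((\<lambda>v. 1 / norm (1 - \<i> * of_real v / a0) + S / \<bar>v + 1\<bar>) \<longlongrightarrow> 0) at_top"
      using tendsto_add by fastforce
    then show "((\<lambda>v. H (\<i> * of_real v)) \<longlongrightarrow> 0) at_top"
      by (rule Lim_null_comparison[rotated])
        (auto intro: eventually_mono[OF eventually_ge_at_top[of 0] Hbd])
  qed
  then have "1 / f z = K z" using HK[OF z] by simp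
  then show ?thesis by (simp add: K_def Z_def)
qed

section \<open>Zeros enumerated by a discrete sequence\<close>

text \<open>
  The functions with zeros \<open>lam n\<close> are studied after the translation that moves the point \<open>\<i>\<close>, which
  is never a zero, to the origin. This is the place of the \<open>n\<close>-th zero after the translation; its
  absolute value is the square root of \<open>1 + (lam n)\<^sup>2\<close>.
\<close>

definition shifted :: "(int \<Rightarrow> real) \<Rightarrow> int \<Rightarrow> complex" where
  "shifted lam k = complex_of_real (lam k) - \<i>"

text \<open>
  The indices at distance less than \<open>N\<close> from \<open>m\<close>. Windows around 0 occur in \<open>balanced\<close>, windows around
  \<open>n\<close> in the \<open>n\<close>-th term of the characteristic sequence.
\<close>

definition window :: "int set \<Rightarrow> int \<Rightarrow> nat \<Rightarrow> int set" where
  "window I m N = {k\<in>I. \<bar>m - k\<bar> < int N}"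

text \<open>
  The consequence \<open>n = o(lam n)\<close> of zero density for the enumeration; \<open>\<bar>lam k\<bar>\<close> is replaced by the
  absolute value of the translated zero, which differs by at most 1.
\<close>

definition sparse :: "int set \<Rightarrow> (int \<Rightarrow> real) \<Rightarrow> bool" where
  "sparse I lam \<longleftrightarrow>
     (\<forall>e>0. \<exists>N. \<forall>k\<in>I. N \<le> \<bar>k\<bar> \<longrightarrow> real_of_int \<bar>k\<bar> \<le> e * norm (shifted lam k))"

lemma norm_shifted: "norm (shifted lam k) = sqrt (1 + (lam k)\<^sup>2)"
  by (simp add: shifted_def cmod_def add.commute)

lemma norm_shifted_ge_1: "1 \<le> norm (shifted lam k)"
  unfolding norm_shifted by simp

lemma norm_shifted_ge_abs: "\<bar>lam k\<bar> \<le> norm (shifted lam k)"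
  using abs_Re_le_cmod[of "shifted lam k"] by (simp add: shifted_def)

lemma norm_shifted_le: "norm (shifted lam k) \<le> \<bar>lam k\<bar> + 1"
  using norm_triangle_ineq4[of "complex_of_real (lam k)" \<i>] by (simp add: shifted_def)

lemma shifted_nonzero [simp]: "shifted lam k \<noteq> 0"
  using norm_shifted_ge_1[of lam k] by auto

lemma shifted_eq_iff [simp]: "shifted lam k = shifted lam l \<longleftrightarrow> lam k = lam l"
  by (simp add: shifted_def)

lemma finite_window: "finite (window I m N)"
  and card_window_le: "card (window I m N) \<le> 2 * N"
proof -
  have *: "window I m N \<subseteq> {m - int N<..<m + int N}"
    by (auto simp: window_def)
  then show "finite (window I m N)" by (rule finite_subset) auto
  have "card (window I m N) \<le> card {m - int N<..<m + int N}"
    by (rule card_mono[OF _ *]) auto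
  then show "card (window I m N) \<le> 2 * N" by simp
qed

lemma discrete_sequence_inj_on:
  assumes "discrete_sequence I lam"
  shows "inj_on lam I"
  using assms strict_mono_on_imp_inj_on by (auto simp: discrete_sequence_def)

lemma discrete_sequence_infinite:
  assumes "discrete_sequence I lam"
  shows "infinite I"
  using assms infinite_Ici[of "- int N" for N] infinite_Iio[of "int N" for N]
  by (auto simp: discrete_sequence_def)

lemma discrete_sequence_finite_bounded:
  assumes "discrete_sequence I lam"
  shows "finite {k\<in>I. \<bar>lam k\<bar> \<le> A}"
proof -
  have "finite (cball 0 A \<inter> lam ` I)"
    by (rule finite_not_islimpt_in_compact) (use assms in \<open>auto simp: discrete_sequence_def\<close>)
  then have "finite (lam ` {k\<in>I. \<bar>lam k\<bar> \<le> A})"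
    by (rule rev_finite_subset) auto
  then show ?thesis
    by (rule finite_imageD) (rule inj_on_subset[OF discrete_sequence_inj_on[OF assms]], auto)
qed

text \<open>The indices between 0 and \<open>k\<close> belong to elements that are not farther from 0 than \<open>lam k\<close>.\<close>

lemma discrete_sequence_index_le_card:
  assumes d: "discrete_sequence I lam" and k: "k \<in> I"
  shows "nat \<bar>k\<bar> \<le> card {j\<in>I. \<bar>lam j\<bar> \<le> \<bar>lam k\<bar>}"
proof -
  have mono: "i \<in> I \<Longrightarrow> j \<in> I \<Longrightarrow> i \<le> j \<Longrightarrow> lam i \<le> lam j" for i j
    using d by (auto simp: discrete_sequence_def strict_mono_on_leD)
  have sign: "j \<in> I \<Longrightarrow> 0 \<le> lam j \<longleftrightarrow> 0 \<le> j" for j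
    using d by (auto simp: discrete_sequence_def)
  have sub: "{min k 0..max k (-1)} \<subseteq> I"
    using d k by (auto simp: discrete_sequence_def)
  have "{min k 0..max k (-1)} \<subseteq> {j\<in>I. \<bar>lam j\<bar> \<le> \<bar>lam k\<bar>}"
  proof
    fix j assume j: "j \<in> {min k 0..max k (-1)}"
    then have jI: "j \<in> I" using sub by blast
    show "j \<in> {j\<in>I. \<bar>lam j\<bar> \<le> \<bar>lam k\<bar>}"
    proof (cases "k \<ge> 0")
      case True
      then show ?thesis using j jI k mono[of j k] sign[OF jI] sign[OF k] by auto
    next
      case False
      then show ?thesis using j jI k mono[of k j] sign[OF jI] sign[OF k] by auto
    qed
  qed
  then have "card {min k 0..max k (-1)} \<le> card {j\<in>I. \<bar>lam j\<bar> \<le> \<bar>lam k\<bar>}"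
    by (rule card_mono[OF discrete_sequence_finite_bounded[OF d]])
  moreover have "nat \<bar>k\<bar> \<le> card {min k 0..max k (-1)}" by auto
  ultimately show ?thesis by linarith
qed

lemma sparseI:
  assumes d: "discrete_sequence I lam"
    and cnt: "\<And>e. e > 0 \<Longrightarrow> \<exists>A0. \<forall>A\<ge>A0. real (card {k\<in>I. \<bar>lam k\<bar> < A}) \<le> e * A"
  shows "sparse I lam"
  unfolding sparse_def
proof (intro allI impI)
  fix e :: real assume e: "e > 0"
  then obtain A0 where A0: "\<And>A. A \<ge> A0 \<Longrightarrow> real (card {k\<in>I. \<bar>lam k\<bar> < A}) \<le> e / 2 * A"
    using cnt[of "e / 2"] by auto
  have fin: "finite {j\<in>I. \<bar>lam j\<bar> < A}" for A
    by (rule finite_subset[OF _ discrete_sequence_finite_bounded[OF d, of A]]) auto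
  have le: "nat \<bar>k\<bar> \<le> card {j\<in>I. \<bar>lam j\<bar> < A}" if "k \<in> I" "\<bar>lam k\<bar> < A" for k A
    by (rule order_trans[OF discrete_sequence_index_le_card[OF d that(1)] card_mono[OF fin]])
      (use that in auto)
  have "real_of_int \<bar>k\<bar> \<le> e * norm (shifted lam k)"
    if k: "k \<in> I" "int (card {j\<in>I. \<bar>lam j\<bar> < A0}) + 1 \<le> \<bar>k\<bar>" for k
  proof -
    have "\<not> \<bar>lam k\<bar> < A0" using le[OF k(1), of A0] k(2) by linarith
    then have "real (card {j\<in>I. \<bar>lam j\<bar> < \<bar>lam k\<bar> + 1}) \<le> e / 2 * (\<bar>lam k\<bar> + 1)"
      by (intro A0) auto
    moreover have "real_of_int \<bar>k\<bar> \<le> real (card {j\<in>I. \<bar>lam j\<bar> < \<bar>lam k\<bar> + 1})"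
      using le[OF k(1), of "\<bar>lam k\<bar> + 1"] by linarith
    moreover have "e / 2 * (\<bar>lam k\<bar> + 1) \<le> e / 2 * (2 * norm (shifted lam k))"
      using e norm_shifted_ge_1[of lam k] norm_shifted_ge_abs[of lam k] by (intro mult_left_mono) auto
    ultimately show ?thesis by simp
  qed
  then show "\<exists>N. \<forall>k\<in>I. N \<le> \<bar>k\<bar> \<longrightarrow> real_of_int \<bar>k\<bar> \<le> e * norm (shifted lam k)" by blast
qed

lemma sparse_window:
  assumes s: "sparse I lam" and K: "K > 0"
  shows "\<forall>\<^sub>F N in sequentially. \<forall>k\<in>I. norm (shifted lam k) < K * real N \<longrightarrow> k \<in> window I m N"
proof -
  obtain N0 where N0: "\<And>k. k \<in> I \<Longrightarrow> N0 \<le> \<bar>k\<bar> \<Longrightarrow> real_of_int \<bar>k\<bar> \<le> 1 / (2 * K) * norm (shifted lam k)"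
    using s K unfolding sparse_def by (metis divide_pos_pos mult_pos_pos zero_less_numeral zero_less_one)
  have "\<forall>k\<in>I. norm (shifted lam k) < K * real N \<longrightarrow> k \<in> window I m N"
    if N: "N \<ge> nat (2 * \<bar>m\<bar> + \<bar>N0\<bar> + 1)" for N
  proof (intro ballI impI)
    fix k assume k: "k \<in> I" "norm (shifted lam k) < K * real N"
    have N': "2 * \<bar>m\<bar> + \<bar>N0\<bar> + 1 \<le> int N" using N by linarith
    have "\<bar>m - k\<bar> < int N"
    proof (cases "N0 \<le> \<bar>k\<bar>")
      case True
      have "1 / (2 * K) * norm (shifted lam k) < 1 / (2 * K) * (K * real N)"
        using k K by (intro mult_strict_left_mono) auto
      then have "real_of_int \<bar>k\<bar> < real N / 2" using N0[OF k(1) True] K by simp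
      then have "2 * \<bar>k\<bar> < int N" by linarith
      then show ?thesis using N' by linarith
    next
      case False
      then show ?thesis using N' by linarith
    qed
    then show "k \<in> window I m N" using k by (simp add: window_def)
  qed
  then show ?thesis by (auto simp: eventually_sequentially)
qed

text \<open>
  The normalized functions of zero type whose zeros, all of them simple, are the points of a
  discrete sequence (after the translation).
\<close>

definition enumerated_zeros :: "(complex \<Rightarrow> complex) \<Rightarrow> int set \<Rightarrow> (int \<Rightarrow> real) \<Rightarrow> bool" where
  "enumerated_zeros f I lam \<longleftrightarrow> zero_type f \<and> f 0 = 1 \<and> (\<forall>a. f a = 0 \<longrightarrow> deriv f a \<noteq> 0) \<and>
     {a. f a = 0} = shifted lam ` I \<and> discrete_sequence I lam"

lemma enumerated_zeros_counting:
  assumes f: "enumerated_zeros f I lam" and e: "e > 0"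
  shows "\<exists>A0. \<forall>A\<ge>A0. real (card {k\<in>I. \<bar>lam k\<bar> < A}) \<le> e * A"
proof -
  have zt: "zero_type f" and f0: "f 0 = 1" and simple: "\<forall>a. f a = 0 \<longrightarrow> deriv f a \<noteq> 0"
    and zeros: "{a. f a = 0} = shifted lam ` I" and d: "discrete_sequence I lam"
    using f by (auto simp: enumerated_zeros_def)
  have "\<forall>\<^sub>F R in at_top. real (card (zeros_within f R)) \<le> e / 2 * R"
    by (rule eventually_mono[OF zero_type_factorization[OF zt f0 simple, of "e / 2"]])
      (use e in auto)
  then obtain R0 where R0: "\<And>R. R \<ge> R0 \<Longrightarrow> real (card (zeros_within f R)) \<le> e / 2 * R"
    by (auto simp: eventually_at_top_linorder)
  have "real (card {k\<in>I. \<bar>lam k\<bar> < A}) \<le> e * A" if A: "A \<ge> max R0 1" for A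
  proof -
    have "shifted lam ` {k\<in>I. \<bar>lam k\<bar> < A} \<subseteq> zeros_within f (A + 1)"
    proof
      fix a assume "a \<in> shifted lam ` {k\<in>I. \<bar>lam k\<bar> < A}"
      then obtain k where k: "k \<in> I" "\<bar>lam k\<bar> < A" "a = shifted lam k" by auto
      then have "f a = 0" using zeros by auto
      then show "a \<in> zeros_within f (A + 1)"
        using norm_shifted_le[of lam k] k by (simp add: zeros_within_def)
    qed
    moreover have "finite (zeros_within f (A + 1))"
      by (rule finite_zeros_within[of f 0]) (use zt f0 in \<open>auto simp: zero_type_def\<close>)
    ultimately have "card (shifted lam ` {k\<in>I. \<bar>lam k\<bar> < A}) \<le> card (zeros_within f (A + 1))"
      by (intro card_mono)
    moreover have "inj_on (shifted lam) {k\<in>I. \<bar>lam k\<bar> < A}"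
      using discrete_sequence_inj_on[OF d] by (auto simp: inj_on_def)
    ultimately have "real (card {k\<in>I. \<bar>lam k\<bar> < A}) \<le> real (card (zeros_within f (A + 1)))"
      by (simp add: card_image)
    also have "\<dots> \<le> e / 2 * (A + 1)" using A by (intro R0) auto
    also have "\<dots> \<le> e / 2 * (2 * A)" using A e by (intro mult_left_mono) auto
    finally show ?thesis by simp
  qed
  then show ?thesis by blast
qed

text \<open>
  A zero type function is close to the product over a window of indices. The window contains all
  zeros in a disc whose radius is much larger than the number of its elements; each remaining factor
  is close to 1, and there are too few of them to matter.
\<close>

lemma zero_type_window_factorization:
  assumes f: "enumerated_zeros f I lam" and e: "e > 0"
  shows "\<forall>\<^sub>F N in sequentially. \<exists>h. h holomorphic_on ball 0 (real N) \<and>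
    (\<forall>w\<in>ball 0 (real N). f w = (\<Prod>k\<in>window I m N. 1 - w / shifted lam k) * exp (h w) \<and>
       norm (h w) \<le> e * norm w)"
proof -
  have zt: "zero_type f" and f0: "f 0 = 1" and simple: "\<forall>a. f a = 0 \<longrightarrow> deriv f a \<noteq> 0"
    and zeros: "{a. f a = 0} = shifted lam ` I" and d: "discrete_sequence I lam"
    using f by (auto simp: enumerated_zeros_def)
  have sp: "sparse I lam" by (rule sparseI[OF d enumerated_zeros_counting[OF f]])
  \<comment> \<open>The disc has radius \<open>K N\<close>; each of the at most \<open>2 N\<close> superfluous factors has a logarithm of at most
    \<open>2 \<bar>w\<bar> / (K N)\<close>, so all of them together contribute at most \<open>4 \<bar>w\<bar> / K\<close>.\<close>
  define K where "K = 4 + 8 / e"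
  have K: "K > 4" "8 / e < K" using e by (auto simp: K_def)
  let ?fac = "\<lambda>R. real (card (zeros_within f R)) \<le> e / 2 * R \<and>
           (\<exists>g h. g holomorphic_on UNIV \<and> (\<forall>w. f w = (\<Prod>a\<in>zeros_within f R. 1 - w / a) * g w) \<and>
              h holomorphic_on ball 0 (R/2) \<and>
              (\<forall>w\<in>ball 0 (R/2). g w = exp (h w) \<and> norm (h w) \<le> e / 2 * norm w))"
  have "\<forall>\<^sub>F R in at_top. ?fac R"
    by (rule zero_type_factorization[OF zt f0 simple]) (use e in simp)
  moreover have "filterlim (\<lambda>N. K * real N) at_top sequentially"
    using K by (intro filterlim_tendsto_pos_mult_at_top[OF tendsto_const] filterlim_real_sequentially) auto
  ultimately have "\<forall>\<^sub>F N in sequentially. ?fac (K * real N)"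
    by (rule eventually_compose_filterlim)
  moreover have "\<forall>\<^sub>F N in sequentially. \<forall>k\<in>I. norm (shifted lam k) < K * real N \<longrightarrow> k \<in> window I m N"
    by (rule sparse_window[OF sp]) (use K in simp)
  ultimately show ?thesis using eventually_gt_at_top[of 0]
  proof eventually_elim
    case (elim N)
    define R where "R = K * real N"
    have N: "real N > 0" using elim by simp
    have R: "real N \<le> R / 2" "2 * real N < R" using K N by (auto simp: R_def)
    obtain g h where h: "h holomorphic_on ball 0 (R/2)"
      and fg: "\<forall>w. f w = (\<Prod>a\<in>zeros_within f R. 1 - w / a) * g w"
      and gh: "\<And>w. w \<in> ball 0 (R/2) \<Longrightarrow> g w = exp (h w) \<and> norm (h w) \<le> e / 2 * norm w"
      using elim(1) unfolding R_def by blast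
    define J where "J = window I m N"
    define J1 where "J1 = {k\<in>J. norm (shifted lam k) < R}"
    define J2 where "J2 = J - J1"
    have fin: "finite J" "finite J1" "finite J2"
      by (auto simp: J_def J1_def J2_def finite_window)
    have JI: "J \<subseteq> I" by (auto simp: J_def window_def)
    have zw: "zeros_within f R = shifted lam ` J1"
    proof
      show "zeros_within f R \<subseteq> shifted lam ` J1"
      proof
        fix a assume "a \<in> zeros_within f R"
        then have a: "a \<in> shifted lam ` I" "norm a < R"
          using zeros by (auto simp: zeros_within_def)
        then show "a \<in> shifted lam ` J1" using elim(2) by (auto simp: J1_def J_def R_def)
      qed
      show "shifted lam ` J1 \<subseteq> zeros_within f R"
        using zeros JI by (auto simp: zeros_within_def J1_def)
    qed
    have "inj_on (shifted lam) J1"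
      using discrete_sequence_inj_on[OF d] JI by (auto simp: inj_on_def J1_def)
    then have prod1: "(\<Prod>a\<in>zeros_within f R. 1 - w / a) = (\<Prod>k\<in>J1. 1 - w / shifted lam k)" for w
      unfolding zw by (subst prod.reindex) auto
    have small: "norm (w / shifted lam k) \<le> norm w / R" "norm (w / shifted lam k) < 1/2"
      if "k \<in> J2" "w \<in> ball 0 (real N)" for k w
    proof -
      have "norm (shifted lam k) \<ge> R" using that by (auto simp: J2_def J1_def)
      then show 1: "norm (w / shifted lam k) \<le> norm w / R"
        using R N unfolding norm_divide by (intro divide_left_mono mult_pos_pos) auto
      have "norm w / R < 1/2" using that R N by (simp add: field_simps)
      with 1 show "norm (w / shifted lam k) < 1/2" by linarith
    qed
    have Re: "Re (1 - w / shifted lam k) > 0" if "k \<in> J2" "w \<in> ball 0 (real N)" for k w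
      using small(2)[OF that] complex_Re_le_cmod[of "w / shifted lam k"] by simp
    define h' where "h' w = h w - (\<Sum>k\<in>J2. Ln (1 - w / shifted lam k))" for w
    have "h' holomorphic_on ball 0 (real N)"
      unfolding h'_def[abs_def]
    proof (intro holomorphic_intros)
      show "h holomorphic_on ball 0 (real N)"
        by (rule holomorphic_on_subset[OF h]) (use R in auto)
      show "1 - w / shifted lam k \<notin> \<real>\<^sub>\<le>\<^sub>0" if "k \<in> J2" "w \<in> ball 0 (real N)" for k w
        using Re[OF that] by (auto simp: complex_nonpos_Reals_iff)
    qed auto
    moreover have "f w = (\<Prod>k\<in>J. 1 - w / shifted lam k) * exp (h' w) \<and> norm (h' w) \<le> e * norm w"
      if w: "w \<in> ball 0 (real N)" for w
    proof
      have w': "w \<in> ball 0 (R/2)" using w R by simp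
      have "(\<Prod>k\<in>J. 1 - w / shifted lam k) = (\<Prod>k\<in>J2. 1 - w / shifted lam k) * (\<Prod>k\<in>J1. 1 - w / shifted lam k)"
        unfolding J2_def using fin by (intro prod.subset_diff) (auto simp: J1_def)
      also have "(\<Prod>k\<in>J2. 1 - w / shifted lam k) = exp (\<Sum>k\<in>J2. Ln (1 - w / shifted lam k))"
        unfolding exp_sum[OF fin(3)]
      proof (intro prod.cong refl)
        fix k assume "k \<in> J2"
        then have "1 - w / shifted lam k \<noteq> 0" using Re[OF _ w, of k] by auto
        then show "1 - w / shifted lam k = exp (Ln (1 - w / shifted lam k))" by simp
      qed
      finally show "f w = (\<Prod>k\<in>J. 1 - w / shifted lam k) * exp (h' w)"
        using fg[rule_format, of w] gh[OF w'] by (simp add: prod1 h'_def exp_diff)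
      have Rp: "R > 0" using R N by linarith
      have "norm (\<Sum>k\<in>J2. Ln (1 - w / shifted lam k)) \<le> (\<Sum>k\<in>J2. 2 * (norm w / R))"
      proof (rule sum_norm_le)
        fix k assume k: "k \<in> J2"
        have "norm (Ln (1 + - (w / shifted lam k))) \<le> 2 * norm (- (w / shifted lam k))"
          by (rule norm_Ln_le) (use small(2)[OF k w] in \<open>simp only: norm_minus_cancel\<close>)
        then show "norm (Ln (1 - w / shifted lam k)) \<le> 2 * (norm w / R)"
          using small(1)[OF k w] by simp
      qed
      also have "\<dots> = real (card J2) * (2 * (norm w / R))" by simp
      also have "\<dots> \<le> real (2 * N) * (2 * (norm w / R))"
      proof (intro mult_right_mono)
        have "card J2 \<le> card J" by (intro card_mono fin) (auto simp: J2_def)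
        then show "real (card J2) \<le> real (2 * N)"
          using card_window_le[of I m N] by (simp add: J_def)
      qed (use Rp in auto)
      also have "\<dots> = 4 / K * norm w" using N K by (simp add: R_def)
      also have "\<dots> \<le> e / 2 * norm w"
        using K e by (intro mult_right_mono) (auto simp: field_simps)
      finally show "norm (h' w) \<le> e * norm w"
        using gh[OF w'] norm_triangle_ineq4[of "h w" "\<Sum>k\<in>J2. Ln (1 - w / shifted lam k)"]
        by (simp add: h'_def)
    qed
    ultimately show ?case unfolding J_def by blast
  qed
qed

section \<open>Limits of products over windows\<close>

lemma tendsto_of_exp_factor:
  fixes x :: "nat \<Rightarrow> complex"
  assumes "\<And>e. e > 0 \<Longrightarrow> \<forall>\<^sub>F N in sequentially. \<exists>u. y = x N * exp u \<and> norm u \<le> e"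
  shows "x \<longlonglongrightarrow> y"
proof (rule tendstoI)
  fix d :: real assume "d > 0"
  have "((\<lambda>u. y * exp (- u)) \<longlongrightarrow> y * exp (- 0)) (at 0)"
    by (intro tendsto_intros)
  then have "\<forall>\<^sub>F u in at 0. dist (y * exp (- u)) y < d"
    using \<open>d > 0\<close> by (auto dest: tendstoD)
  then obtain s where s: "s > 0" "\<And>u. u \<noteq> 0 \<Longrightarrow> norm u < s \<Longrightarrow> dist (y * exp (- u)) y < d"
    by (auto simp: eventually_at dist_norm)
  have "\<forall>\<^sub>F N in sequentially. \<exists>u. y = x N * exp u \<and> norm u \<le> s / 2"
    using s by (intro assms) auto
  then show "\<forall>\<^sub>F N in sequentially. dist (x N) y < d"
  proof eventually_elim
    case (elim N)
    then obtain u where u: "y = x N * exp u" "norm u \<le> s / 2" by blast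
    have "x N = y * exp (- u)" by (simp add: u(1) exp_minus)
    then show ?case using s(2)[of u] u(2) s(1) \<open>d > 0\<close> by (cases "u = 0") auto
  qed
qed

lemma deriv_prod_linear_factors:
  assumes "finite J"
  shows "((\<lambda>w. \<Prod>k\<in>J. 1 - w / a k) has_field_derivative - (\<Sum>k\<in>J. 1 / a k)) (at (0::complex))"
  using assms
proof (induction J rule: finite_induct)
  case empty
  then show ?case by simp
next
  case (insert j J)
  have "((\<lambda>w. (1 - w / a j) * (\<Prod>k\<in>J. 1 - w / a k)) has_field_derivative
      (1 - 0 / a j) * - (\<Sum>k\<in>J. 1 / a k) + (- (1 / a j)) * (\<Prod>k\<in>J. 1 - 0 / a k)) (at 0)"
    using DERIV_mult'[OF DERIV_diff[OF DERIV_const DERIV_cdivide[OF DERIV_ident]] insert.IH, of 1 "a j"]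
    by simp
  then show ?case using insert.hyps by (simp add: algebra_simps)
qed

lemma window_product_tendsto:
  assumes f: "enumerated_zeros f I lam"
  shows "(\<lambda>N. \<Prod>k\<in>window I m N. 1 - w / shifted lam k) \<longlonglongrightarrow> f w"
proof (rule tendsto_of_exp_factor)
  fix e :: real assume e: "e > 0"
  have "e / (norm w + 1) > 0" using e by (simp add: add_nonneg_pos)
  from zero_type_window_factorization[OF f this, of m]
    filterlim_real_sequentially[unfolded filterlim_at_top_dense, rule_format, of "norm w"]
  show "\<forall>\<^sub>F N in sequentially. \<exists>u. f w = (\<Prod>k\<in>window I m N. 1 - w / shifted lam k) * exp u \<and> norm u \<le> e"
  proof eventually_elim
    case (elim N)
    then obtain h where h: "f w = (\<Prod>k\<in>window I m N. 1 - w / shifted lam k) * exp (h w)"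
      "norm (h w) \<le> e / (norm w + 1) * norm w"
      by (metis mem_ball_0)
    note h(2)
    also have "e / (norm w + 1) * norm w \<le> e / (norm w + 1) * (norm w + 1)"
      using e by (intro mult_left_mono) auto
    also have "\<dots> = e" by (simp add: add_nonneg_eq_0_iff)
    finally show ?case using h(1) by blast
  qed
qed

lemma eventually_in_window: "n \<in> I \<Longrightarrow> \<forall>\<^sub>F N in sequentially. n \<in> window I m N"
  by (rule eventually_mono[OF eventually_gt_at_top[of "nat \<bar>m - n\<bar>"]]) (auto simp: window_def)

text \<open>The derivative at the \<open>n\<close>-th zero is the limit of the derivatives of the products.\<close>

lemma window_product_derivative:
  assumes f: "enumerated_zeros f I lam" and n: "n \<in> I"
  shows "(\<lambda>N. \<Prod>k\<in>window I m N - {n}. 1 - shifted lam n / shifted lam k)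
           \<longlonglongrightarrow> - shifted lam n * deriv f (shifted lam n)"
proof (rule tendsto_of_exp_factor)
  let ?a = "shifted lam n"
  fix e :: real assume e: "e > 0"
  have "e / norm ?a > 0" using e by simp
  from zero_type_window_factorization[OF f this, of m] eventually_in_window[OF n, of m]
    filterlim_real_sequentially[unfolded filterlim_at_top_dense, rule_format, of "norm ?a"]
  show "\<forall>\<^sub>F N in sequentially. \<exists>u. - ?a * deriv f ?a =
      (\<Prod>k\<in>window I m N - {n}. 1 - ?a / shifted lam k) * exp u \<and> norm u \<le> e"
  proof eventually_elim
    case (elim N)
    then obtain h where hol: "h holomorphic_on ball 0 (real N)"
      and h: "\<And>w. w \<in> ball 0 (real N) \<Longrightarrow> f w = (\<Prod>k\<in>window I m N. 1 - w / shifted lam k) * exp (h w)"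
        "\<And>w. w \<in> ball 0 (real N) \<Longrightarrow> norm (h w) \<le> e / norm ?a * norm w"
      by blast
    define Q where "Q w = (\<Prod>k\<in>window I m N - {n}. 1 - w / shifted lam k) * exp (h w)" for w
    have a: "?a \<in> ball 0 (real N)" using elim by simp
    have "Q holomorphic_on ball 0 (real N)"
      unfolding Q_def[abs_def] by (intro holomorphic_intros hol) auto
    then have "(Q has_field_derivative deriv Q ?a) (at ?a)"
      by (rule holomorphic_derivI[OF _ open_ball a])
    then have "((\<lambda>w. (1 - w / ?a) * Q w) has_field_derivative
        (1 - ?a / ?a) * deriv Q ?a + - (1 / ?a) * Q ?a) (at ?a)"
      by (rule DERIV_mult'[rotated]) (auto intro!: derivative_eq_intros)
    then have "(f has_field_derivative (1 - ?a / ?a) * deriv Q ?a + - (1 / ?a) * Q ?a) (at ?a)"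
    proof (rule has_field_derivative_transform_within_open[OF _ open_ball a])
      fix w :: complex assume w: "w \<in> ball 0 (real N)"
      show "(1 - w / ?a) * Q w = f w"
        unfolding h(1)[OF w] Q_def using elim(2) finite_window by (subst (2) prod.remove[of _ n]) auto
    qed
    then have "deriv f ?a = - (1 / ?a) * Q ?a" by (simp add: DERIV_imp_deriv)
    then have "- ?a * deriv f ?a = Q ?a" by simp
    moreover have "norm (h ?a) \<le> e" using h(2)[OF a] by simp
    ultimately show ?case unfolding Q_def by blast
  qed
qed

text \<open>The logarithmic derivative at the origin.\<close>

lemma window_sum_tendsto:
  assumes f: "enumerated_zeros f I lam"
  shows "(\<lambda>N. \<Sum>k\<in>window I m N. 1 / shifted lam k) \<longlonglongrightarrow> - deriv f 0"
proof (rule tendstoI)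
  fix d :: real assume d: "d > 0"
  then have "d / 2 > 0" by simp
  from zero_type_window_factorization[OF f this, of m] eventually_gt_at_top[of 0]
  show "\<forall>\<^sub>F N in sequentially. dist (\<Sum>k\<in>window I m N. 1 / shifted lam k) (- deriv f 0) < d"
  proof eventually_elim
    case (elim N)
    then obtain h where hol: "h holomorphic_on ball 0 (real N)"
      and h: "\<And>w. w \<in> ball 0 (real N) \<Longrightarrow> f w = (\<Prod>k\<in>window I m N. 1 - w / shifted lam k) * exp (h w)"
        "\<And>w. w \<in> ball 0 (real N) \<Longrightarrow> norm (h w) \<le> d / 2 * norm w"
      by blast
    have z: "0 \<in> ball 0 (real N)" using elim by simp
    have h0: "h 0 = 0" using h(2)[OF z] by simp
    have dh: "(h has_field_derivative deriv h 0) (at 0)"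
      by (rule holomorphic_derivI[OF hol open_ball z])
    have "((\<lambda>w. h w / w) \<longlongrightarrow> deriv h 0) (at 0)"
      using dh h0 by (simp add: has_field_derivative_iff)
    then have "((\<lambda>w. norm (h w / w)) \<longlongrightarrow> norm (deriv h 0)) (at 0)"
      by (rule tendsto_norm)
    moreover have "\<forall>\<^sub>F w in at 0. norm (h w / w) \<le> d / 2"
      using eventually_at_in_open'[OF open_ball z]
    proof eventually_elim
      case (elim w)
      then show ?case using h(2)[of w] d by (cases "w = 0") (auto simp: norm_divide field_simps)
    qed
    ultimately have bd: "norm (deriv h 0) \<le> d / 2"
      by (rule tendsto_upperbound) auto
    have "((\<lambda>w. (\<Prod>k\<in>window I m N. 1 - w / shifted lam k) * exp (h w)) has_field_derivative
       (\<Prod>k\<in>window I m N. 1 - 0 / shifted lam k) * (exp (h 0) * deriv h 0) +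
       - (\<Sum>k\<in>window I m N. 1 / shifted lam k) * exp (h 0)) (at 0)"
      by (rule DERIV_mult'[OF deriv_prod_linear_factors[OF finite_window]])
        (rule DERIV_fun_exp[OF dh])
    then have "(f has_field_derivative
       (\<Prod>k\<in>window I m N. 1 - 0 / shifted lam k) * (exp (h 0) * deriv h 0) +
       - (\<Sum>k\<in>window I m N. 1 / shifted lam k) * exp (h 0)) (at 0)"
      by (rule has_field_derivative_transform_within_open[OF _ open_ball z]) (simp add: h(1))
    then have "deriv f 0 = deriv h 0 - (\<Sum>k\<in>window I m N. 1 / shifted lam k)"
      by (simp add: DERIV_imp_deriv h0)
    then have "dist (\<Sum>k\<in>window I m N. 1 / shifted lam k) (- deriv f 0) = norm (deriv h 0)"
      by (simp add: dist_norm)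
    then show ?case using bd d by simp
  qed
qed

lemma inverse_shifted: "1 / shifted lam k = Complex (lam k / (1 + (lam k)\<^sup>2)) (1 / (1 + (lam k)\<^sup>2))"
  by (simp add: shifted_def complex_eq_iff Re_divide Im_divide power2_eq_square add.commute)

lemma enumerated_zeros_imp_balanced:
  assumes f: "enumerated_zeros f I lam"
  shows "balanced I lam"
proof -
  have "(\<lambda>N. Re (\<Sum>k\<in>window I 0 N. 1 / shifted lam k)) \<longlonglongrightarrow> Re (- deriv f 0)"
    by (intro tendsto_Re window_sum_tendsto f)
  then show ?thesis
    unfolding balanced_def convergent_def Re_sum inverse_shifted window_def by auto
qed

text \<open>The factor 2 in the upper density is absorbed by \<open>e\<close>.\<close>

lemma zero_density_iff:
  "zero_density L \<longleftrightarrow> (\<forall>e>0. \<exists>A0. \<forall>A\<ge>A0. real (card (L \<inter> {-A<..<A})) \<le> e * A)"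
proof -
  let ?g = "\<lambda>A::real. ereal (real (card (L \<inter> {-A<..<A})) / (2 * A))"
  have "0 \<le> Limsup at_top ?g"
    by (rule le_Limsup) (auto intro: eventually_mono[OF eventually_ge_at_top[of 0]])
  then have "zero_density L \<longleftrightarrow> Limsup at_top ?g \<le> 0"
    by (auto simp: zero_density_def upper_density_def)
  also have "\<dots> \<longleftrightarrow> (\<forall>e>0. \<exists>A0. \<forall>A\<ge>A0. real (card (L \<inter> {-A<..<A})) \<le> e * A)"
  proof safe
    fix e :: real assume L: "Limsup at_top ?g \<le> 0" and "e > 0"
    have "\<forall>\<^sub>F A in at_top. ?g A < ereal (e / 2)"
      by (rule L[unfolded Limsup_le_iff, rule_format]) (use \<open>e > 0\<close> in simp)
    then have "\<forall>\<^sub>F A in at_top. real (card (L \<inter> {-A<..<A})) \<le> e * A"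
      using eventually_gt_at_top[of 0]
    proof eventually_elim
      case (elim A)
      then show ?case using \<open>e > 0\<close> by (simp add: field_simps)
    qed
    then show "\<exists>A0. \<forall>A\<ge>A0. real (card (L \<inter> {-A<..<A})) \<le> e * A"
      by (simp add: eventually_at_top_linorder)
  next
    assume *: "\<forall>e>0. \<exists>A0. \<forall>A\<ge>A0. real (card (L \<inter> {-A<..<A})) \<le> e * A"
    show "Limsup at_top ?g \<le> 0"
      unfolding Limsup_le_iff
    proof (intro allI impI)
      fix y :: ereal assume "0 < y"
      then obtain e where e: "0 < ereal e" "ereal e < y" using ereal_dense2 by blast
      then have "\<forall>\<^sub>F A in at_top. real (card (L \<inter> {-A<..<A})) \<le> e * A"
        using * by (simp add: eventually_at_top_linorder)
      then show "\<forall>\<^sub>F A in at_top. ?g A < y"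
        using eventually_gt_at_top[of 0]
      proof eventually_elim
        case (elim A)
        then have "real (card (L \<inter> {-A<..<A})) / (2 * A) \<le> e / 2"
          by (simp add: field_simps)
        also have "\<dots> < e" using e by simp
        finally have "real (card (L \<inter> {-A<..<A})) / (2 * A) < e" .
        then show ?case using e by (meson ereal_less_eq(3) less_imp_le order_le_less_trans)
      qed
    qed
  qed
  finally show ?thesis .
qed

lemma card_bounded_elements:
  assumes "discrete_sequence I lam"
  shows "card (lam ` I \<inter> {-A<..<A}) = card {k\<in>I. \<bar>lam k\<bar> < A}"
proof -
  have "lam ` I \<inter> {-A<..<A} = lam ` {k\<in>I. \<bar>lam k\<bar> < A}" by (auto simp: abs_less_iff)
  moreover have "inj_on lam {k\<in>I. \<bar>lam k\<bar> < A}"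
    by (rule inj_on_subset[OF discrete_sequence_inj_on[OF assms]]) auto
  ultimately show ?thesis by (simp add: card_image)
qed

lemma enumerated_zeros_imp_zero_density:
  assumes f: "enumerated_zeros f I lam"
  shows "zero_density (lam ` I)"
proof -
  have d: "discrete_sequence I lam" using f by (simp add: enumerated_zeros_def)
  show ?thesis
    unfolding zero_density_iff card_bounded_elements[OF d]
    using enumerated_zeros_counting[OF f] by blast
qed

lemma zero_density_imp_sparse:
  assumes d: "discrete_sequence I lam" and "zero_density (lam ` I)"
  shows "sparse I lam"
  using assms(2) unfolding zero_density_iff card_bounded_elements[OF d]
  by (intro sparseI[OF d]) blast

lemma one_minus_shifted_quotient:
  "1 - shifted lam n / shifted lam k = of_real (lam k - lam n) / shifted lam k"
proof -
  have "shifted lam k - shifted lam n = of_real (lam k - lam n)" by (simp add: shifted_def)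
  then show ?thesis by (simp add: diff_divide_eq_iff flip: shifted_def)
qed

text \<open>
  The factor \<open>1 + (lam n)\<^sup>2\<close> in front of the products in the characteristic sequence cancels the factor
  \<open>shifted lam n\<close> in the derivative.
\<close>

lemma exp_characteristic_sequence:
  assumes f: "enumerated_zeros f I lam" and n: "n \<in> I"
  shows "exp (characteristic_sequence I lam n) = 1 / norm (deriv f (shifted lam n))"
proof -
  let ?a = "shifted lam n"
  let ?W = "\<lambda>N. window I n N - {n}"
  let ?X = "\<lambda>N. norm (\<Prod>k\<in>?W N. 1 - ?a / shifted lam k)"
  have "f ?a = 0" and d: "discrete_sequence I lam"
    using f n by (auto simp: enumerated_zeros_def)
  then have nz: "deriv f ?a \<noteq> 0" using f by (auto simp: enumerated_zeros_def)
  have neq: "lam k \<noteq> lam n" if "k \<in> ?W N" for k N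
    using discrete_sequence_inj_on[OF d] n that by (auto simp: window_def inj_on_def)
  have lim: "(\<lambda>N. ?X N) \<longlonglongrightarrow> norm (- ?a * deriv f ?a)"
    by (intro tendsto_norm window_product_derivative f n)
  have "(\<lambda>N. -2 * ln (?X N))
      \<longlonglongrightarrow> -2 * ln (norm (- ?a * deriv f ?a))"
    by (rule tendsto_mult[OF tendsto_const tendsto_ln[OF lim]]) (use nz in simp)
  also have "(\<lambda>N. -2 * ln (?X N)) =
      (\<lambda>N. \<Sum>k\<in>{k\<in>I. 0 < \<bar>n - k\<bar> \<and> \<bar>n - k\<bar> < int N}. ln ((1 + (lam k)\<^sup>2) / (lam k - lam n)\<^sup>2))"
  proof
    fix N
    have W: "?W N = {k\<in>I. 0 < \<bar>n - k\<bar> \<and> \<bar>n - k\<bar> < int N}" by (auto simp: window_def)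
    have "-2 * ln (?X N) =
        -2 * (\<Sum>k\<in>?W N. ln (norm (1 - ?a / shifted lam k)))"
      unfolding prod_norm[symmetric] using neq finite_window
      by (subst ln_prod) (auto simp: one_minus_shifted_quotient)
    also have "\<dots> = (\<Sum>k\<in>?W N. ln ((1 + (lam k)\<^sup>2) / (lam k - lam n)\<^sup>2))"
      unfolding sum_distrib_left
    proof (rule sum.cong[OF refl])
      fix k assume k: "k \<in> ?W N"
      have pos: "1 + (lam k)\<^sup>2 > 0" by (simp add: add_pos_nonneg)
      have "norm (1 - ?a / shifted lam k) = \<bar>lam k - lam n\<bar> / sqrt (1 + (lam k)\<^sup>2)"
        by (simp add: one_minus_shifted_quotient norm_divide norm_shifted flip: of_real_diff)
      also have "-2 * ln \<dots> = ln (1 + (lam k)\<^sup>2) - 2 * ln \<bar>lam k - lam n\<bar>"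
        using neq[OF k] pos by (simp add: ln_div ln_sqrt)
      also have "\<dots> = ln ((1 + (lam k)\<^sup>2) / (lam k - lam n)\<^sup>2)"
      proof -
        have "ln ((lam k - lam n)\<^sup>2) = ln (\<bar>lam k - lam n\<bar>\<^sup>2)" by simp
        also have "\<dots> = 2 * ln \<bar>lam k - lam n\<bar>" using neq[OF k] by (subst ln_realpow) auto
        finally show ?thesis using neq[OF k] pos by (simp add: ln_div)
      qed
      finally show "-2 * ln (norm (1 - ?a / shifted lam k)) =
          ln ((1 + (lam k)\<^sup>2) / (lam k - lam n)\<^sup>2)" .
    qed
    finally show "-2 * ln (?X N) =
      (\<Sum>k\<in>{k\<in>I. 0 < \<bar>n - k\<bar> \<and> \<bar>n - k\<bar> < int N}. ln ((1 + (lam k)\<^sup>2) / (lam k - lam n)\<^sup>2))"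
      unfolding W .
  qed
  finally have "characteristic_sequence I lam n =
      1/2 * (ln (1 + (lam n)\<^sup>2) + -2 * ln (norm (- ?a * deriv f ?a)))"
    unfolding characteristic_sequence_def by (simp add: limI)
  also have "ln (norm (- ?a * deriv f ?a)) = ln (1 + (lam n)\<^sup>2) / 2 + ln (norm (deriv f ?a))"
    using nz add_pos_nonneg[of 1 "(lam n)\<^sup>2"]
    by (simp add: norm_mult ln_mult norm_shifted ln_sqrt)
  finally have "characteristic_sequence I lam n = - ln (norm (deriv f ?a))"
    by (simp add: field_simps)
  then show ?thesis using nz by (simp add: exp_minus divide_inverse)
qed

section \<open>Constructing the function from its zeros\<close>

lemma sum_inverse_squares_tail:
  assumes "N > 0" "N \<le> M"
  shows "(\<Sum>k\<in>{k::int. int N \<le> \<bar>k\<bar> \<and> \<bar>k\<bar> < int M}. 1 / (real_of_int \<bar>k\<bar>)\<^sup>2) \<le> 4 / real N - 4 / real M"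
  using assms(2)
proof (induction M rule: dec_induct)
  case base
  have "{k::int. int N \<le> \<bar>k\<bar> \<and> \<bar>k\<bar> < int N} = {}" by auto
  then show ?case by (simp only:) simp
next
  case (step M)
  have M: "M > 0" using assms step by linarith
  let ?S = "\<lambda>M. {k::int. int N \<le> \<bar>k\<bar> \<and> \<bar>k\<bar> < int M}"
  have eq: "?S (Suc M) = insert (int M) (insert (- int M) (?S M))"
    using step by auto
  have fin: "finite (?S M)" by (rule finite_subset[of _ "{- int M..int M}"]) auto
  have "(\<Sum>k\<in>?S (Suc M). 1 / (real_of_int \<bar>k\<bar>)\<^sup>2) = 2 / (real M)\<^sup>2 + (\<Sum>k\<in>?S M. 1 / (real_of_int \<bar>k\<bar>)\<^sup>2)"
    unfolding eq using fin M by simp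
  also have "\<dots> \<le> 2 / (real M)\<^sup>2 + (4 / real N - 4 / real M)" using step.IH by simp
  also have "2 / (real M)\<^sup>2 \<le> 4 / real M - 4 / real (Suc M)"
  proof -
    have "2 / (real M)\<^sup>2 = 4 / (2 * (real M * real M))" by (simp add: power2_eq_square)
    also have "\<dots> \<le> 4 / (real M * (real M + 1))"
      using M by (intro divide_left_mono mult_pos_pos) (auto simp: algebra_simps)
    also have "\<dots> = 4 / real M - 4 / (real M + 1)" using M by (simp add: diff_frac_eq)
    finally show ?thesis by (simp add: add.commute)
  qed
  finally show ?case by simp
qed

lemma sum_inverse_sqrt_le:
  "(\<Sum>k\<in>{k::int. \<bar>k\<bar> < int N}. 1 / sqrt (real_of_int \<bar>k\<bar> + 1)) \<le> 4 * sqrt (real N)"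
proof (induction N)
  case 0
  have "{k::int. \<bar>k\<bar> < int 0} = {}" by auto
  then show ?case by (simp only:) simp
next
  case (Suc N)
  let ?S = "\<lambda>M. {k::int. \<bar>k\<bar> < int M}"
  have eq: "?S (Suc N) = insert (int N) (insert (- int N) (?S N))" by auto
  have fin: "finite (?S N)" by (rule finite_subset[of _ "{- int N..int N}"]) auto
  have "(\<Sum>k\<in>?S (Suc N). 1 / sqrt (real_of_int \<bar>k\<bar> + 1)) \<le>
      2 / sqrt (real N + 1) + (\<Sum>k\<in>?S N. 1 / sqrt (real_of_int \<bar>k\<bar> + 1))"
    unfolding eq using fin by (cases "N = 0") auto
  also have "\<dots> \<le> 2 / sqrt (real N + 1) + 4 * sqrt (real N)" using Suc.IH by simp
  also have "\<dots> \<le> 4 * sqrt (real (Suc N))"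
  proof -
    define x y where "x = sqrt (real N)" and "y = sqrt (real N + 1)"
    have xy: "0 \<le> x" "x \<le> y" "0 < y" "y * y - x * x = 1" by (auto simp: x_def y_def)
    then have "(y - x) * (y + x) = 1" by (simp add: algebra_simps)
    moreover have "(y - x) * (y + x) \<le> (y - x) * (2 * y)" using xy by (intro mult_left_mono) auto
    ultimately have "2 / y \<le> 4 * y - 4 * x" using xy by (simp add: field_simps)
    then show ?thesis by (simp add: x_def y_def add.commute)
  qed
  finally show ?case .
qed

lemma exp_near_1:
  fixes e :: real
  assumes "e > 0"
  shows "\<exists>d>0. d \<le> 1 \<and> (\<forall>u::complex. norm u \<le> d \<longrightarrow> norm (exp u - 1) < e)"
proof -
  have "isCont exp (0::complex)" by (intro continuous_intros)
  then have "\<exists>d>0. \<forall>u::complex. dist u 0 < d \<longrightarrow> dist (exp u) (exp 0) < e"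
    using assms by (auto simp: continuous_at_eps_delta)
  then obtain d where d: "d > 0" "\<And>u::complex. norm u < d \<Longrightarrow> norm (exp u - 1) < e"
    by (auto simp: dist_norm)
  then show ?thesis by (intro exI[of _ "min (d / 2) 1"]) auto
qed

lemma norm_mult_exp_le:
  fixes T :: complex
  assumes "norm T \<le> d"
  shows "norm (a * exp T) \<le> norm a * exp d"
  using assms complex_Re_le_cmod[of T] by (simp add: norm_mult mult_left_mono)

context
  fixes I :: "int set" and lam :: "int \<Rightarrow> real"
  assumes disc: "discrete_sequence I lam" and bal: "balanced I lam" and sparse: "sparse I lam"
begin

text \<open>
  For the window of radius \<open>N\<close> around 0: \<open>P N\<close> is the product with the zeros in the window, \<open>s N\<close> the sum
  of the inverse zeros, and \<open>Q N M\<close> the sum of the inverse squares between two windows.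
\<close>

private abbreviation (input) "W N \<equiv> window I 0 N"
private abbreviation (input) "P N w \<equiv> \<Prod>k\<in>window I 0 N. 1 - w / shifted lam k"
private abbreviation (input) "s N \<equiv> \<Sum>k\<in>window I 0 N. 1 / shifted lam k"
private abbreviation (input) "Q N M \<equiv> \<Sum>k\<in>window I 0 M - window I 0 N. 1 / (norm (shifted lam k))\<^sup>2"

private lemma window_mono: "N \<le> M \<Longrightarrow> window I 0 N \<subseteq> window I 0 M"
  by (auto simp: window_def)

private lemma zeros_grow: "\<exists>N0. \<forall>k\<in>I. int N0 \<le> \<bar>k\<bar> \<longrightarrow> K * real_of_int \<bar>k\<bar> \<le> norm (shifted lam k)" if "K > 0"
proof -
  have "1 / K > 0" using that by simp
  then obtain N0 where N0: "\<forall>k\<in>I. N0 \<le> \<bar>k\<bar> \<longrightarrow> real_of_int \<bar>k\<bar> \<le> 1 / K * norm (shifted lam k)"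
    using sparse unfolding sparse_def by blast
  show ?thesis
  proof (intro exI[of _ "nat N0"] ballI impI)
    fix k assume k: "k \<in> I" "int (nat N0) \<le> \<bar>k\<bar>"
    have "N0 \<le> \<bar>k\<bar>" using k(2) by linarith
    with k(1) have "real_of_int \<bar>k\<bar> \<le> 1 / K * norm (shifted lam k)" using N0 by blast
    then show "K * real_of_int \<bar>k\<bar> \<le> norm (shifted lam k)"
      using that by (simp add: field_simps)
  qed
qed

private lemma zeros_lower_bound: "\<exists>c>0. \<forall>k\<in>I. c * (real_of_int \<bar>k\<bar> + 1) \<le> norm (shifted lam k)"
proof -
  obtain N0 where N0: "\<And>k. k \<in> I \<Longrightarrow> int N0 \<le> \<bar>k\<bar> \<Longrightarrow> real_of_int \<bar>k\<bar> \<le> norm (shifted lam k)"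
    using zeros_grow[of 1] by auto
  show ?thesis
  proof (intro exI[of _ "1 / (real N0 + 2)"] conjI ballI)
    fix k assume k: "k \<in> I"
    have "real_of_int \<bar>k\<bar> + 1 \<le> (real N0 + 2) * norm (shifted lam k)"
    proof (cases "int N0 \<le> \<bar>k\<bar>")
      case True
      have "real_of_int \<bar>k\<bar> + 1 \<le> 2 * norm (shifted lam k)"
        using N0[OF k True] norm_shifted_ge_1[of lam k] by simp
      also have "\<dots> \<le> (real N0 + 2) * norm (shifted lam k)" by (intro mult_right_mono) auto
      finally show ?thesis .
    next
      case False
      then have "\<bar>k\<bar> < int N0" by simp
      then have "real_of_int \<bar>k\<bar> < real_of_int (int N0)" by (simp only: of_int_less_iff)
      then have "real_of_int \<bar>k\<bar> + 1 \<le> (real N0 + 2) * 1" by simp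
      also have "\<dots> \<le> (real N0 + 2) * norm (shifted lam k)"
        using norm_shifted_ge_1[of lam k] by (intro mult_left_mono) auto
      finally show ?thesis .
    qed
    then show "1 / (real N0 + 2) * (real_of_int \<bar>k\<bar> + 1) \<le> norm (shifted lam k)"
      by (simp add: field_simps)
  qed simp
qed

text \<open>The inverse squares of the zeros outside a window, when these grow at least like \<open>K * \<bar>k\<bar>\<close>.\<close>

private lemma Q_le:
  assumes "K > 0" "N > 0" "N \<le> M"
    and K: "\<And>k. k \<in> I \<Longrightarrow> int N \<le> \<bar>k\<bar> \<Longrightarrow> K * real_of_int \<bar>k\<bar> \<le> norm (shifted lam k)"
  shows "Q N M \<le> 4 / (K\<^sup>2 * real N)"
proof -
  let ?S = "{k::int. int N \<le> \<bar>k\<bar> \<and> \<bar>k\<bar> < int M}"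
  have fin: "finite ?S" by (rule finite_subset[of _ "{- int M..int M}"]) auto
  have sub: "W M - W N \<subseteq> ?S" by (auto simp: window_def)
  have "Q N M \<le> (\<Sum>k\<in>W M - W N. 1 / K\<^sup>2 * (1 / (real_of_int \<bar>k\<bar>)\<^sup>2))"
  proof (rule sum_mono)
    fix k assume k: "k \<in> W M - W N"
    then have kI: "k \<in> I" "int N \<le> \<bar>k\<bar>" by (auto simp: window_def)
    from kI have pos: "0 < K * real_of_int \<bar>k\<bar>" using assms(1,2) by auto
    then have "(K * real_of_int \<bar>k\<bar>)\<^sup>2 \<le> (norm (shifted lam k))\<^sup>2"
      using K[OF kI] by (intro power_mono) auto
    then have "1 / (norm (shifted lam k))\<^sup>2 \<le> 1 / (K * real_of_int \<bar>k\<bar>)\<^sup>2"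
      using zero_less_power[OF pos, of 2] by (intro frac_le) auto
    then show "1 / (norm (shifted lam k))\<^sup>2 \<le> 1 / K\<^sup>2 * (1 / (real_of_int \<bar>k\<bar>)\<^sup>2)"
      by (simp add: power_mult_distrib)
  qed
  also have "\<dots> \<le> (\<Sum>k\<in>?S. 1 / K\<^sup>2 * (1 / (real_of_int \<bar>k\<bar>)\<^sup>2))"
    by (rule sum_mono2[OF fin sub]) auto
  also have "\<dots> \<le> 1 / K\<^sup>2 * (4 / real N - 4 / real M)"
    unfolding sum_distrib_left[symmetric]
    by (intro mult_left_mono sum_inverse_squares_tail) (use assms in auto)
  also have "\<dots> \<le> 1 / K\<^sup>2 * (4 / real N)" by (intro mult_left_mono) auto
  finally show ?thesis by simp
qed

private lemma sum_convergent: "convergent s"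
proof -
  have re: "convergent (\<lambda>N. Re (s N))"
    using bal by (simp add: balanced_def inverse_shifted window_def)
  have im: "convergent (\<lambda>N. Im (s N))"
  proof (rule Bseq_mono_convergent)
    have s_im: "Im (s N) = (\<Sum>k\<in>window I 0 N. 1 / (norm (shifted lam k))\<^sup>2)" for N
      by (simp add: inverse_shifted norm_shifted add_nonneg_nonneg)
    show "\<forall>m n. m \<le> n \<longrightarrow> Im (s m) \<le> Im (s n)"
      unfolding s_im by (auto intro!: sum_mono2 finite_window window_mono)
    obtain N0 where N0: "\<And>k. k \<in> I \<Longrightarrow> int N0 \<le> \<bar>k\<bar> \<Longrightarrow> 1 * real_of_int \<bar>k\<bar> \<le> norm (shifted lam k)"
      using zeros_grow[of 1] by auto
    have "norm (Im (s M)) \<le> Im (s (Suc N0)) + 4" for M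
    proof -
      have nn: "0 \<le> Im (s M)" unfolding s_im by (intro sum_nonneg) auto
      have "Im (s M) \<le> Im (s (max M (Suc N0)))"
        unfolding s_im by (auto intro!: sum_mono2 finite_window window_mono)
      also have "\<dots> = Q (Suc N0) (max M (Suc N0)) + Im (s (Suc N0))"
        unfolding s_im by (intro sum.subset_diff finite_window window_mono) auto
      also have "Q (Suc N0) (max M (Suc N0)) \<le> 4 / (1\<^sup>2 * real (Suc N0))"
        by (rule Q_le) (use N0 in auto)
      also have "\<dots> \<le> 4" by (simp add: field_simps)
      finally show ?thesis using nn by simp
    qed
    then show "Bseq (\<lambda>N. Im (s N))" by (rule BseqI')
  qed
  from re im obtain x y where "(\<lambda>N. Re (s N)) \<longlonglongrightarrow> x" "(\<lambda>N. Im (s N)) \<longlonglongrightarrow> y"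
    by (auto simp: convergent_def)
  then have "s \<longlonglongrightarrow> Complex x y" by (simp add: tendsto_complex_iff)
  then show ?thesis by (auto simp: convergent_def)
qed

text \<open>
  The logarithm of a far factor is \<open>- w / a\<close> up to an error of \<open>2 \<bar>w / a\<bar>\<^sup>2\<close>. The sum of the main terms is
  small because the sums \<open>s\<close> converge.
\<close>

private lemma window_log:
  assumes "N \<le> M" and far: "\<And>k. k \<in> I \<Longrightarrow> int N \<le> \<bar>k\<bar> \<Longrightarrow> 2 * norm w \<le> norm (shifted lam k)"
  shows "\<exists>T. P M w = P N w * exp T \<and> norm T \<le> norm w * norm (s M - s N) + 2 * (norm w)\<^sup>2 * Q N M"
proof -
  let ?D = "W M - W N"
  define T where "T = (\<Sum>k\<in>?D. Ln (1 + - (w / shifted lam k)))"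
  have fin: "finite ?D" by (simp add: finite_window)
  have sub: "W N \<subseteq> W M" by (rule window_mono[OF assms(1)])
  have small: "norm (w / shifted lam k) \<le> 1 / 2" if "k \<in> ?D" for k
  proof -
    have "k \<in> I" "int N \<le> \<bar>k\<bar>" using that by (auto simp: window_def)
    then show ?thesis using far[of k] by (simp add: norm_divide field_simps)
  qed
  have "P M w = (\<Prod>k\<in>?D. 1 - w / shifted lam k) * P N w"
    by (rule prod.subset_diff[OF sub finite_window])
  also have "(\<Prod>k\<in>?D. 1 - w / shifted lam k) = exp T"
    unfolding T_def exp_sum[OF fin]
  proof (intro prod.cong refl)
    fix k assume "k \<in> ?D"
    then have "w / shifted lam k \<noteq> 1" using small[of k] by auto
    then show "1 - w / shifted lam k = exp (Ln (1 + - (w / shifted lam k)))" by simp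
  qed
  finally have "P M w = P N w * exp T" by simp
  moreover have "norm T \<le> norm w * norm (s M - s N) + 2 * (norm w)\<^sup>2 * Q N M"
  proof -
    have "s M - s N = (\<Sum>k\<in>?D. 1 / shifted lam k)"
      using sum.subset_diff[OF sub finite_window, of "\<lambda>k. 1 / shifted lam k"] by simp
    then have "w * (s M - s N) = (\<Sum>k\<in>?D. w / shifted lam k)"
      by (simp add: sum_distrib_left)
    then have "T = (\<Sum>k\<in>?D. Ln (1 + - (w / shifted lam k)) - - (w / shifted lam k)) + - (w * (s M - s N))"
      unfolding T_def sum_subtractf sum_negf by simp
    then have "norm T \<le> norm (\<Sum>k\<in>?D. Ln (1 + - (w / shifted lam k)) - - (w / shifted lam k)) + norm (- (w * (s M - s N)))"
      using norm_triangle_ineq by (simp only:)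
    also have "norm (\<Sum>k\<in>?D. Ln (1 + - (w / shifted lam k)) - - (w / shifted lam k)) \<le>
        (\<Sum>k\<in>?D. 2 * (norm w)\<^sup>2 * (1 / (norm (shifted lam k))\<^sup>2))"
    proof (rule sum_norm_le)
      fix k assume k: "k \<in> ?D"
      let ?x = "- (w / shifted lam k)"
      have x: "norm ?x \<le> 1 / 2" using small[OF k] by simp
      then have "norm (Ln (1 + ?x) - ?x) \<le> (norm ?x)\<^sup>2 / (1 - norm ?x)"
        by (intro Ln_approx_linear) linarith
      also have "\<dots> \<le> (norm ?x)\<^sup>2 / (1 / 2)" using x by (intro divide_left_mono mult_pos_pos) auto
      also have "\<dots> = 2 * (norm w)\<^sup>2 * (1 / (norm (shifted lam k))\<^sup>2)"
        by (simp add: norm_divide power_divide)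
      finally show "norm (Ln (1 + ?x) - ?x) \<le> 2 * (norm w)\<^sup>2 * (1 / (norm (shifted lam k))\<^sup>2)" .
    qed
    also have "\<dots> = 2 * (norm w)\<^sup>2 * Q N M" by (rule sum_distrib_left[symmetric])
    finally show ?thesis by (simp add: norm_mult)
  qed
  ultimately show ?thesis by blast
qed

private lemma window_log_uniform:
  assumes "r > 0" "d > 0"
  shows "\<exists>N0. \<forall>N\<ge>N0. \<forall>M\<ge>N. \<forall>w. norm w \<le> r \<longrightarrow> (\<exists>T. P M w = P N w * exp T \<and> norm T \<le> d)"
proof -
  obtain N1 where N1: "\<forall>k\<in>I. int N1 \<le> \<bar>k\<bar> \<longrightarrow> 1 * real_of_int \<bar>k\<bar> \<le> norm (shifted lam k)"
    using zeros_grow[of 1] by auto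
  have "Cauchy s" using sum_convergent by (rule convergent_Cauchy)
  then obtain N2 where N2: "\<And>m n. m \<ge> N2 \<Longrightarrow> n \<ge> N2 \<Longrightarrow> norm (s m - s n) < d / (2 * r)"
    using CauchyD[OF \<open>Cauchy s\<close>, of "d / (2 * r)"] assms by auto
  obtain N3 where N3: "2 * r < real N3" using reals_Archimedean2 by blast
  obtain N4 where N4: "16 * r\<^sup>2 / d < real N4" using reals_Archimedean2 by blast
  show ?thesis
  proof (intro exI[of _ "N1 + N2 + N3 + N4"] allI impI)
    fix N M and w :: complex assume N: "N1 + N2 + N3 + N4 \<le> N" "N \<le> M" and w: "norm w \<le> r"
    have N': "2 * r < real N" "16 * r\<^sup>2 / d < real N" using N N3 N4 by linarith+
    have "N > 0" using N'(1) assms(1) by (cases N) auto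
    note N' = N' this
    have K: "k \<in> I \<Longrightarrow> int N \<le> \<bar>k\<bar> \<Longrightarrow> 1 * real_of_int \<bar>k\<bar> \<le> norm (shifted lam k)" for k
      using N1 N by auto
    have "2 * norm w \<le> norm (shifted lam k)" if "k \<in> I" "int N \<le> \<bar>k\<bar>" for k
    proof -
      have "2 * norm w \<le> real N" using w N' by linarith
      also have "\<dots> \<le> real_of_int \<bar>k\<bar>" using that by linarith
      finally show ?thesis using K[OF that] by simp
    qed
    from window_log[OF N(2) this] obtain T where T: "P M w = P N w * exp T"
      "norm T \<le> norm w * norm (s M - s N) + 2 * (norm w)\<^sup>2 * Q N M" by blast
    have "norm w * norm (s M - s N) \<le> r * (d / (2 * r))"
      using w N2[of M N] N assms by (intro mult_mono) auto
    moreover have "2 * (norm w)\<^sup>2 * Q N M \<le> 2 * r\<^sup>2 * (4 / (1\<^sup>2 * real N))"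
    proof (rule mult_mono)
      show "Q N M \<le> 4 / (1\<^sup>2 * real N)"
        by (rule Q_le[OF _ N'(3) N(2) K]) auto
      show "2 * (norm w)\<^sup>2 \<le> 2 * r\<^sup>2" using w by (simp add: power_mono)
    qed (auto intro: sum_nonneg)
    moreover have "2 * r\<^sup>2 * (4 / (1\<^sup>2 * real N)) \<le> d / 2"
    proof -
      have "16 * r\<^sup>2 < real N * d" using N'(2) assms(2) by (simp add: pos_divide_less_eq)
      then show ?thesis using N'(3) by (simp add: pos_divide_le_eq mult.commute)
    qed
    moreover have "r * (d / (2 * r)) = d / 2" using assms by simp
    ultimately have "norm T \<le> d" using T(2) by linarith
    then show "\<exists>T. P M w = P N w * exp T \<and> norm T \<le> d" using T(1) by blast
  qed
qed


private lemma window_product_convergent: "convergent (\<lambda>N. P N w)"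
proof -
  have r: "norm w + 1 > 0" by (simp add: add_nonneg_pos)
  obtain N1 where N1: "\<And>M. M \<ge> N1 \<Longrightarrow> \<exists>T. P M w = P N1 w * exp T \<and> norm T \<le> 1"
    using window_log_uniform[OF r zero_less_one] by (metis order_refl less_add_one less_imp_le)
  define B where "B = norm (P N1 w) * exp 1 + 1"
  have B: "B > 0" by (simp add: B_def add_nonneg_pos)
  have bd: "norm (P M w) \<le> B" if M: "M \<ge> N1" for M
  proof -
    obtain T where T: "P M w = P N1 w * exp T" "norm T \<le> 1" using N1[OF M] by blast
    show ?thesis using norm_mult_exp_le[OF T(2), of "P N1 w"] unfolding T(1) B_def by linarith
  qed
  have "Cauchy (\<lambda>N. P N w)"
  proof (rule CauchyI')
    fix e :: real assume e: "e > 0"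
    obtain d where d: "d > 0" "\<And>u::complex. norm u \<le> d \<Longrightarrow> norm (exp u - 1) < e / B"
      using exp_near_1[of "e / B"] e B by auto
    obtain N2 where N2: "\<And>N M. N \<ge> N2 \<Longrightarrow> M \<ge> N \<Longrightarrow> \<exists>T. P M w = P N w * exp T \<and> norm T \<le> d"
      using window_log_uniform[OF r d(1)] by (metis less_add_one less_imp_le)
    have "dist (P N w) (P M w) < e" if NM: "N \<ge> max N1 N2" "M > N" for N M
    proof -
      obtain T where T: "P M w = P N w * exp T" "norm T \<le> d" using N2[of N M] NM by auto
      have "P M w - P N w = P N w * (exp T - 1)" unfolding T(1) by (simp add: algebra_simps)
      then have "dist (P N w) (P M w) = norm (P N w) * norm (exp T - 1)"
        by (simp add: dist_norm norm_minus_commute[of "P N w"] norm_mult)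
      also have "\<dots> \<le> B * norm (exp T - 1)"
        using bd[of N] NM by (intro mult_right_mono) auto
      also have "\<dots> < B * (e / B)" using d(2)[OF T(2)] B by (intro mult_strict_left_mono) auto
      finally show ?thesis using B by simp
    qed
    then show "\<exists>N0. \<forall>N\<ge>N0. \<forall>M>N. dist (P N w) (P M w) < e" by blast
  qed
  then show ?thesis by (rule Cauchy_convergent)
qed

text \<open>The entire function that is the limit of the products over the windows.\<close>

definition "window_limit w = lim (\<lambda>N. P N w)"

private lemma window_limit: "(\<lambda>N. P N w) \<longlonglongrightarrow> window_limit w"
  unfolding window_limit_def using window_product_convergent convergent_LIMSEQ_iff by blast

private lemma window_limit_log_uniform:
  assumes "r > 0" "d > 0"
  shows "\<exists>N0. \<forall>N\<ge>N0. \<forall>w. norm w \<le> r \<longrightarrow> (\<exists>T. window_limit w = P N w * exp T \<and> norm T \<le> d)"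
proof -
  obtain N0 where N0: "\<And>N M w. N0 \<le> N \<Longrightarrow> N \<le> M \<Longrightarrow> norm w \<le> r \<Longrightarrow>
      \<exists>T. P M w = P N w * exp T \<and> norm T \<le> d"
    using window_log_uniform[OF assms] by blast
  have "\<exists>T. window_limit w = P N w * exp T \<and> norm T \<le> d" if N: "N \<ge> N0" and w: "norm w \<le> r" for N w
  proof -
    let ?S = "(\<lambda>T. P N w * exp T) ` cball 0 d"
    have "compact ?S"
      by (intro compact_continuous_image continuous_intros compact_cball)
    then have "closed ?S" by (rule compact_imp_closed)
    moreover have "\<forall>\<^sub>F M in sequentially. P M w \<in> ?S"
      using eventually_ge_at_top[of N]
    proof eventually_elim
      case (elim M)
      then show ?case using N0[OF N elim w] by (auto simp: image_iff)
    qed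
    ultimately have "window_limit w \<in> ?S"
      by (rule Lim_in_closed_set[OF _ _ sequentially_bot window_limit])
    then show ?thesis by auto
  qed
  then show ?thesis by blast
qed

private lemma window_limit_holomorphic: "window_limit holomorphic_on UNIV"
proof (rule holomorphic_uniform_sequence[OF open_UNIV])
  show "P N holomorphic_on UNIV" for N by (intro holomorphic_intros) auto
  fix x :: complex
  define r where "r = norm x + 1"
  have r: "r > 0" by (simp add: r_def add_nonneg_pos)
  obtain N1 where N1: "\<And>w. norm w \<le> r \<Longrightarrow> \<exists>T. window_limit w = P N1 w * exp T \<and> norm T \<le> 1"
    using window_limit_log_uniform[OF r zero_less_one] by blast
  have "compact (P N1 ` cball 0 r)"
    by (intro compact_continuous_image compact_cball continuous_intros) auto
  then have "bounded (P N1 ` cball 0 r)" by (rule compact_imp_bounded)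
  then obtain B0 where "\<forall>x\<in>P N1 ` cball 0 r. norm x \<le> B0" unfolding bounded_iff by blast
  then have B0: "norm (P N1 w) \<le> B0" if "norm w \<le> r" for w using that by simp
  define B where "B = \<bar>B0\<bar> * exp 1 + 1"
  have B: "B > 0" by (simp add: B_def add_nonneg_pos)
  have bd: "norm (window_limit w) \<le> B" if w: "norm w \<le> r" for w
  proof -
    obtain T where T: "window_limit w = P N1 w * exp T" "norm T \<le> 1" using N1[OF w] by blast
    have "norm (P N1 w) * exp 1 \<le> \<bar>B0\<bar> * exp 1"
      using B0[OF w] by (intro mult_right_mono) auto
    then show ?thesis using norm_mult_exp_le[OF T(2), of "P N1 w"] unfolding T(1) B_def by linarith
  qed
  have "uniform_limit (cball 0 r) P window_limit sequentially"
  proof (rule uniform_limitI)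
    fix e :: real assume e: "e > 0"
    obtain d where d: "d > 0" "\<And>u::complex. norm u \<le> d \<Longrightarrow> norm (exp u - 1) < e / B"
      using exp_near_1[of "e / B"] e B by auto
    obtain N2 where N2: "\<And>N w. N2 \<le> N \<Longrightarrow> norm w \<le> r \<Longrightarrow> \<exists>T. window_limit w = P N w * exp T \<and> norm T \<le> d"
      using window_limit_log_uniform[OF r d(1)] by blast
    have "dist (P N w) (window_limit w) < e" if "N2 \<le> N" "norm w \<le> r" for N w
    proof -
      obtain T where T: "window_limit w = P N w * exp T" "norm T \<le> d" using N2[OF \<open>N2 \<le> N\<close> \<open>norm w \<le> r\<close>] by blast
      have "P N w - window_limit w = window_limit w * (exp (- T) - 1)"
        unfolding T(1) by (simp add: algebra_simps flip: exp_add)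
      then have "dist (P N w) (window_limit w) = norm (window_limit w) * norm (exp (- T) - 1)"
        by (simp only: dist_norm norm_mult)
      also have "\<dots> \<le> B * norm (exp (- T) - 1)"
        using bd[OF \<open>norm w \<le> r\<close>] by (intro mult_right_mono) auto
      also have "\<dots> < B * (e / B)"
        using d(2)[of "- T"] T(2) B by (intro mult_strict_left_mono) auto
      finally show ?thesis using B by simp
    qed
    then show "\<forall>\<^sub>F N in sequentially. \<forall>w\<in>cball 0 r. dist (P N w) (window_limit w) < e"
      by (auto intro: eventually_mono[OF eventually_ge_at_top[of N2]])
  qed
  moreover have "cball x 1 \<subseteq> cball 0 r"
  proof
    fix w assume "w \<in> cball x 1"
    then show "w \<in> cball 0 r"
      using norm_triangle_ineq[of x "w - x"] by (simp add: r_def dist_norm norm_minus_commute)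
  qed
  ultimately have "uniform_limit (cball x 1) P window_limit sequentially"
    by (rule uniform_limit_on_subset)
  then show "\<exists>d>0. cball x d \<subseteq> UNIV \<and> uniform_limit (cball x d) P window_limit sequentially"
    by (intro exI[of _ 1]) auto
qed

text \<open>
  On the disc of radius \<open>R\<close>, the indices are split at \<open>N\<close>, which is about \<open>d * R\<close> for a small \<open>d\<close>. The near
  factors are bounded by \<open>1 + x \<le> exp (2 * sqrt x)\<close> with \<open>x\<close> at most \<open>R / (c * (\<bar>k\<bar> + 1))\<close>, so their product
  is at most \<open>exp (8 * sqrt (R * N / c))\<close>; \<open>window_log\<close> applies to the far factors.
\<close>

private lemma window_limit_zero_type: "zero_type window_limit"
proof (rule zero_typeI[OF window_limit_holomorphic, of 1])
  fix e :: real assume e: "e > 0"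
  obtain c where c: "c > 0" "\<And>k. k \<in> I \<Longrightarrow> c * (real_of_int \<bar>k\<bar> + 1) \<le> norm (shifted lam k)"
    using zeros_lower_bound by blast
  \<comment> \<open>The first bound makes \<open>8 * sqrt (2 * d / c)\<close> at most \<open>e / 4\<close>, the second one \<open>2 * d\<close> at most \<open>e / 4\<close>.\<close>
  define d where "d = min (c * e\<^sup>2 / 2048) (e / 8)"
  have d: "d > 0" "2048 * d \<le> c * e\<^sup>2" "8 * d \<le> e" using c e by (auto simp: d_def)
  \<comment> \<open>With this growth rate the zeros beyond the index \<open>d * R\<close> lie outside the disc of radius \<open>2 * R\<close>.\<close>
  define K where "K = 2 / d"
  have K: "K > 0" using d by (simp add: K_def)
  obtain N1 where N1: "\<And>k. k \<in> I \<Longrightarrow> int N1 \<le> \<bar>k\<bar> \<Longrightarrow> K * real_of_int \<bar>k\<bar> \<le> norm (shifted lam k)"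
    using zeros_grow[OF K] by blast
  have "Cauchy s" using sum_convergent by (rule convergent_Cauchy)
  then obtain N2 where N2: "\<And>m n. m \<ge> N2 \<Longrightarrow> n \<ge> N2 \<Longrightarrow> norm (s m - s n) < e / 4"
    using CauchyD[of s "e / 4"] e by auto
  have "norm (window_limit w) \<le> exp (e * R)"
    if R: "R \<ge> max (1 / d) (real (N1 + N2) / d)" and w: "norm w \<le> R" for R w
  proof -
    have R1: "1 \<le> d * R" "real (N1 + N2) \<le> d * R" using R d by (auto simp: field_simps)
    have Rpos: "R > 0" using R d by (smt (verit) divide_pos_pos max.cobounded1)
    define N where "N = nat \<lceil>d * R\<rceil>"
    have N: "d * R \<le> real N" "real N \<le> 2 * d * R" "N > 0" "N1 \<le> N" "N2 \<le> N"
      unfolding N_def using R1 by linarith+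
    have K': "K * real_of_int \<bar>k\<bar> \<le> norm (shifted lam k)" if "k \<in> I" "int N \<le> \<bar>k\<bar>" for k
      using N1[OF that(1)] that(2) N by linarith
    have far: "2 * norm w \<le> norm (shifted lam k)" if "k \<in> I" "int N \<le> \<bar>k\<bar>" for k
    proof -
      have "2 * R = K * (d * R)" using d by (simp add: K_def)
      also have "\<dots> \<le> K * real_of_int \<bar>k\<bar>"
        using K N(1) that by (intro mult_left_mono) linarith+
      also have "\<dots> \<le> norm (shifted lam k)" by (rule K'[OF that])
      finally show ?thesis using w by linarith
    qed
    have near: "norm (P N w) \<le> exp (e / 4 * R)"
    proof -
      have "norm (P N w) = (\<Prod>k\<in>W N. norm (1 - w / shifted lam k))" by (simp add: prod_norm)
      also have "\<dots> \<le> (\<Prod>k\<in>W N. exp (2 * sqrt (R / c) * (1 / sqrt (real_of_int \<bar>k\<bar> + 1))))"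
      proof (rule prod_mono, intro conjI)
        fix k assume "k \<in> W N"
        then have k: "k \<in> I" by (simp add: window_def)
        have pos: "c * (real_of_int \<bar>k\<bar> + 1) > 0" using c by (intro mult_pos_pos) auto
        define y where "y = sqrt (R / (c * (real_of_int \<bar>k\<bar> + 1)))"
        have y0: "y \<ge> 0" "y\<^sup>2 = R / (c * (real_of_int \<bar>k\<bar> + 1))"
          using Rpos pos by (auto simp: y_def)
        have "norm (1 - w / shifted lam k) \<le> 1 + norm w / norm (shifted lam k)"
          using norm_triangle_ineq4[of 1 "w / shifted lam k"] by (simp add: norm_divide)
        also have "norm w / norm (shifted lam k) \<le> R / (c * (real_of_int \<bar>k\<bar> + 1))"
          using w c(2)[OF k] pos Rpos by (intro frac_le) auto
        also have "1 + \<dots> \<le> exp (2 * y)"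
        proof -
          have "1 + 2 * y + (2 * y)\<^sup>2 / 2 \<le> exp (2 * y)"
            using y0 by (intro exp_lower_Taylor_quadratic) auto
          then have "1 + 2 * y + 2 * y\<^sup>2 \<le> exp (2 * y)" by (simp add: power_mult_distrib)
          then show ?thesis unfolding y0(2)[symmetric] using y0(1) zero_le_power2[of y] by linarith
        qed
        also have "2 * y = 2 * sqrt (R / c) * (1 / sqrt (real_of_int \<bar>k\<bar> + 1))"
          by (simp add: y_def real_sqrt_divide real_sqrt_mult)
        finally show "norm (1 - w / shifted lam k) \<le> exp (2 * sqrt (R / c) * (1 / sqrt (real_of_int \<bar>k\<bar> + 1)))"
          by simp
      qed simp
      also have "\<dots> = exp (2 * sqrt (R / c) * (\<Sum>k\<in>W N. 1 / sqrt (real_of_int \<bar>k\<bar> + 1)))"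
        by (simp only: exp_sum[OF finite_window, symmetric] sum_distrib_left)
      also have "\<dots> \<le> exp (2 * sqrt (R / c) * (4 * sqrt (2 * d * R)))"
      proof (subst exp_le_cancel_iff, rule mult_left_mono)
        have "(\<Sum>k\<in>W N. 1 / sqrt (real_of_int \<bar>k\<bar> + 1)) \<le>
            (\<Sum>k\<in>{k::int. \<bar>k\<bar> < int N}. 1 / sqrt (real_of_int \<bar>k\<bar> + 1))"
        proof (rule sum_mono2)
          show "finite {k::int. \<bar>k\<bar> < int N}"
            by (rule finite_subset[of _ "{- int N..int N}"]) auto
        qed (auto simp: window_def)
        also have "\<dots> \<le> 4 * sqrt (real N)" by (rule sum_inverse_sqrt_le)
        also have "\<dots> \<le> 4 * sqrt (2 * d * R)" using N by simp
        finally show "(\<Sum>k\<in>W N. 1 / sqrt (real_of_int \<bar>k\<bar> + 1)) \<le> 4 * sqrt (2 * d * R)" .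
      qed (use Rpos c in auto)
      also have "2 * sqrt (R / c) * (4 * sqrt (2 * d * R)) \<le> e / 4 * R"
      proof -
        have "sqrt (R / c) * sqrt (2 * d * R) = sqrt (R\<^sup>2 * (2 * d / c))"
          by (simp add: power2_eq_square algebra_simps flip: real_sqrt_mult)
        also have "\<dots> \<le> sqrt (R\<^sup>2 * (e / 32)\<^sup>2)"
          using d(2) c(1) by (intro real_sqrt_le_mono mult_left_mono) (auto simp: field_simps)
        also have "\<dots> = R * (e / 32)" using Rpos e by (simp add: real_sqrt_mult)
        finally show ?thesis by (simp add: algebra_simps)
      qed
      finally show ?thesis by simp
    qed
    have "norm (P M w) \<le> exp (e * R)" if M: "M \<ge> N" for M
    proof -
      obtain T where T: "P M w = P N w * exp T"
        "norm T \<le> norm w * norm (s M - s N) + 2 * (norm w)\<^sup>2 * Q N M"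
        using window_log[OF M far] by blast
      have "norm w * norm (s M - s N) \<le> R * (e / 4)"
        using w N2[of M N] N M e Rpos by (intro mult_mono) auto
      also have "\<dots> = e / 4 * R" by simp
      finally have 1: "norm w * norm (s M - s N) \<le> e / 4 * R" .
      have "2 * (norm w)\<^sup>2 * Q N M \<le> 2 * R\<^sup>2 * (4 / (K\<^sup>2 * real N))"
      proof (rule mult_mono)
        show "Q N M \<le> 4 / (K\<^sup>2 * real N)" by (rule Q_le[OF K N(3) M K'])
        show "2 * (norm w)\<^sup>2 \<le> 2 * R\<^sup>2" using w by (simp add: power_mono)
      qed (auto intro: sum_nonneg)
      also have "2 * R\<^sup>2 * (4 / (K\<^sup>2 * real N)) \<le> 2 * R\<^sup>2 * (4 / (K\<^sup>2 * (d * R)))"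
        using N K d Rpos by (intro mult_left_mono divide_left_mono mult_pos_pos) auto
      also have "\<dots> = 2 * d * R"
        using d Rpos by (simp add: K_def power2_eq_square field_simps)
      also have "\<dots> \<le> e / 4 * R" using d Rpos by (intro mult_right_mono) auto
      finally have "norm T \<le> e / 4 * R + e / 4 * R"
        by (rule order_trans[OF T(2) add_mono[OF 1]])
      then have "norm T \<le> e / 2 * R" by (simp add: mult.commute)
      then have "norm (P N w * exp T) \<le> norm (P N w) * exp (e / 2 * R)" by (rule norm_mult_exp_le)
      also have "\<dots> \<le> exp (e / 4 * R) * exp (e / 2 * R)"
        using near by (intro mult_right_mono) auto
      also have "\<dots> = exp (3 / 4 * e * R)" by (simp add: exp_add[symmetric])
      also have "\<dots> \<le> exp (e * R)" using e Rpos by simp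
      finally show ?thesis unfolding T(1) .
    qed
    then have ev: "\<forall>\<^sub>F M in sequentially. norm (P M w) \<le> exp (e * R)"
      by (auto simp: eventually_sequentially)
    show ?thesis
      by (rule tendsto_upperbound[OF tendsto_norm[OF window_limit] ev sequentially_bot])
  qed
  then show "\<forall>\<^sub>F R in at_top. \<forall>w. norm w \<le> 1 * R \<longrightarrow> norm (window_limit w) \<le> exp (e * R)"
    unfolding eventually_at_top_linorder by (metis mult_1)
qed simp

text \<open>
  Near each point the limit is a finite product times an exponential; this yields its zeros and,
  through a lower bound for the difference quotient, their simplicity.
\<close>

lemma window_limit_enumerated_zeros: "enumerated_zeros window_limit I lam"
proof -
  have zeros: "window_limit w = 0 \<longleftrightarrow> w \<in> shifted lam ` I" for w
  proof -
    have r: "norm w + 1 > 0" by (simp add: add_nonneg_pos)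
    obtain N0 where N0: "\<And>N. N \<ge> N0 \<Longrightarrow> \<exists>T. window_limit w = P N w * exp T \<and> norm T \<le> 1"
      using window_limit_log_uniform[OF r zero_less_one] by (metis less_add_one less_imp_le)
    have P0: "P N w = 0 \<longleftrightarrow> w \<in> shifted lam ` window I 0 N" for N
      by (auto simp: prod_zero_iff[OF finite_window])
    show ?thesis
    proof
      assume "window_limit w = 0"
      then have "P N0 w = 0" using N0[of N0] by auto
      then show "w \<in> shifted lam ` I" using P0[of N0] by (auto simp: window_def)
    next
      assume "w \<in> shifted lam ` I"
      then obtain k where k: "k \<in> I" "w = shifted lam k" by blast
      define N where "N = max N0 (nat \<bar>k\<bar> + 1)"
      have "k \<in> window I 0 N" using k by (auto simp: window_def N_def)
      then have "P N w = 0" using k P0[of N] by blast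
      then show "window_limit w = 0" using N0[of N] by (auto simp: N_def)
    qed
  qed
  have "deriv window_limit a \<noteq> 0" if a0: "window_limit a = 0" for a
  proof
    assume da: "deriv window_limit a = 0"
    obtain n where n: "n \<in> I" "a = shifted lam n" using zeros a0 by blast
    have r: "norm a + 1 > 0" by (simp add: add_nonneg_pos)
    obtain N0 where N0: "\<And>N w. N \<ge> N0 \<Longrightarrow> norm w \<le> norm a + 1 \<Longrightarrow>
        \<exists>T. window_limit w = P N w * exp T \<and> norm T \<le> 1"
      using window_limit_log_uniform[OF r zero_less_one] by blast
    define N where "N = max N0 (nat \<bar>n\<bar> + 1)"
    have nW: "n \<in> window I 0 N" using n by (auto simp: window_def N_def)
    define q where "q w = (\<Prod>k\<in>window I 0 N - {n}. 1 - w / shifted lam k)" for w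
    have Pq: "P N w = (1 - w / a) * q w" for w
      unfolding q_def n(2) by (rule prod.remove[OF finite_window nW])
    have qa: "q a \<noteq> 0"
    proof -
      have "1 - a / shifted lam k \<noteq> 0" if "k \<in> window I 0 N - {n}" for k
        using discrete_sequence_inj_on[OF disc] n that by (auto simp: window_def inj_on_def)
      then show ?thesis by (simp add: q_def prod_zero_iff finite_window)
    qed
    have a: "a \<noteq> 0" using n by simp
    have lower: "norm (q w) / (norm a * exp 1) \<le> norm (window_limit w / (w - a))"
      if w: "norm w \<le> norm a + 1" "w \<noteq> a" for w
    proof -
      obtain T where T: "window_limit w = P N w * exp T" "norm T \<le> 1"
        using N0[of N w] w by (auto simp: N_def)
      have "window_limit w / (w - a) = - (q w * exp T / a)"
        unfolding T(1) Pq using w a by (simp add: field_simps)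
      then have eq: "norm (window_limit w / (w - a)) = norm (q w) * exp (Re T) / norm a"
        by (simp add: norm_divide norm_mult)
      have "exp (-1) \<le> exp (Re T)" using T(2) abs_Re_le_cmod[of T] by simp
      then have "norm (q w) * exp (-1) / norm a \<le> norm (q w) * exp (Re T) / norm a"
        by (intro divide_right_mono mult_left_mono) auto
      then show ?thesis unfolding eq by (simp add: exp_minus field_simps)
    qed
    have "(window_limit has_field_derivative deriv window_limit a) (at a)"
      by (rule holomorphic_derivI[OF window_limit_holomorphic open_UNIV]) simp
    then have "((\<lambda>w. window_limit w / (w - a)) \<longlongrightarrow> 0) (at a)"
      by (simp add: has_field_derivative_iff a0 da)
    then have "((\<lambda>w. norm (window_limit w / (w - a))) \<longlongrightarrow> 0) (at a)"
      by (rule tendsto_norm_zero)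
    moreover have "((\<lambda>w. norm (q w) / (norm a * exp 1)) \<longlongrightarrow> norm (q a) / (norm a * exp 1)) (at a)"
      unfolding q_def using a by (intro tendsto_intros) auto
    moreover have "\<forall>\<^sub>F w in at a. norm (q w) / (norm a * exp 1) \<le> norm (window_limit w / (w - a))"
      unfolding eventually_at
    proof (intro exI[of _ 1] conjI ballI impI)
      fix w assume "w \<noteq> a \<and> dist w a < 1"
      then show "norm (q w) / (norm a * exp 1) \<le> norm (window_limit w / (w - a))"
        using norm_triangle_ineq2[of w a] by (intro lower) (auto simp: dist_norm)
    qed simp
    ultimately have "norm (q a) / (norm a * exp 1) \<le> 0"
      by (intro tendsto_le[of "at a"]) auto
    then show False using qa a by (simp add: divide_le_0_iff not_le mult_le_0_iff)
  qed
  moreover have "window_limit 0 = 1"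
    using window_limit[of 0] by (simp add: LIMSEQ_const_iff)
  ultimately show ?thesis
    using window_limit_zero_type zeros disc by (auto simp: enumerated_zeros_def)
qed

end

section \<open>Atomic signed measures\<close>

text \<open>The positive measure with mass \<open>g n\<close> at \<open>lam n\<close>, as an image of a measure on the index set.\<close>

definition atomic_measure :: "int set \<Rightarrow> (int \<Rightarrow> real) \<Rightarrow> (int \<Rightarrow> real) \<Rightarrow> real measure" where
  "atomic_measure I lam g = distr (density (count_space I) (\<lambda>n. ennreal (g n))) borel lam"

text \<open>The signed set function with masses \<open>c n\<close> at \<open>lam n\<close>.\<close>

definition atomic_set_function :: "int set \<Rightarrow> (int \<Rightarrow> real) \<Rightarrow> (int \<Rightarrow> real) \<Rightarrow> real set \<Rightarrow> real" where
  "atomic_set_function I lam c B = (\<Sum>\<^sub>\<infinity>n\<in>I. c n * indicator B (lam n))"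

lemma sets_atomic_measure [simp]: "sets (atomic_measure I lam g) = sets borel"
  and space_atomic_measure [simp]: "space (atomic_measure I lam g) = UNIV"
  by (simp_all add: atomic_measure_def)

lemma summable_on_mult_indicator:
  fixes c :: "int \<Rightarrow> real"
  assumes "(\<lambda>n. \<bar>c n\<bar>) summable_on I"
  shows "(\<lambda>n. \<bar>c n * indicator B (lam n)\<bar>) summable_on I" "(\<lambda>n. c n * indicator B (lam n)) summable_on I"
proof -
  show 1: "(\<lambda>n. \<bar>c n * indicator B (lam n)\<bar>) summable_on I"
    by (rule summable_on_comparison_test[OF assms]) (auto simp: indicator_def)
  show "(\<lambda>n. c n * indicator B (lam n)) summable_on I"
    by (rule abs_summable_summable) (use 1 in simp)
qed

lemma emeasure_atomic_measure:
  assumes nn: "\<And>n. g n \<ge> 0" and sm: "g summable_on I" and B: "B \<in> sets borel"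
  shows "emeasure (atomic_measure I lam g) B = ennreal (atomic_set_function I lam g B)"
proof -
  have sm': "(\<lambda>n. \<bar>g n\<bar>) summable_on I" using nn sm by simp
  have "emeasure (atomic_measure I lam g) B =
      emeasure (density (count_space I) (\<lambda>n. ennreal (g n))) (lam -` B \<inter> I)"
    unfolding atomic_measure_def using B by (subst emeasure_distr) auto
  also have "\<dots> = (\<integral>\<^sup>+n. ennreal (g n) * indicator (lam -` B \<inter> I) n \<partial>count_space I)"
    by (subst emeasure_density) auto
  also have "\<dots> = (\<integral>\<^sup>+n. ennreal (g n * indicator B (lam n)) \<partial>count_space I)"
    by (rule nn_integral_cong) (auto simp: indicator_def)
  also have "\<dots> = ennreal (infsetsum (\<lambda>n. g n * indicator B (lam n)) I)"
    by (rule nn_integral_conv_infsetsum)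
      (use nn summable_on_mult_indicator(1)[OF sm', of B lam] in
        \<open>auto simp: abs_summable_equivalent[symmetric]\<close>)
  also have "infsetsum (\<lambda>n. g n * indicator B (lam n)) I = atomic_set_function I lam g B"
    unfolding atomic_set_function_def
    by (rule infsetsum_infsum)
      (use summable_on_mult_indicator(1)[OF sm', of B lam] in
        \<open>auto simp: abs_summable_equivalent[symmetric]\<close>)
  finally show ?thesis .
qed

lemma atomic_set_function_nonneg: "(\<And>n. g n \<ge> 0) \<Longrightarrow> atomic_set_function I lam g B \<ge> 0"
  unfolding atomic_set_function_def by (intro infsum_nonneg) auto

lemma finite_atomic_measure:
  assumes "\<And>n. g n \<ge> 0" "g summable_on I"
  shows "finite_measure (atomic_measure I lam g)"
  by (rule finite_measureI) (simp add: emeasure_atomic_measure[OF assms])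

lemma measure_atomic_measure:
  assumes "\<And>n. g n \<ge> 0" "g summable_on I" "B \<in> sets borel"
  shows "measure (atomic_measure I lam g) B = atomic_set_function I lam g B"
  using emeasure_atomic_measure[OF assms] atomic_set_function_nonneg[of g, OF assms(1)]
  by (simp add: measure_def)

lemma summable_on_parts:
  fixes c :: "int \<Rightarrow> real"
  assumes "(\<lambda>n. \<bar>c n\<bar>) summable_on I"
  shows "(\<lambda>n. max (c n) 0) summable_on I" "(\<lambda>n. max (- c n) 0) summable_on I"
  by (rule summable_on_comparison_test[OF assms]; auto)+

lemma atomic_set_function_parts:
  assumes sm: "(\<lambda>n. \<bar>c n\<bar>) summable_on I"
  shows "atomic_set_function I lam c B =
    atomic_set_function I lam (\<lambda>n. max (c n) 0) B - atomic_set_function I lam (\<lambda>n. max (- c n) 0) B"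
proof -
  have "(\<Sum>\<^sub>\<infinity>n\<in>I. max (c n) 0 * indicator B (lam n) + - (max (- c n) 0 * indicator B (lam n))) =
      (\<Sum>\<^sub>\<infinity>n\<in>I. max (c n) 0 * indicator B (lam n)) + (\<Sum>\<^sub>\<infinity>n\<in>I. - (max (- c n) 0 * indicator B (lam n)))"
    using summable_on_parts[OF sm]
    by (intro infsum_add summable_on_uminus[THEN iffD2] summable_on_mult_indicator(2)) auto
  moreover have "max (c n) 0 * indicator B (lam n) + - (max (- c n) 0 * indicator B (lam n)) =
      c n * indicator B (lam n)" for n
    by (auto simp: max_def indicator_def)
  ultimately show ?thesis by (simp add: atomic_set_function_def infsum_uminus)
qed

lemma finite_signed_measure_atomic:
  assumes sm: "(\<lambda>n. \<bar>c n\<bar>) summable_on I"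
  shows "finite_signed_measure (atomic_set_function I lam c)"
  unfolding finite_signed_measure_def
proof (intro conjI allI impI)
  show "atomic_set_function I lam c {} = 0" by (simp add: atomic_set_function_def)
  fix B :: "nat \<Rightarrow> real set" assume B: "range B \<subseteq> sets borel" and disj: "disjoint_family B"
  let ?p = "\<lambda>n. max (c n) 0" and ?m = "\<lambda>n. max (- c n) 0"
  have *: "(\<lambda>i. atomic_set_function I lam g (B i)) sums atomic_set_function I lam g (\<Union>i. B i)"
    if g: "\<And>n. g n \<ge> 0" "g summable_on I" for g
  proof -
    have "(\<lambda>i. measure (atomic_measure I lam g) (B i)) sums measure (atomic_measure I lam g) (\<Union>i. B i)"
      by (rule finite_measure.finite_measure_UNION[OF finite_atomic_measure[OF g]])
        (use B disj in auto)
    moreover have "B i \<in> sets borel" "(\<Union>i. B i) \<in> sets borel" for i using B by auto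
    ultimately show ?thesis by (simp add: measure_atomic_measure[OF g])
  qed
  show "(\<lambda>i. atomic_set_function I lam c (B i)) sums atomic_set_function I lam c (\<Union>i. B i)"
    unfolding atomic_set_function_parts[OF sm]
    by (intro sums_diff * summable_on_parts[OF sm]) auto
qed

text \<open>The supremum defining the positive variation is attained at the set of atoms with positive mass.\<close>

lemma positive_variation_atomic:
  assumes sm: "(\<lambda>n. \<bar>c n\<bar>) summable_on I" and inj: "inj_on lam I"
  shows "positive_variation (atomic_set_function I lam c) = atomic_measure I lam (\<lambda>n. max (c n) 0)"
proof -
  let ?p = "\<lambda>n. max (c n) 0"
  let ?m = "atomic_set_function I lam c"
  let ?V = "\<lambda>B. SUP A\<in>{A\<in>sets borel. A \<subseteq> B}. ennreal (?m A)"
  have p: "?p n \<ge> 0" for n by simp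
  have psm: "?p summable_on I" by (rule summable_on_parts[OF sm])
  have psm': "(\<lambda>n. \<bar>?p n\<bar>) summable_on I" using psm by simp
  have eq: "?V B = emeasure (atomic_measure I lam ?p) B"
    if B: "B \<in> sets borel" for B
  proof (rule antisym)
    show "?V B \<le> emeasure (atomic_measure I lam ?p) B"
      unfolding emeasure_atomic_measure[OF p psm B]
    proof (rule SUP_least)
      fix A assume "A \<in> {A\<in>sets borel. A \<subseteq> B}"
      then have "?m A \<le> atomic_set_function I lam ?p B"
        unfolding atomic_set_function_def
        by (intro infsum_mono summable_on_mult_indicator(2)[OF sm] summable_on_mult_indicator(2)[OF psm'])
          (auto simp: indicator_def)
      then show "ennreal (?m A) \<le> ennreal (atomic_set_function I lam ?p B)" by (rule ennreal_leI)
    qed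
    define A where "A = B \<inter> lam ` {n\<in>I. c n > 0}"
    have "countable (lam ` {n\<in>I. c n > 0})" by (intro countable_image) auto
    then have "lam ` {n\<in>I. c n > 0} \<in> sets borel"
      by (rule sets.countable[rotated]) auto
    then have A: "A \<in> {A\<in>sets borel. A \<subseteq> B}" using B by (auto simp: A_def)
    have "?m A = atomic_set_function I lam ?p B"
      unfolding atomic_set_function_def
    proof (rule infsum_cong)
      fix n assume n: "n \<in> I"
      have "lam n \<in> A \<longleftrightarrow> lam n \<in> B \<and> c n > 0"
        using inj n by (auto simp: A_def inj_on_def)
      then show "c n * indicator A (lam n) = max (c n) 0 * indicator B (lam n)"
        by (auto simp: indicator_def max_def)
    qed
    then have "emeasure (atomic_measure I lam ?p) B = ennreal (?m A)"
      by (simp add: emeasure_atomic_measure[OF p psm B])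
    also have "\<dots> \<le> ?V B"
      by (rule SUP_upper[OF A])
    finally show "emeasure (atomic_measure I lam ?p) B \<le> ?V B" .
  qed
  have "positive_variation ?m = measure_of UNIV (sets borel) (emeasure (atomic_measure I lam ?p))"
    unfolding positive_variation_def
  proof (rule measure_of_eq)
    fix B :: "real set" assume "B \<in> sigma_sets UNIV (sets borel)"
    then have "B \<in> sets borel" using sets.sigma_sets_eq[of "borel :: real measure"] by simp
    then show "?V B = emeasure (atomic_measure I lam ?p) B"
      by (rule eq)
  qed auto
  also have "\<dots> = atomic_measure I lam ?p"
    using measure_of_of_measure[of "atomic_measure I lam ?p"] by simp
  finally show ?thesis .
qed

lemma integral_atomic_measure:
  fixes f :: "real \<Rightarrow> complex"
  assumes g: "\<And>n. g n \<ge> 0" "g summable_on I" and f: "f \<in> borel_measurable borel"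
    and C: "\<And>n. n \<in> I \<Longrightarrow> norm (f (lam n)) \<le> C"
  shows "(LINT t|atomic_measure I lam g. f t) = (\<Sum>\<^sub>\<infinity>n\<in>I. of_real (g n) * f (lam n))"
    and "(\<lambda>n. of_real (g n) * f (lam n)) summable_on I"
proof -
  have sm: "(\<lambda>n. norm (of_real (g n) * f (lam n))) summable_on I"
    by (rule summable_on_comparison_test[OF summable_on_cmult_left[OF g(2), of C]])
      (use g C in \<open>auto simp: norm_mult intro!: mult_mono\<close>)
  show "(\<lambda>n. of_real (g n) * f (lam n)) summable_on I"
    by (rule abs_summable_summable[OF sm])
  have "(LINT t|atomic_measure I lam g. f t) = (LINT n|density (count_space I) (\<lambda>n. ennreal (g n)). f (lam n))"
    unfolding atomic_measure_def by (rule integral_distr) (use f in auto)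
  also have "\<dots> = (LINT n|count_space I. g n *\<^sub>R f (lam n))"
    by (rule integral_density) (use g in auto)
  also have "\<dots> = infsetsum (\<lambda>n. of_real (g n) * f (lam n)) I"
    by (simp add: infsetsum_def scaleR_conv_of_real)
  also have "\<dots> = (\<Sum>\<^sub>\<infinity>n\<in>I. of_real (g n) * f (lam n))"
    by (rule infsetsum_infsum) (use sm in \<open>simp add: abs_summable_equivalent[symmetric]\<close>)
  finally show "(LINT t|atomic_measure I lam g. f t) = (\<Sum>\<^sub>\<infinity>n\<in>I. of_real (g n) * f (lam n))" .
qed

lemma cauchy_integral_atomic:
  assumes d: "discrete_sequence I lam" and sm: "(\<lambda>n. \<bar>c n\<bar>) summable_on I"
    and z: "z \<notin> complex_of_real ` lam ` I"
  shows "cauchy_integral (atomic_set_function I lam c) z =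
    1 / of_real pi * (\<Sum>\<^sub>\<infinity>n\<in>I. of_real (c n) * (1 / (of_real (lam n) - z)))"
proof -
  let ?p = "\<lambda>n. max (c n) 0" and ?m = "\<lambda>n. max (- c n) 0"
  let ?f = "\<lambda>t. 1 / (complex_of_real t - z)"
  have inj: "inj_on lam I" by (rule discrete_sequence_inj_on[OF d])
  have sm': "(\<lambda>n. \<bar>- c n\<bar>) summable_on I" using sm by simp
  have neg: "(\<lambda>B. - atomic_set_function I lam c B) = atomic_set_function I lam (\<lambda>n. - c n)"
    by (simp add: atomic_set_function_def fun_eq_iff flip: infsum_uminus)
  define C where "C = 1 + (\<Sum>n\<in>{n\<in>I. \<bar>lam n\<bar> \<le> norm z + 1}. norm (?f (lam n)))"
  have C: "norm (?f (lam n)) \<le> C" if n: "n \<in> I" for n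
  proof (cases "\<bar>lam n\<bar> \<le> norm z + 1")
    case True
    have "norm (?f (lam n)) \<le> (\<Sum>n\<in>{n\<in>I. \<bar>lam n\<bar> \<le> norm z + 1}. norm (?f (lam n)))"
      by (rule member_le_sum) (use True n discrete_sequence_finite_bounded[OF d] in auto)
    then show ?thesis by (simp add: C_def)
  next
    case False
    then have "1 \<le> norm (complex_of_real (lam n) - z)"
      using norm_triangle_ineq2[of "complex_of_real (lam n)" z] by simp
    then have "norm (?f (lam n)) \<le> 1" by (simp add: norm_divide divide_le_eq_1)
    also have "1 \<le> C" unfolding C_def by (simp add: sum_nonneg)
    finally show ?thesis .
  qed
  have f: "?f \<in> borel_measurable borel" by measurable
  note ip = integral_atomic_measure[OF _ summable_on_parts(1)[OF sm] f C]
  note im = integral_atomic_measure[OF _ summable_on_parts(2)[OF sm] f C]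
  have "signed_integral (atomic_set_function I lam c) ?f =
      (\<Sum>\<^sub>\<infinity>n\<in>I. of_real (?p n) * ?f (lam n)) - (\<Sum>\<^sub>\<infinity>n\<in>I. of_real (?m n) * ?f (lam n))"
    unfolding signed_integral_def negative_variation_def neg
      positive_variation_atomic[OF sm inj] positive_variation_atomic[OF sm' inj]
    by (subst ip(1) im(1); simp)+
  also have "\<dots> = (\<Sum>\<^sub>\<infinity>n\<in>I. of_real (?p n) * ?f (lam n)) + (\<Sum>\<^sub>\<infinity>n\<in>I. - (of_real (?m n) * ?f (lam n)))"
    by (simp add: infsum_uminus)
  also have "\<dots> = (\<Sum>\<^sub>\<infinity>n\<in>I. of_real (?p n) * ?f (lam n) + - (of_real (?m n) * ?f (lam n)))"
    by (rule infsum_add[symmetric]) (intro summable_on_uminus[THEN iffD2] ip(2) im(2); simp)+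
  also have "\<dots> = (\<Sum>\<^sub>\<infinity>n\<in>I. of_real (c n) * ?f (lam n))"
    by (rule infsum_cong) (auto simp: max_def)
  finally show ?thesis unfolding cauchy_integral_def by simp
qed

lemma concentrated_on_atomic: "concentrated_on (atomic_set_function I lam c) (lam ` I)"
  unfolding concentrated_on_def atomic_set_function_def
  by (intro ballI impI infsum_0) (auto simp: indicator_def)

lemma characteristic_measure_eq:
  "characteristic_measure I lam =
     atomic_set_function I lam (\<lambda>n. (-1) powi n * exp (characteristic_sequence I lam n))"
  by (simp add: fun_eq_iff characteristic_measure_def atomic_set_function_def unit_point_mass_def)

section \<open>Alternation of signs\<close>

lemma prod_differences_sign:
  fixes lam :: "int \<Rightarrow> real"
  assumes "finite W" and mono: "\<And>k. k \<in> W \<Longrightarrow> lam k < lam n \<longleftrightarrow> k < n"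
  shows "(\<Prod>k\<in>W - {n}. lam k - lam n) =
    (-1) ^ card {k\<in>W. k < n} * (\<Prod>k\<in>W - {n}. \<bar>lam k - lam n\<bar>)"
proof -
  have "(\<Prod>k\<in>W - {n}. lam k - lam n) = (\<Prod>k\<in>W - {n}. (if k < n then -1 else 1) * \<bar>lam k - lam n\<bar>)"
  proof (rule prod.cong[OF refl])
    fix k assume "k \<in> W - {n}"
    then show "lam k - lam n = (if k < n then -1 else 1) * \<bar>lam k - lam n\<bar>"
      using mono[of k] by auto
  qed
  also have "\<dots> = (\<Prod>k\<in>W - {n}. if k < n then -1 else 1) * (\<Prod>k\<in>W - {n}. \<bar>lam k - lam n\<bar>)"
    by (rule prod.distrib)
  also have "(\<Prod>k\<in>W - {n}. if k < n then -1 else 1 :: real) = (\<Prod>k\<in>{k\<in>W. k < n}. -1)"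
    using assms(1) by (intro prod.mono_neutral_cong_right) auto
  finally show ?thesis by simp
qed

text \<open>A window is an interval of the index set, so moving \<open>n\<close> by one step changes the exponent by one.\<close>

lemma window_sign:
  assumes d: "discrete_sequence I lam" and n: "n \<in> window I 0 N" and l: "l \<in> window I 0 N"
  shows "(-1) ^ card {k\<in>window I 0 N. k < n} * (-1) powi n =
         (-1) ^ card {k\<in>window I 0 N. k < l} * ((-1) powi l :: complex)"
proof -
  have *: "(-1) ^ card {k\<in>window I 0 N. k < n} * (-1) powi n =
         (-1) ^ card {k\<in>window I 0 N. k < l} * ((-1) powi l :: complex)"
    if n: "n \<in> window I 0 N" and l: "l \<in> window I 0 N" and le: "n \<le> l" for n l
  proof -
    have "{n..<l} \<subseteq> I" using n l d by (auto simp: discrete_sequence_def window_def)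
    then have eq: "{k\<in>window I 0 N. k < l} = {k\<in>window I 0 N. k < n} \<union> {n..<l}"
      using n l le by (auto simp: window_def)
    have "finite {k\<in>window I 0 N. k < n}" by (rule finite_subset[OF _ finite_window]) auto
    then have "card ({k\<in>window I 0 N. k < n} \<union> {n..<l}) = card {k\<in>window I 0 N. k < n} + card {n..<l}"
      by (intro card_Un_disjoint) auto
    then have "card {k\<in>window I 0 N. k < l} = card {k\<in>window I 0 N. k < n} + nat (l - n)"
      unfolding eq by (simp only: card_atLeastLessThan_int)
    moreover have "(-1) ^ nat (l - n) * ((-1) powi l :: complex) = (-1) powi n"
      using le by (auto simp: power_int_minus_left minus_one_power_iff even_nat_iff)
    ultimately show ?thesis by (simp add: power_add mult.assoc)
  qed
  show ?thesis
  proof (cases "n \<le> l")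
    case True
    then show ?thesis by (rule *[OF n l])
  next
    case False
    then have "l \<le> n" by simp
    then show ?thesis by (rule *[OF l n, symmetric])
  qed
qed

text \<open>
  Up to the sign \<open>(-1) powi n\<close>, the derivatives at all zeros have the same argument. This holds for the
  products over windows, whose derivatives are real products divided by a common constant.
\<close>

lemma derivatives_alternate:
  assumes f: "enumerated_zeros f I lam" and n: "n \<in> I" and l: "l \<in> I"
  shows "deriv f (shifted lam n) * of_real (norm (deriv f (shifted lam l))) * (-1) powi n =
         deriv f (shifted lam l) * of_real (norm (deriv f (shifted lam n))) * (-1) powi l"
proof -
  have d: "discrete_sequence I lam" using f by (simp add: enumerated_zeros_def)
  have mono: "k \<in> I \<Longrightarrow> j \<in> I \<Longrightarrow> lam k < lam j \<longleftrightarrow> k < j" for k j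
    using d by (auto simp: discrete_sequence_def strict_mono_on_less)
  define y where "y j N = - (\<Prod>k\<in>window I 0 N - {j}. 1 - shifted lam j / shifted lam k) / shifted lam j" for j N
  have lim: "y j \<longlonglongrightarrow> deriv f (shifted lam j)" if "j \<in> I" for j
  proof -
    have "y j \<longlonglongrightarrow> - (- shifted lam j * deriv f (shifted lam j)) / shifted lam j"
      unfolding y_def[abs_def] by (intro tendsto_intros window_product_derivative[OF f that]) auto
    then show ?thesis by simp
  qed
  define t where "t j N = (\<Prod>k\<in>window I 0 N - {j}. \<bar>lam k - lam j\<bar>)" for j N
  define s where "s j N = (-1 :: complex) ^ card {k\<in>window I 0 N. k < j}" for j N
  define p where "p N = (\<Prod>k\<in>window I 0 N. shifted lam k)" for N
  have ev: "\<forall>\<^sub>F N in sequentially. y n N * of_real (norm (y l N)) * (-1) powi n =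
      y l N * of_real (norm (y n N)) * (-1) powi l"
    using eventually_in_window[OF n, of 0] eventually_in_window[OF l, of 0]
  proof eventually_elim
    case (elim N)
    have yj: "y j N = - (s j N * of_real (t j N) / p N)" if j: "j \<in> window I 0 N" for j
    proof -
      have "(\<Prod>k\<in>window I 0 N - {j}. lam k - lam j) =
          (-1) ^ card {k\<in>window I 0 N. k < j} * t j N"
        unfolding t_def using j by (intro prod_differences_sign finite_window mono) (auto simp: window_def)
      then have "(\<Prod>k\<in>window I 0 N - {j}. complex_of_real (lam k - lam j)) = s j N * of_real (t j N)"
        unfolding of_real_prod[symmetric] by (simp add: s_def)
      moreover have "p N = shifted lam j * (\<Prod>k\<in>window I 0 N - {j}. shifted lam k)"
        unfolding p_def by (rule prod.remove[OF finite_window j])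
      ultimately show ?thesis
        unfolding y_def one_minus_shifted_quotient prod_dividef by simp
    qed
    have t: "t j N \<ge> 0" for j by (simp add: t_def prod_nonneg)
    have ny: "norm (y j N) = t j N / norm (p N)" if "j \<in> window I 0 N" for j
      using t[of j] by (simp add: yj[OF that] norm_mult norm_divide s_def norm_power)
    have "s n N * (-1) powi n = s l N * (-1) powi l"
      unfolding s_def by (rule window_sign[OF d elim])
    then show ?case
      unfolding ny[OF elim(1)] ny[OF elim(2)] unfolding yj[OF elim(1)] yj[OF elim(2)]
      by (simp add: field_simps)
  qed
  have "(\<lambda>N. y n N * of_real (norm (y l N)) * (-1) powi n) \<longlonglongrightarrow>
      deriv f (shifted lam n) * of_real (norm (deriv f (shifted lam l))) * (-1) powi n"
    by (intro tendsto_intros lim n l)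
  moreover have "(\<lambda>N. y l N * of_real (norm (y n N)) * (-1) powi l) \<longlonglongrightarrow>
      deriv f (shifted lam l) * of_real (norm (deriv f (shifted lam n))) * (-1) powi l"
    by (intro tendsto_intros lim n l)
  then have "(\<lambda>N. y n N * of_real (norm (y l N)) * (-1) powi n) \<longlonglongrightarrow>
      deriv f (shifted lam l) * of_real (norm (deriv f (shifted lam n))) * (-1) powi l"
    by (rule Lim_transform_eventually) (use ev in \<open>auto elim: eventually_mono\<close>)
  ultimately show ?thesis by (rule LIMSEQ_unique)
qed

lemma inverse_derivatives:
  assumes f: "enumerated_zeros f I lam"
  shows "\<exists>c. \<forall>n\<in>I. 1 / deriv f (shifted lam n) =
     c * of_real ((-1) powi n * exp (characteristic_sequence I lam n))"
proof -
  have nz: "deriv f (shifted lam n) \<noteq> 0" if "n \<in> I" for n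
  proof -
    have "f (shifted lam n) = 0" using f that by (auto simp: enumerated_zeros_def)
    then show ?thesis using f by (simp add: enumerated_zeros_def)
  qed
  have "I \<noteq> {}" using f discrete_sequence_infinite by (force simp: enumerated_zeros_def)
  then obtain l where l: "l \<in> I" by blast
  let ?D = "\<lambda>n. deriv f (shifted lam n)"
  have "1 / ?D n = (of_real (norm (?D l)) * (-1) powi l / ?D l) *
      of_real ((-1) powi n * exp (characteristic_sequence I lam n))" if n: "n \<in> I" for n
  proof -
    have "?D n * of_real (norm (?D l)) * (-1) powi n * (-1) powi l =
        ?D l * of_real (norm (?D n)) * ((-1) powi l * (-1) powi l)"
      using derivatives_alternate[OF f n l] by (simp add: mult.assoc)
    also have "(-1) powi l * (-1) powi l = (1 :: complex)" by simp
    finally have "?D l * of_real (norm (?D n)) = ?D n * of_real (norm (?D l)) * (-1) powi n * (-1) powi l"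
      by simp
    then show ?thesis
      using nz[OF n] nz[OF l] by (simp add: exp_characteristic_sequence[OF f n] field_simps)
  qed
  then show ?thesis by blast
qed

section \<open>The two classes in terms of the characteristic sequence\<close>

text \<open>Bounds for a smaller type imply those for a larger one, so the infimum is 0 iff all types occur.\<close>

lemma exponential_type_eq_0_iff:
  "exponential_type F = 0 \<longleftrightarrow> (\<forall>e>0. \<exists>C. \<forall>z. norm (F z) \<le> C * exp (e * norm z))"
proof -
  let ?S = "{ereal a | a. 0 \<le> a \<and> (\<exists>C. \<forall>z. norm (F z) \<le> C * exp (a * norm z))}"
  have ge: "0 \<le> Inf ?S" by (rule Inf_greatest) auto
  show ?thesis
  proof
    assume 0: "exponential_type F = 0"
    show "\<forall>e>0. \<exists>C. \<forall>z. norm (F z) \<le> C * exp (e * norm z)"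
    proof (intro allI impI)
      fix e :: real assume "e > 0"
      then have "Inf ?S < ereal e" using 0 by (simp add: exponential_type_def)
      then obtain a C where a: "a < e" "\<forall>z. norm (F z) \<le> C * exp (a * norm z)"
        unfolding Inf_less_iff by auto
      have "norm (F z) \<le> \<bar>C\<bar> * exp (e * norm z)" for z
        using a(1) by (intro order_trans[OF a(2)[rule_format]] mult_mono) (auto intro: mult_right_mono)
      then show "\<exists>C. \<forall>z. norm (F z) \<le> C * exp (e * norm z)" by blast
    qed
  next
    assume *: "\<forall>e>0. \<exists>C. \<forall>z. norm (F z) \<le> C * exp (e * norm z)"
    have "Inf ?S \<le> 0"
    proof (rule ccontr)
      assume "\<not> Inf ?S \<le> 0"
      then have "0 < Inf ?S" by (simp only: not_le)
      then obtain e where e: "0 < ereal e" "ereal e < Inf ?S" using ereal_dense2 by blast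
      then have "Inf ?S \<le> ereal e" using * by (intro Inf_lower) auto
      then show False using e by simp
    qed
    then show "exponential_type F = 0" using ge by (simp add: exponential_type_def)
  qed
qed

lemma eventually_index_at_infinity_iff:
  "eventually P (index_at_infinity I) \<longleftrightarrow> finite {n\<in>I. \<not> P n}"
proof -
  have "eventually P (index_at_infinity I) \<longleftrightarrow> (\<exists>N. \<forall>n. N \<le> \<bar>n\<bar> \<longrightarrow> n \<in> I \<longrightarrow> P n)"
    by (simp add: index_at_infinity_def eventually_inf_principal eventually_filtercomap_at_top_linorder)
  also have "\<dots> \<longleftrightarrow> finite {n\<in>I. \<not> P n}"
  proof
    assume "\<exists>N. \<forall>n. N \<le> \<bar>n\<bar> \<longrightarrow> n \<in> I \<longrightarrow> P n"
    then obtain N where "\<And>n. N \<le> \<bar>n\<bar> \<Longrightarrow> n \<in> I \<Longrightarrow> P n" by blast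
    then have "{n\<in>I. \<not> P n} \<subseteq> {- N..N}" by force
    then show "finite {n\<in>I. \<not> P n}" by (rule finite_subset) auto
  next
    assume fin: "finite {n\<in>I. \<not> P n}"
    have "P n" if "1 + (\<Sum>k\<in>{n\<in>I. \<not> P n}. \<bar>k\<bar>) \<le> \<bar>n\<bar>" "n \<in> I" for n
    proof (rule ccontr)
      assume "\<not> P n"
      then have "\<bar>n\<bar> \<le> (\<Sum>k\<in>{n\<in>I. \<not> P n}. \<bar>k\<bar>)"
        using that(2) fin by (intro member_le_sum) auto
      then show False using that(1) by simp
    qed
    then show "\<exists>N. \<forall>n. N \<le> \<bar>n\<bar> \<longrightarrow> n \<in> I \<longrightarrow> P n" by blast
  qed
  finally show ?thesis .
qed

text \<open>Limits over the indices depend only on the set of elements of the sequence.\<close>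

lemma tendsto_index_at_infinity_iff:
  assumes "inj_on lam I"
  shows "((\<lambda>n. Q (lam n)) \<longlongrightarrow> l) (index_at_infinity I) \<longleftrightarrow>
    (\<forall>e>0. finite {x\<in>lam ` I. \<not> dist (Q x) l < e})"
proof -
  have "finite {n\<in>I. \<not> dist (Q (lam n)) l < e} \<longleftrightarrow> finite {x\<in>lam ` I. \<not> dist (Q x) l < e}" for e
  proof -
    have "{x\<in>lam ` I. \<not> dist (Q x) l < e} = lam ` {n\<in>I. \<not> dist (Q (lam n)) l < e}" by auto
    moreover have "inj_on lam {n\<in>I. \<not> dist (Q (lam n)) l < e}"
      by (rule inj_on_subset[OF assms]) auto
    ultimately show ?thesis by (simp add: finite_image_iff)
  qed
  then show ?thesis by (simp add: tendsto_iff eventually_index_at_infinity_iff)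
qed

lemma zero_sets_eq:
  assumes "zero_type_real_simple_zeros F J mu" "has_zero_set F (lam ` I)"
  shows "mu ` J = lam ` I"
proof -
  have "complex_of_real ` mu ` J = complex_of_real ` lam ` I"
    using assms by (simp add: zero_type_real_simple_zeros_def has_zero_set_def)
  then show ?thesis by (simp add: inj_image_eq_iff inj_of_real)
qed

text \<open>
  Membership in the classes provides some enumeration of the zeros, which may be replaced by a given
  one, as the conditions depend on the set of zeros only.
\<close>

lemma zero_type_real_simple_zeros_cong:
  assumes "zero_type_real_simple_zeros F J mu" "has_zero_set F (lam ` I)" "discrete_sequence I lam"
  shows "zero_type_real_simple_zeros F I lam"
proof -
  have eq: "mu ` J = lam ` I" by (rule zero_sets_eq[OF assms(1,2)])
  have "deriv F (complex_of_real (lam n)) \<noteq> 0" if "n \<in> I" for n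
  proof -
    have "lam n \<in> mu ` J" using that eq by blast
    then show ?thesis using assms(1) by (auto simp: zero_type_real_simple_zeros_def)
  qed
  then show ?thesis using assms by (auto simp: zero_type_real_simple_zeros_def)
qed

lemma hamburger_class_iff_decay:
  assumes d: "discrete_sequence I lam"
  shows "F \<in> hamburger_class \<and> has_zero_set F (lam ` I) \<longleftrightarrow>
    zero_type_real_simple_zeros F I lam \<and>
    (\<forall>a>0. ((\<lambda>n. \<bar>lam n\<bar> powr a / norm (deriv F (complex_of_real (lam n)))) \<longlongrightarrow> 0) (index_at_infinity I))"
proof -
  let ?Q = "\<lambda>a x. \<bar>x\<bar> powr a / norm (deriv F (complex_of_real x))"
  have "((\<lambda>n. ?Q a (lam n)) \<longlongrightarrow> 0) (index_at_infinity I)"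
    if F: "zero_type_real_simple_zeros F J mu" "has_zero_set F (lam ` I)"
      and lim: "((\<lambda>n. ?Q a (mu n)) \<longlongrightarrow> 0) (index_at_infinity J)" for J mu a
  proof -
    have inj: "inj_on mu J"
      using F(1) by (intro discrete_sequence_inj_on) (simp add: zero_type_real_simple_zeros_def)
    show ?thesis
      using lim unfolding tendsto_index_at_infinity_iff[OF inj, of "?Q a"]
        tendsto_index_at_infinity_iff[OF discrete_sequence_inj_on[OF d], of "?Q a"] zero_sets_eq[OF F] .
  qed
  moreover have "has_zero_set F (lam ` I)" if "zero_type_real_simple_zeros F I lam"
    using that by (simp add: zero_type_real_simple_zeros_def)
  ultimately show ?thesis
    unfolding hamburger_class_def using zero_type_real_simple_zeros_cong[OF _ _ d] by blast
qed

lemma krein_class_iff_summable: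
  assumes d: "discrete_sequence I lam"
  shows "F \<in> krein_zero_type_class \<and> has_zero_set F (lam ` I) \<longleftrightarrow>
    zero_type_real_simple_zeros F I lam \<and>
    (\<lambda>n. 1 / norm (deriv F (complex_of_real (lam n)))) summable_on I"
proof -
  let ?Q = "\<lambda>x. 1 / norm (deriv F (complex_of_real x))"
  have "(\<lambda>n. ?Q (lam n)) summable_on I"
    if F: "zero_type_real_simple_zeros F J mu" "has_zero_set F (lam ` I)"
      and sm: "(\<lambda>n. ?Q (mu n)) summable_on J" for J mu
  proof -
    have inj: "inj_on mu J"
      using F(1) by (intro discrete_sequence_inj_on) (simp add: zero_type_real_simple_zeros_def)
    have "?Q summable_on (mu ` J)"
      using sm by (simp add: summable_on_reindex[OF inj] o_def)
    then show ?thesis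
      by (simp add: zero_sets_eq[OF F] summable_on_reindex[OF discrete_sequence_inj_on[OF d]] o_def)
  qed
  moreover have "has_zero_set F (lam ` I)" if "zero_type_real_simple_zeros F I lam"
    using that by (simp add: zero_type_real_simple_zeros_def)
  ultimately show ?thesis
    unfolding krein_zero_type_class_def using zero_type_real_simple_zeros_cong[OF _ _ d] by blast
qed

lemma enumerated_zeros_of_zero_type_real_simple_zeros:
  assumes F: "zero_type_real_simple_zeros F I lam"
  defines "f \<equiv> \<lambda>w. 1 / F \<i> * F (w + \<i>)"
  shows "F \<i> \<noteq> 0" "enumerated_zeros f I lam"
    "\<And>n. deriv f (shifted lam n) = deriv F (of_real (lam n)) / F \<i>"
proof -
  have hol: "F holomorphic_on UNIV" and zeros: "{z. F z = 0} = complex_of_real ` lam ` I"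
    and nz: "\<And>n. n \<in> I \<Longrightarrow> deriv F (complex_of_real (lam n)) \<noteq> 0"
    using F by (auto simp: zero_type_real_simple_zeros_def transcendental_entire_def has_zero_set_def)
  show Fi: "F \<i> \<noteq> 0"
  proof
    assume "F \<i> = 0"
    then have "\<i> \<in> complex_of_real ` lam ` I" using zeros by blast
    then show False by (auto simp: complex_eq_iff)
  qed
  have zt: "zero_type F"
    using F by (simp add: zero_type_def zero_type_real_simple_zeros_def transcendental_entire_def
        exponential_type_eq_0_iff)
  have df: "deriv f w = deriv F (w + \<i>) / F \<i>" for w
  proof -
    have "(F has_field_derivative deriv F (w + \<i>)) (at (w + \<i>))"
      by (rule holomorphic_derivI[OF hol]) auto
    then have "((\<lambda>w. F (w + \<i>)) has_field_derivative deriv F (w + \<i>)) (at w)"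
      by (simp add: DERIV_shift)
    then have "(f has_field_derivative 1 / F \<i> * deriv F (w + \<i>)) (at w)"
      unfolding f_def by (rule DERIV_cmult)
    then show ?thesis by (simp add: DERIV_imp_deriv)
  qed
  show "deriv f (shifted lam n) = deriv F (of_real (lam n)) / F \<i>" for n
    by (simp add: df shifted_def)
  have "zero_type f" unfolding f_def by (rule zero_type_shift[OF zt])
  moreover have fz: "{a. f a = 0} = shifted lam ` I"
  proof (intro set_eqI iffI)
    fix a assume "a \<in> {a. f a = 0}"
    then have "F (a + \<i>) = 0" using Fi by (simp add: f_def)
    then obtain n where "n \<in> I" "a + \<i> = complex_of_real (lam n)" using zeros by blast
    then show "a \<in> shifted lam ` I" by (auto simp: shifted_def eq_diff_eq)
  next
    fix a assume "a \<in> shifted lam ` I"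
    then obtain n where "n \<in> I" "a + \<i> = complex_of_real (lam n)" by (auto simp: shifted_def)
    then have "F (a + \<i>) = 0" using zeros by auto
    then show "a \<in> {a. f a = 0}" by (simp add: f_def)
  qed
  moreover have "deriv f a \<noteq> 0" if "f a = 0" for a
  proof -
    have "a \<in> shifted lam ` I" using that fz by blast
    then obtain n where "n \<in> I" "a = shifted lam n" by blast
    then show ?thesis using nz Fi by (simp add: df shifted_def)
  qed
  ultimately show "enumerated_zeros f I lam"
    using F Fi by (simp add: enumerated_zeros_def zero_type_real_simple_zeros_def f_def)
qed

lemma zero_type_real_simple_zeros_unique:
  assumes F: "zero_type_real_simple_zeros F I lam" and G: "zero_type_real_simple_zeros G I lam"
  shows "\<exists>c. \<forall>z. G z = c * F z"
proof -
  have "1 / F \<i> * F z = 1 / G \<i> * G z" for z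
  proof -
    have "1 / F \<i> * F ((z - \<i>) + \<i>) = 1 / G \<i> * G ((z - \<i>) + \<i>)"
      using enumerated_zeros_of_zero_type_real_simple_zeros(2)[OF F]
        enumerated_zeros_of_zero_type_real_simple_zeros(2)[OF G]
      by (intro LIMSEQ_unique[OF window_product_tendsto window_product_tendsto])
    then show ?thesis by simp
  qed
  then have "G z = G \<i> / F \<i> * F z" for z
    using enumerated_zeros_of_zero_type_real_simple_zeros(1)[OF F]
      enumerated_zeros_of_zero_type_real_simple_zeros(1)[OF G]
    by (simp add: field_simps)
  then show ?thesis by blast
qed

text \<open>
  A limit of products over windows need not be real on the line, but its quotient by its value at a
  real point other than its zeros is, since the products have real quotients.
\<close>

lemma exists_zero_type_real_simple_zeros:
  assumes d: "discrete_sequence I lam" and bal: "balanced I lam" and zd: "zero_density (lam ` I)"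
  shows "\<exists>F. zero_type_real_simple_zeros F I lam"
proof -
  define f where "f = window_limit I lam"
  have f: "enumerated_zeros f I lam"
    unfolding f_def by (rule window_limit_enumerated_zeros[OF d bal zero_density_imp_sparse[OF d zd]])
  have zt: "zero_type f" and zeros: "{a. f a = 0} = shifted lam ` I"
    and simple: "\<And>a. f a = 0 \<Longrightarrow> deriv f a \<noteq> 0"
    using f by (auto simp: enumerated_zeros_def)
  have "countable (lam ` I)" by (intro countable_image) auto
  then obtain x0 where x0: "x0 \<notin> lam ` I"
    using uncountable_UNIV_real by (metis UNIV_eq_I)
  define k where "k = f (complex_of_real x0 - \<i>)"
  have k: "k \<noteq> 0"
  proof
    assume "k = 0"
    then have "complex_of_real x0 - \<i> \<in> shifted lam ` I" using zeros by (auto simp: k_def)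
    then show False using x0 by (auto simp: shifted_def)
  qed
  define F where "F z = 1 / k * f (z + - \<i>)" for z
  have ztF: "zero_type F" unfolding F_def[abs_def] by (rule zero_type_shift[OF zt])
  have hz: "has_zero_set F (lam ` I)"
    unfolding has_zero_set_def
  proof (intro set_eqI iffI)
    fix z assume "z \<in> {z. F z = 0}"
    then have "z + - \<i> \<in> shifted lam ` I" using zeros k by (auto simp: F_def)
    then show "z \<in> complex_of_real ` lam ` I" by (auto simp: shifted_def)
  next
    fix z assume "z \<in> complex_of_real ` lam ` I"
    then have "z + - \<i> \<in> shifted lam ` I" by (auto simp: shifted_def)
    then have "f (z + - \<i>) = 0" using zeros by blast
    then show "z \<in> {z. F z = 0}" by (simp add: F_def)
  qed
  have holf: "f holomorphic_on UNIV" and holF: "F holomorphic_on UNIV"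
    using zt ztF by (auto simp: zero_type_def)
  have der: "deriv F (complex_of_real (lam n)) \<noteq> 0" if n: "n \<in> I" for n
  proof -
    have "(f has_field_derivative deriv f (shifted lam n)) (at (complex_of_real (lam n) + - \<i>))"
      unfolding shifted_def diff_conv_add_uminus by (rule holomorphic_derivI[OF holf]) auto
    then have "((\<lambda>z. f (z + - \<i>)) has_field_derivative deriv f (shifted lam n)) (at (complex_of_real (lam n)))"
      by (simp only: DERIV_shift)
    then have "(F has_field_derivative 1 / k * deriv f (shifted lam n)) (at (complex_of_real (lam n)))"
      unfolding F_def[abs_def] by (rule DERIV_cmult)
    moreover have "deriv f (shifted lam n) \<noteq> 0" using n zeros by (intro simple) auto
    ultimately show ?thesis using k by (simp add: DERIV_imp_deriv)
  qed
  have real: "F (complex_of_real x) \<in> \<real>" for x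
  proof (rule Lim_in_closed_set[OF closed_complex_Reals _ sequentially_bot])
    let ?P = "\<lambda>N z. \<Prod>k\<in>window I 0 N. 1 - (complex_of_real z - \<i>) / shifted lam k"
    show "(\<lambda>N. ?P N x / ?P N x0) \<longlonglongrightarrow> F (complex_of_real x)"
      unfolding F_def using k tendsto_divide[OF window_product_tendsto[OF f, where m = 0 and w = "complex_of_real x - \<i>"]
        window_product_tendsto[OF f, where m = 0 and w = "complex_of_real x0 - \<i>"]]
      by (simp add: k_def)
    have fac: "1 - (complex_of_real z - \<i>) / shifted lam k = complex_of_real (lam k - z) / shifted lam k" for z k
    proof -
      have "shifted lam k - (complex_of_real z - \<i>) = complex_of_real (lam k - z)" by (simp add: shifted_def)
      then show ?thesis by (simp add: diff_divide_eq_iff flip: shifted_def)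
    qed
    have quot: "(A / a) / (B / a) = A / B" if "a \<noteq> 0" for A B a :: complex
      using that by (cases "B = 0") (auto simp: field_simps)
    have "?P N x / ?P N x0 = (\<Prod>k\<in>window I 0 N. complex_of_real ((lam k - x) / (lam k - x0)))" for N
      unfolding prod_dividef[symmetric] fac by (intro prod.cong refl) (simp only: quot shifted_nonzero of_real_divide not_False_eq_True)
    then show "\<forall>\<^sub>F N in sequentially. ?P N x / ?P N x0 \<in> \<real>"
      by (simp only: of_real_prod[symmetric]) simp
  qed
  have "transcendental_entire F"
    unfolding transcendental_entire_def
  proof (intro conjI holF notI)
    assume "\<exists>p. \<forall>z. F z = poly p z"
    then obtain p where p: "\<And>z. F z = poly p z" by blast
    have "F (complex_of_real x0) = 1" using k by (simp add: F_def k_def)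
    then have "p \<noteq> 0" using p by auto
    then have "finite {z. poly p z = 0}" by (rule poly_roots_finite)
    then have "finite (complex_of_real ` lam ` I)"
      using hz p by (simp add: has_zero_set_def)
    then have "finite (lam ` I)" by (rule finite_imageD) (auto intro: inj_onI)
    then show False
      using discrete_sequence_infinite[OF d] finite_imageD discrete_sequence_inj_on[OF d] by blast
  qed
  moreover have "exponential_type F = 0"
    using ztF by (simp add: exponential_type_eq_0_iff zero_type_def)
  ultimately have "zero_type_real_simple_zeros F I lam"
    using d hz real der by (simp add: zero_type_real_simple_zeros_def)
  then show ?thesis by blast
qed

lemma norm_derivative_eq:
  assumes F: "zero_type_real_simple_zeros F I lam" and n: "n \<in> I"
  shows "1 / norm (deriv F (of_real (lam n))) = exp (characteristic_sequence I lam n) / norm (F \<i>)"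
proof -
  note f = enumerated_zeros_of_zero_type_real_simple_zeros[OF F]
  show ?thesis
    unfolding exp_characteristic_sequence[OF f(2) n] f(3) using f(1) by (simp add: norm_divide)
qed

lemma filterlim_abs_at_infinity:
  assumes d: "discrete_sequence I lam"
  shows "filterlim (\<lambda>n. \<bar>lam n\<bar>) at_top (index_at_infinity I)"
  unfolding filterlim_at_top_dense
proof
  fix A
  show "\<forall>\<^sub>F n in index_at_infinity I. A < \<bar>lam n\<bar>"
    unfolding eventually_index_at_infinity_iff
    by (rule finite_subset[OF _ discrete_sequence_finite_bounded[OF d, of A]]) auto
qed

text \<open>
  Decay faster than every power is the same as negativity together with \<open>ln x / p\<close> tending to 0;
  in logarithmic form the former says that \<open>a * ln x + p\<close> tends to \<open>-\<infinity>\<close> for each \<open>a\<close>.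
\<close>

lemma rapid_decay_iff:
  fixes x p :: "'a \<Rightarrow> real"
  assumes inf: "filterlim x at_top F"
  shows "(\<forall>a>0. ((\<lambda>n. x n powr a * exp (p n)) \<longlongrightarrow> 0) F) \<longleftrightarrow>
    (\<forall>\<^sub>F n in F. p n < 0) \<and> ((\<lambda>n. ln (x n) / p n) \<longlongrightarrow> 0) F"
proof (intro iffI conjI allI impI)
  assume *: "\<forall>a>0. ((\<lambda>n. x n powr a * exp (p n)) \<longlongrightarrow> 0) F"
  have ev1: "\<forall>\<^sub>F n in F. 1 < x n" using inf by (simp add: filterlim_at_top_dense)
  have ev: "\<forall>\<^sub>F n in F. a * ln (x n) < - p n" if "a > 0" for a
  proof -
    have "\<forall>\<^sub>F n in F. x n powr a * exp (p n) < 1"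
      using *[rule_format, OF that] by (rule order_tendstoD) simp
    then show ?thesis using ev1
    proof eventually_elim
      case (elim n)
      then have "exp (a * ln (x n) + p n) < exp 0" by (simp add: powr_def exp_add)
      then show ?case unfolding exp_less_cancel_iff by simp
    qed
  qed
  show "\<forall>\<^sub>F n in F. p n < 0"
    using ev[OF zero_less_one] ev1
  proof eventually_elim
    case (elim n)
    then show ?case using ln_gt_zero[of "x n"] by linarith
  qed
  show "((\<lambda>n. ln (x n) / p n) \<longlongrightarrow> 0) F"
  proof (rule tendstoI)
    fix e :: real assume e: "e > 0"
    then have "\<forall>\<^sub>F n in F. 1 / e * ln (x n) < - p n" by (intro ev) simp
    then show "\<forall>\<^sub>F n in F. dist (ln (x n) / p n) 0 < e"
      using ev1
    proof eventually_elim
      case (elim n)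
      have l: "ln (x n) > 0" using elim by simp
      have "0 < 1 / e * ln (x n)" using l e by simp
      then have p: "- p n > 0" using elim by linarith
      have "ln (x n) < e * (- p n)" using elim(1) e by (simp add: field_simps)
      then have "ln (x n) / (- p n) < e" unfolding pos_divide_less_eq[OF p] .
      moreover have "dist (ln (x n) / p n) 0 = ln (x n) / (- p n)"
        using l p by (simp add: dist_norm abs_divide)
      ultimately show ?case by simp
    qed
  qed
next
  fix a :: real
  assume *: "(\<forall>\<^sub>F n in F. p n < 0) \<and> ((\<lambda>n. ln (x n) / p n) \<longlongrightarrow> 0) F" and a: "a > 0"
  have "\<forall>\<^sub>F n in F. - 1 / (a + 1) < ln (x n) / p n"
    using * a by (intro order_tendstoD(1)[where y = 0]) auto
  moreover have "\<forall>\<^sub>F n in F. 1 < x n" using inf by (simp add: filterlim_at_top_dense)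
  moreover have "\<forall>\<^sub>F n in F. p n < 0" using * by blast
  ultimately have le: "\<forall>\<^sub>F n in F. x n powr a * exp (p n) \<le> 1 / x n"
  proof eventually_elim
    case (elim n)
    have "(a + 1) * ln (x n) < - p n"
      using elim a by (simp add: field_simps)
    then have "exp (a * ln (x n) + p n) \<le> exp (- ln (x n))"
      by (simp add: algebra_simps)
    then show ?case using elim by (simp add: powr_def exp_add exp_minus divide_inverse)
  qed
  have lim: "((\<lambda>n. 1 / x n) \<longlongrightarrow> 0) F"
    by (rule tendsto_divide_0[OF tendsto_const filterlim_at_top_imp_at_infinity[OF inf]])
  show "((\<lambda>n. x n powr a * exp (p n)) \<longlongrightarrow> 0) F"
    by (rule tendsto_sandwich[OF _ le tendsto_const lim]) simp
qed

lemma hamburger_condition_iff_decay: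
  assumes d: "discrete_sequence I lam"
  shows "hamburger_condition I lam \<longleftrightarrow>
    (\<forall>a>0. ((\<lambda>n. \<bar>lam n\<bar> powr a * exp (characteristic_sequence I lam n)) \<longlongrightarrow> 0) (index_at_infinity I))"
  unfolding hamburger_condition_def
  by (rule rapid_decay_iff[OF filterlim_abs_at_infinity[OF d], symmetric])

lemma hamburger_class_iff:
  assumes d: "discrete_sequence I lam"
  shows "F \<in> hamburger_class \<and> has_zero_set F (lam ` I) \<longleftrightarrow>
    zero_type_real_simple_zeros F I lam \<and> hamburger_condition I lam"
proof -
  let ?at = "index_at_infinity I"
  let ?D = "\<lambda>a n. \<bar>lam n\<bar> powr a / norm (deriv F (complex_of_real (lam n)))" and ?G = "\<lambda>a n. \<bar>lam n\<bar> powr a * exp (characteristic_sequence I lam n)"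
  have "(?D a \<longlongrightarrow> 0) (?at) \<longleftrightarrow>
      (?G a \<longlongrightarrow> 0) (?at)"
    if F: "zero_type_real_simple_zeros F I lam" for a
  proof -
    have k: "F \<i> \<noteq> 0" by (rule enumerated_zeros_of_zero_type_real_simple_zeros(1)[OF F])
    have ev: "\<forall>\<^sub>F n in ?at. n \<in> I"
      by (simp add: eventually_index_at_infinity_iff)
    have eq: "\<forall>\<^sub>F n in ?at. ?D a n =
        1 / norm (F \<i>) * ?G a n"
      using ev
    proof eventually_elim
      case (elim n)
      have "?D a n =
          \<bar>lam n\<bar> powr a * (1 / norm (deriv F (complex_of_real (lam n))))" by simp
      then show ?case unfolding norm_derivative_eq[OF F elim] by simp
    qed
    have "(?D a \<longlongrightarrow> 0) (?at) \<longleftrightarrow>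
        ((\<lambda>n. 1 / norm (F \<i>) * ?G a n) \<longlongrightarrow> 0)
          (?at)"
      by (rule tendsto_cong[OF eq])
    also have "\<dots> \<longleftrightarrow> (?G a \<longlongrightarrow> 0) (?at)"
      using tendsto_mult_left_iff[of "1 / norm (F \<i>)" _ 0] k by simp
    finally show ?thesis .
  qed
  then show ?thesis
    unfolding hamburger_class_iff_decay[OF d] hamburger_condition_iff_decay[OF d] by blast
qed

lemma krein_class_iff:
  assumes d: "discrete_sequence I lam"
  shows "F \<in> krein_zero_type_class \<and> has_zero_set F (lam ` I) \<longleftrightarrow>
    zero_type_real_simple_zeros F I lam \<and> krein_condition I lam"
proof -
  have "(\<lambda>n. 1 / norm (deriv F (complex_of_real (lam n)))) summable_on I \<longleftrightarrow> krein_condition I lam"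
    if F: "zero_type_real_simple_zeros F I lam"
  proof -
    have k: "F \<i> \<noteq> 0" by (rule enumerated_zeros_of_zero_type_real_simple_zeros(1)[OF F])
    have "(\<lambda>n. 1 / norm (deriv F (complex_of_real (lam n)))) summable_on I \<longleftrightarrow>
        (\<lambda>n. exp (characteristic_sequence I lam n) * (1 / norm (F \<i>))) summable_on I"
      by (rule summable_on_cong) (simp add: norm_derivative_eq[OF F])
    also have "\<dots> \<longleftrightarrow> krein_condition I lam"
      unfolding krein_condition_def using k by (intro summable_on_cmult_left') simp
    finally show ?thesis .
  qed
  then show ?thesis unfolding krein_class_iff_summable[OF d] by blast
qed

lemma summable_inverse_squares:
  assumes f: "enumerated_zeros f I lam"
  shows "(\<lambda>n. 1 / (1 + (lam n)\<^sup>2)) summable_on I"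
proof (rule nonneg_bdd_above_summable_on)
  show "0 \<le> 1 / (1 + (lam n)\<^sup>2)" for n by simp
  have "convergent (\<lambda>N. \<Sum>k\<in>window I 0 N. 1 / shifted lam k)"
    using window_sum_tendsto[OF f] by (auto simp: convergent_def)
  then have "Bseq (\<lambda>N. \<Sum>k\<in>window I 0 N. 1 / shifted lam k)" by (rule convergent_imp_Bseq)
  then obtain B where B: "\<And>N. norm (\<Sum>k\<in>window I 0 N. 1 / shifted lam k) \<le> B"
    unfolding Bseq_def by blast
  show "bdd_above (sum (\<lambda>n. 1 / (1 + (lam n)\<^sup>2)) ` {A. A \<subseteq> I \<and> finite A})"
  proof (rule bdd_aboveI2)
    fix A assume "A \<in> {A. A \<subseteq> I \<and> finite A}"
    then have A: "A \<subseteq> I" "finite A" by auto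
    define N where "N = nat (\<Sum>k\<in>A. \<bar>k\<bar>) + 1"
    have "A \<subseteq> window I 0 N"
    proof
      fix k assume k: "k \<in> A"
      have "\<bar>k\<bar> \<le> (\<Sum>k\<in>A. \<bar>k\<bar>)" by (rule member_le_sum) (use k A in auto)
      then show "k \<in> window I 0 N" using k A by (auto simp: window_def N_def)
    qed
    then have "(\<Sum>n\<in>A. 1 / (1 + (lam n)\<^sup>2)) \<le> (\<Sum>n\<in>window I 0 N. 1 / (1 + (lam n)\<^sup>2))"
      by (intro sum_mono2 finite_window) auto
    also have "\<dots> = Im (\<Sum>k\<in>window I 0 N. 1 / shifted lam k)"
      unfolding Im_sum inverse_shifted by simp
    also have "\<dots> \<le> B" using B[of N] abs_Im_le_cmod[of "\<Sum>k\<in>window I 0 N. 1 / shifted lam k"] by linarith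
    finally show "(\<Sum>n\<in>A. 1 / (1 + (lam n)\<^sup>2)) \<le> B" .
  qed
qed

text \<open>The decay condition with exponent 2, together with the summability of the inverse squares.\<close>

lemma hamburger_condition_imp_krein_condition:
  assumes f: "enumerated_zeros f I lam" and h: "hamburger_condition I lam"
  shows "krein_condition I lam"
proof -
  have d: "discrete_sequence I lam" using f by (simp add: enumerated_zeros_def)
  let ?e = "\<lambda>n. exp (characteristic_sequence I lam n)"
  have "((\<lambda>n. \<bar>lam n\<bar> powr 2 * ?e n) \<longlongrightarrow> 0) (index_at_infinity I)"
    by (rule h[unfolded hamburger_condition_iff_decay[OF d], rule_format]) simp
  then have "\<forall>\<^sub>F n in index_at_infinity I. \<bar>lam n\<bar> powr 2 * ?e n < 1"
    by (rule order_tendstoD) simp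
  moreover have "\<forall>\<^sub>F n in index_at_infinity I. 1 < \<bar>lam n\<bar>"
    using filterlim_abs_at_infinity[OF d] by (simp add: filterlim_at_top_dense)
  ultimately have "\<forall>\<^sub>F n in index_at_infinity I. ?e n \<le> 2 * (1 / (1 + (lam n)\<^sup>2))"
  proof eventually_elim
    case (elim n)
    have "1 * 1 \<le> \<bar>lam n\<bar> * \<bar>lam n\<bar>" using elim(2) by (intro mult_mono) auto
    then have l: "1 \<le> (lam n)\<^sup>2" by (simp add: power2_eq_square)
    have le: "(lam n)\<^sup>2 * ?e n < 1" using elim by simp
    have "(1 + (lam n)\<^sup>2) * ?e n \<le> (2 * (lam n)\<^sup>2) * ?e n" using l by (intro mult_right_mono) auto
    also have "\<dots> = 2 * ((lam n)\<^sup>2 * ?e n)" by (simp only: mult.assoc)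
    also have "\<dots> \<le> 2" using le by linarith
    finally have "?e n * (1 + (lam n)\<^sup>2) \<le> 2" by (simp only: mult.commute)
    moreover have "1 + (lam n)\<^sup>2 > 0" by (simp add: add_pos_nonneg)
    ultimately have "?e n \<le> 2 / (1 + (lam n)\<^sup>2)" by (simp only: pos_le_divide_eq)
    then show ?case by simp
  qed
  then have fin: "finite {n\<in>I. \<not> ?e n \<le> 2 * (1 / (1 + (lam n)\<^sup>2))}" (is "finite ?E")
    unfolding eventually_index_at_infinity_iff .
  have "(\<lambda>n. 2 * (1 / (1 + (lam n)\<^sup>2))) summable_on (I - ?E)"
    by (intro summable_on_cmult_right summable_on_subset_banach[OF summable_inverse_squares[OF f]]) auto
  then have "?e summable_on (I - ?E)"
    by (rule summable_on_comparison_test) auto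
  moreover have "?e summable_on ?E" using fin by (rule summable_on_finite)
  ultimately have "?e summable_on ((I - ?E) \<union> ?E)" by (rule summable_on_Un_disjoint) auto
  moreover have "(I - ?E) \<union> ?E = I" by blast
  ultimately show ?thesis by (simp add: krein_condition_def)
qed

lemma constant_over_cauchy_integral_characteristic_measure:
  assumes F: "zero_type_real_simple_zeros F I lam" and kr: "krein_condition I lam"
  shows "constant_over_cauchy_integral F (characteristic_measure I lam) (lam ` I)"
proof -
  define f where "f w = 1 / F \<i> * F (w + \<i>)" for w
  have Fi: "F \<i> \<noteq> 0" and f: "enumerated_zeros f I lam"
    using enumerated_zeros_of_zero_type_real_simple_zeros[OF F] by (auto simp: f_def[abs_def])
  have zt: "zero_type f" and f0: "f 0 = 1" and simple: "\<forall>a. f a = 0 \<longrightarrow> deriv f a \<noteq> 0"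
    and zeros: "{a. f a = 0} = shifted lam ` I" and d: "discrete_sequence I lam"
    using f by (auto simp: enumerated_zeros_def)
  have inj: "inj_on (shifted lam) I" using discrete_sequence_inj_on[OF d] by (auto simp: inj_on_def)
  let ?s = "\<lambda>n. (-1) powi n * exp (characteristic_sequence I lam n)"
  obtain c where c: "\<And>n. n \<in> I \<Longrightarrow> 1 / deriv f (shifted lam n) = c * of_real (?s n)"
    using inverse_derivatives[OF f] by blast
  have "(\<lambda>n. 1 / norm (deriv f (shifted lam n))) summable_on I"
    using kr unfolding krein_condition_def
    by (subst summable_on_cong[of I _ "\<lambda>n. exp (characteristic_sequence I lam n)"])
      (simp_all add: exp_characteristic_sequence[OF f])
  then have sm: "(\<lambda>a. 1 / norm (deriv f a)) summable_on {a. f a = 0}"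
    unfolding zeros by (simp add: summable_on_reindex[OF inj] o_def)
  have sma: "(\<lambda>n. \<bar>?s n\<bar>) summable_on I"
    using kr by (simp add: krein_condition_def abs_mult power_int_abs)
  obtain l where l: "l \<in> I" using discrete_sequence_infinite[OF d] by (metis all_not_in_conv finite.emptyI)
  then have ex: "f (shifted lam l) = 0" using zeros by blast
  have Im: "Im a = -1" if "f a = 0" for a
  proof -
    have "a \<in> shifted lam ` I" using that zeros by blast
    then show ?thesis by (auto simp: shifted_def)
  qed
  have "F z = - (F \<i> / (c * of_real pi)) / cauchy_integral (characteristic_measure I lam) z"
    if z: "z \<notin> complex_of_real ` lam ` I" for z
  proof -
    have "z - \<i> \<notin> shifted lam ` I" using z by (auto simp: shifted_def)
    then have fz: "f (z - \<i>) \<noteq> 0" using zeros by blast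
    have "1 / f (z - \<i>) = (\<Sum>\<^sub>\<infinity>a\<in>shifted lam ` I. 1 / (deriv f a * (z - \<i> - a)))"
      using partial_fractions[OF zt f0 simple Im ex sm fz] unfolding zeros .
    also have "\<dots> = (\<Sum>\<^sub>\<infinity>n\<in>I. 1 / (deriv f (shifted lam n) * (z - \<i> - shifted lam n)))"
      by (simp add: infsum_reindex[OF inj] o_def)
    also have "\<dots> = (\<Sum>\<^sub>\<infinity>n\<in>I. - c * (of_real (?s n) * (1 / (of_real (lam n) - z))))"
    proof (rule infsum_cong)
      fix n assume n: "n \<in> I"
      have "1 / (deriv f (shifted lam n) * (z - \<i> - shifted lam n)) =
          1 / deriv f (shifted lam n) * (1 / (z - of_real (lam n)))"
        by (simp add: shifted_def)
      also have "\<dots> = - c * (of_real (?s n) * (1 / (of_real (lam n) - z)))"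
        unfolding c[OF n] minus_diff_eq[of "of_real (lam n)" z, symmetric] divide_minus_right by simp
      finally show "1 / (deriv f (shifted lam n) * (z - \<i> - shifted lam n)) =
          - c * (of_real (?s n) * (1 / (of_real (lam n) - z)))" .
    qed
    also have "\<dots> = - c * (\<Sum>\<^sub>\<infinity>n\<in>I. of_real (?s n) * (1 / (of_real (lam n) - z)))"
      by (rule infsum_cmult_right')
    also have "(\<Sum>\<^sub>\<infinity>n\<in>I. of_real (?s n) * (1 / (of_real (lam n) - z))) =
        of_real pi * cauchy_integral (characteristic_measure I lam) z"
      unfolding characteristic_measure_eq by (subst cauchy_integral_atomic[OF d sma z]) simp
    finally have "1 / f (z - \<i>) = - (c * of_real pi) * cauchy_integral (characteristic_measure I lam) z"
      by (simp add: mult.assoc)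
    then have "f (z - \<i>) = 1 / (- (c * of_real pi) * cauchy_integral (characteristic_measure I lam) z)"
      by (metis div_by_1 divide_divide_eq_right mult_1)
    moreover have "F z = F \<i> * f (z - \<i>)" using Fi by (simp add: f_def)
    ultimately show ?thesis by simp
  qed
  then show ?thesis unfolding constant_over_cauchy_integral_def by blast
qed

lemma zero_type_real_simple_zeros_imp_balanced_zero_density:
  assumes F: "zero_type_real_simple_zeros F I lam"
  shows "balanced I lam" "zero_density (lam ` I)"
  using enumerated_zeros_imp_balanced enumerated_zeros_imp_zero_density
    enumerated_zeros_of_zero_type_real_simple_zeros(2)[OF F] by blast+

text \<open>
  The statement for a class that is described by a condition \<open>Q\<close> on the characteristic sequence that
  implies summability.
\<close>

lemma class_theorem:
  assumes d: "discrete_sequence I lam"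
    and S: "\<And>F. F \<in> S \<and> has_zero_set F (lam ` I) \<longleftrightarrow> zero_type_real_simple_zeros F I lam \<and> Q"
    and Q: "\<And>F. zero_type_real_simple_zeros F I lam \<Longrightarrow> Q \<Longrightarrow> krein_condition I lam"
  shows "(\<exists>F\<in>S. has_zero_set F (lam ` I)) \<longleftrightarrow> balanced I lam \<and> zero_density (lam ` I) \<and> Q"
    and "balanced I lam \<and> zero_density (lam ` I) \<and> Q \<longrightarrow>
        unique_up_to_constant S (lam ` I) \<and>
        finite_signed_measure (characteristic_measure I lam) \<and>
        concentrated_on (characteristic_measure I lam) (lam ` I) \<and>
        (\<forall>F\<in>S. has_zero_set F (lam ` I) \<longrightarrow>
           constant_over_cauchy_integral F (characteristic_measure I lam) (lam ` I))"
      (is "?cond \<longrightarrow> ?concl")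
proof -
  show iff: "(\<exists>F\<in>S. has_zero_set F (lam ` I)) \<longleftrightarrow> balanced I lam \<and> zero_density (lam ` I) \<and> Q"
    using S exists_zero_type_real_simple_zeros[OF d]
      zero_type_real_simple_zeros_imp_balanced_zero_density by blast
  show "?cond \<longrightarrow> ?concl"
  proof
    assume cond: ?cond
    then obtain F where "F \<in> S" "has_zero_set F (lam ` I)" using iff by blast
    then have kr: "krein_condition I lam" using S Q by blast
    have "unique_up_to_constant S (lam ` I)"
      unfolding unique_up_to_constant_def
      using iff cond S zero_type_real_simple_zeros_unique by blast
    moreover have "finite_signed_measure (characteristic_measure I lam)"
      unfolding characteristic_measure_eq
      by (rule finite_signed_measure_atomic)
        (use kr in \<open>simp add: krein_condition_def abs_mult power_int_abs\<close>)
    moreover have "concentrated_on (characteristic_measure I lam) (lam ` I)"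
      unfolding characteristic_measure_eq by (rule concentrated_on_atomic)
    moreover have "\<forall>F\<in>S. has_zero_set F (lam ` I) \<longrightarrow>
           constant_over_cauchy_integral F (characteristic_measure I lam) (lam ` I)"
      using S constant_over_cauchy_integral_characteristic_measure kr by blast
    ultimately show ?concl by blast
  qed
qed

theorem proposition5p2:
  fixes I :: "int set" and lam :: "int \<Rightarrow> real"
  assumes "discrete_sequence I lam"
  shows
    "((\<exists>F\<in>hamburger_class. has_zero_set F (lam ` I)) \<longleftrightarrow>
        balanced I lam \<and> zero_density (lam ` I) \<and> hamburger_condition I lam) \<and>
     (balanced I lam \<and> zero_density (lam ` I) \<and> hamburger_condition I lam \<longrightarrow>
        unique_up_to_constant hamburger_class (lam ` I) \<and>
        finite_signed_measure (characteristic_measure I lam) \<and>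
        concentrated_on (characteristic_measure I lam) (lam ` I) \<and>
        (\<forall>F\<in>hamburger_class. has_zero_set F (lam ` I) \<longrightarrow>
           constant_over_cauchy_integral F (characteristic_measure I lam) (lam ` I))) \<and>
     ((\<exists>F\<in>krein_zero_type_class. has_zero_set F (lam ` I)) \<longleftrightarrow>
        balanced I lam \<and> zero_density (lam ` I) \<and> krein_condition I lam) \<and>
     (balanced I lam \<and> zero_density (lam ` I) \<and> krein_condition I lam \<longrightarrow>
        unique_up_to_constant krein_zero_type_class (lam ` I) \<and>
        finite_signed_measure (characteristic_measure I lam) \<and>
        concentrated_on (characteristic_measure I lam) (lam ` I) \<and>
        (\<forall>F\<in>krein_zero_type_class. has_zero_set F (lam ` I) \<longrightarrow>
           constant_over_cauchy_integral F (characteristic_measure I lam) (lam ` I)))"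
proof -
  have ham: "krein_condition I lam"
    if "zero_type_real_simple_zeros F I lam" "hamburger_condition I lam" for F
    using hamburger_condition_imp_krein_condition[OF
        enumerated_zeros_of_zero_type_real_simple_zeros(2)[OF that(1)] that(2)] .
  show ?thesis
    by (intro conjI class_theorem(1)[OF assms hamburger_class_iff[OF assms] ham]
        class_theorem(2)[OF assms hamburger_class_iff[OF assms] ham]
        class_theorem(1)[OF assms krein_class_iff[OF assms]]
        class_theorem(2)[OF assms krein_class_iff[OF assms]])
qed

end
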